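(* Let $S$ be a connected Riemann surface, $H:S\to S$ a non-constant holomorphic map, and $X\subseteq S$ a subset which is locally compact in the relative topology, has no isolated points and satisfies $H^{-1}(X)=X$. Then $G_X$ has a countable base for its topology, i.e. $G_X$ is a second countable étale locally compact Hausdorff groupoid.
   Context: The groupoid $G_X$. Let $\mathcal P$ be the set of homeomorphisms $\eta:U\to V$ between relatively open subsets of $X$ for which there are open sets $U_1,V_1\subseteq S$ and a bi-holomorphic map $\eta_1:U_1\to V_1$ with $U_1\cap X=U$, $V_1\cap X=V$ and $\eta=\eta_1|_U$. For $k\in\mathbb Z$ let $\mathcal T_k$ be the set of $\eta:U\to V$ in $\mathcal P$ for which there are natural numbers $n,m$ with $k=n-m$ and $H^n(z)=H^m(\eta(z))$ for all $z\in U$. $G_X$ is the set of classes $[x,k,\eta,y]$ of quadruples with $\eta\in\mathcal T_k$, $x$ in the domain of $\eta$, $\eta(x)=y$, where $(x,k,\eta,y)\sim(x',k',\eta',y')$ iff $x=x'$, $k=k'$, $y=y'$ and $\eta,\eta'$ agree in a neighbourhood of $x$ in $X$. Operations: $[x,k,\eta,y][y,k',\eta',y']=[x,k+k',\eta'\circ\eta,y']$, $[x,k,\eta,y]^{-1}=[y,-k,\eta^{-1},x]$; the unit space is identified with $X$ via $x\mapsto[x,0,\mathrm{id},x]$; range $r[x,k,\eta,y]=x$, source $s[x,k,\eta,y]=y$. The topology has as base the sets $\{[z,k,\eta,\eta(z)]:z\in U\}$, with $\eta\in\mathcal T_k$ and $U$ an open subset of the domain of $\eta$. *)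

theory Defs
  imports "HOL-Analysis.Analysis"
begin

section \<open>Riemann surfaces\<close>

definition complex_chart :: "'a topology \<Rightarrow> 'a set \<Rightarrow> ('a \<Rightarrow> complex) \<Rightarrow> bool" where
  "complex_chart S U \<phi> \<longleftrightarrow>
     openin S U \<and> open (\<phi> ` U) \<and>
     homeomorphic_map (subtopology S U) (top_of_set (\<phi> ` U)) \<phi>"

text \<open>
  A Riemann surface is a Hausdorff space with a holomorphic atlas. Neither connectedness nor a
  countable base is part of the definition. The atlas need not be maximal.
\<close>

definition riemann_surface :: "'a topology \<Rightarrow> ('a set \<times> ('a \<Rightarrow> complex)) set \<Rightarrow> bool" where
  "riemann_surface S \<A> \<longleftrightarrow>
     Hausdorff_space S \<and>
     (\<forall>(U, \<phi>) \<in> \<A>. complex_chart S U \<phi>) \<and>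
     (\<Union>(U, \<phi>) \<in> \<A>. U) = topspace S \<and>
     (\<forall>(U, \<phi>) \<in> \<A>. \<forall>(V, \<psi>) \<in> \<A>.
        (\<psi> \<circ> inv_into U \<phi>) holomorphic_on (\<phi> ` (U \<inter> V)))"

text \<open>Holomorphy of a map from the open subset \<open>D\<close> of the surface into the surface:\<close>

definition surface_holomorphic_on ::
    "'a topology \<Rightarrow> ('a set \<times> ('a \<Rightarrow> complex)) set \<Rightarrow> 'a set \<Rightarrow> ('a \<Rightarrow> 'a) \<Rightarrow> bool" where
  "surface_holomorphic_on S \<A> D f \<longleftrightarrow>
     openin S D \<and> continuous_map (subtopology S D) S f \<and>
     (\<forall>(U, \<phi>) \<in> \<A>. \<forall>(V, \<psi>) \<in> \<A>.
        (\<psi> \<circ> f \<circ> inv_into U \<phi>) holomorphic_on (\<phi> ` {z \<in> U \<inter> D. f z \<in> V}))"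

definition biholomorphic ::
    "'a topology \<Rightarrow> ('a set \<times> ('a \<Rightarrow> complex)) set \<Rightarrow> 'a set \<Rightarrow> 'a set \<Rightarrow> ('a \<Rightarrow> 'a) \<Rightarrow> bool" where
  "biholomorphic S \<A> U V f \<longleftrightarrow>
     bij_betw f U V \<and> surface_holomorphic_on S \<A> U f \<and>
     surface_holomorphic_on S \<A> V (inv_into U f)"

section \<open>The groupoid of a holomorphic map\<close>

text \<open>
  A map \<open>\<eta> : U \<rightarrow> V\<close> between subsets of \<open>X\<close> is a partial function with \<open>dom \<eta> = U\<close> and
  \<open>ran \<eta> = V\<close>, so \<open>\<eta>' \<circ>\<^sub>m \<eta>\<close> is composition on the largest possible domain.
\<close>

definition local_maps ::
    "'a topology \<Rightarrow> ('a set \<times> ('a \<Rightarrow> complex)) set \<Rightarrow> 'a set \<Rightarrow> ('a \<rightharpoonup> 'a) set" where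
  "local_maps S \<A> X =
     {\<eta>. openin (subtopology S X) (dom \<eta>) \<and> openin (subtopology S X) (ran \<eta>) \<and>
         homeomorphic_map (subtopology S (dom \<eta>)) (subtopology S (ran \<eta>)) (\<lambda>z. the (\<eta> z)) \<and>
         (\<exists>U\<^sub>1 V\<^sub>1 \<eta>\<^sub>1. openin S U\<^sub>1 \<and> openin S V\<^sub>1 \<and> biholomorphic S \<A> U\<^sub>1 V\<^sub>1 \<eta>\<^sub>1 \<and>
            U\<^sub>1 \<inter> X = dom \<eta> \<and> V\<^sub>1 \<inter> X = ran \<eta> \<and> (\<forall>z \<in> dom \<eta>. \<eta> z = Some (\<eta>\<^sub>1 z)))}"

definition local_transfers ::
    "'a topology \<Rightarrow> ('a set \<times> ('a \<Rightarrow> complex)) set \<Rightarrow> ('a \<Rightarrow> 'a) \<Rightarrow> 'a set \<Rightarrow> int \<Rightarrow> ('a \<rightharpoonup> 'a) set"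
  where
  "local_transfers S \<A> H X k =
     {\<eta> \<in> local_maps S \<A> X. \<exists>n m :: nat. k = int n - int m \<and>
        (\<forall>z \<in> dom \<eta>. (H ^^ n) z = (H ^^ m) (the (\<eta> z)))}"

type_synonym 'a quadruple = "'a \<times> int \<times> ('a \<rightharpoonup> 'a) \<times> 'a"

definition quadruples ::
    "'a topology \<Rightarrow> ('a set \<times> ('a \<Rightarrow> complex)) set \<Rightarrow> ('a \<Rightarrow> 'a) \<Rightarrow> 'a set \<Rightarrow> 'a quadruple set" where
  "quadruples S \<A> H X = {(x, k, \<eta>, y). \<eta> \<in> local_transfers S \<A> H X k \<and> \<eta> x = Some y}"

definition germ_rel ::
    "'a topology \<Rightarrow> ('a set \<times> ('a \<Rightarrow> complex)) set \<Rightarrow> ('a \<Rightarrow> 'a) \<Rightarrow> 'a set \<Rightarrow>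
     ('a quadruple \<times> 'a quadruple) set" where
  "germ_rel S \<A> H X =
     {((x, k, \<eta>, y), (x', k', \<eta>', y')).
        (x, k, \<eta>, y) \<in> quadruples S \<A> H X \<and> (x', k', \<eta>', y') \<in> quadruples S \<A> H X \<and>
        x = x' \<and> k = k' \<and> y = y' \<and>
        (\<exists>W. openin (subtopology S X) W \<and> x \<in> W \<and> W \<subseteq> dom \<eta> \<inter> dom \<eta>' \<and> (\<forall>z \<in> W. \<eta> z = \<eta>' z))}"

definition germ ::
    "'a topology \<Rightarrow> ('a set \<times> ('a \<Rightarrow> complex)) set \<Rightarrow> ('a \<Rightarrow> 'a) \<Rightarrow> 'a set \<Rightarrow>
     'a \<Rightarrow> int \<Rightarrow> ('a \<rightharpoonup> 'a) \<Rightarrow> 'a \<Rightarrow> 'a quadruple set" where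
  "germ S \<A> H X x k \<eta> y = germ_rel S \<A> H X `` {(x, k, \<eta>, y)}"

definition germs ::
    "'a topology \<Rightarrow> ('a set \<times> ('a \<Rightarrow> complex)) set \<Rightarrow> ('a \<Rightarrow> 'a) \<Rightarrow> 'a set \<Rightarrow> 'a quadruple set set" where
  "germs S \<A> H X = quadruples S \<A> H X // germ_rel S \<A> H X"

definition germ_range :: "'a quadruple set \<Rightarrow> 'a" where
  "germ_range g = (THE x. \<exists>k \<eta> y. (x, k, \<eta>, y) \<in> g)"

definition germ_source :: "'a quadruple set \<Rightarrow> 'a" where
  "germ_source g = (THE y. \<exists>x k \<eta>. (x, k, \<eta>, y) \<in> g)"

definition germ_mult ::
    "'a topology \<Rightarrow> ('a set \<times> ('a \<Rightarrow> complex)) set \<Rightarrow> ('a \<Rightarrow> 'a) \<Rightarrow> 'a set \<Rightarrow>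
     'a quadruple set \<Rightarrow> 'a quadruple set \<Rightarrow> 'a quadruple set" where
  "germ_mult S \<A> H X g h =
     (THE c. \<exists>x k \<eta> y k' \<eta>' y'. (x, k, \<eta>, y) \<in> g \<and> (y, k', \<eta>', y') \<in> h \<and>
        c = germ S \<A> H X x (k + k') (\<eta>' \<circ>\<^sub>m \<eta>) y')"

definition map_inverse :: "('a \<rightharpoonup> 'a) \<Rightarrow> ('a \<rightharpoonup> 'a)" where
  "map_inverse \<eta> = (\<lambda>y. if y \<in> ran \<eta> then Some (THE x. \<eta> x = Some y) else None)"

definition germ_inverse ::
    "'a topology \<Rightarrow> ('a set \<times> ('a \<Rightarrow> complex)) set \<Rightarrow> ('a \<Rightarrow> 'a) \<Rightarrow> 'a set \<Rightarrow>
     'a quadruple set \<Rightarrow> 'a quadruple set" where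
  "germ_inverse S \<A> H X g =
     (THE c. \<exists>x k \<eta> y. (x, k, \<eta>, y) \<in> g \<and> c = germ S \<A> H X y (- k) (map_inverse \<eta>) x)"

definition germ_unit ::
    "'a topology \<Rightarrow> ('a set \<times> ('a \<Rightarrow> complex)) set \<Rightarrow> ('a \<Rightarrow> 'a) \<Rightarrow> 'a set \<Rightarrow>
     'a \<Rightarrow> 'a quadruple set" where
  "germ_unit S \<A> H X x = germ S \<A> H X x 0 (Some |` X) x"

definition germ_base ::
    "'a topology \<Rightarrow> ('a set \<times> ('a \<Rightarrow> complex)) set \<Rightarrow> ('a \<Rightarrow> 'a) \<Rightarrow> 'a set \<Rightarrow>
     'a quadruple set set set" where
  "germ_base S \<A> H X =
     {(\<lambda>z. germ S \<A> H X z k \<eta> (the (\<eta> z))) ` U | k \<eta> U.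
        \<eta> \<in> local_transfers S \<A> H X k \<and> openin (subtopology S X) U \<and> U \<subseteq> dom \<eta>}"

definition germ_topology ::
    "'a topology \<Rightarrow> ('a set \<times> ('a \<Rightarrow> complex)) set \<Rightarrow> ('a \<Rightarrow> 'a) \<Rightarrow> 'a set \<Rightarrow>
     'a quadruple set topology" where
  "germ_topology S \<A> H X = topology (arbitrary union_of (\<lambda>B. B \<in> germ_base S \<A> H X))"

text \<open>
  The constant \<^const>\<open>topology\<close> only gives the intended open sets once the family
  is known to be a topology. This is \<open>openin_germ_topology\<close> below.
\<close>

lemma germ_rel_equiv: "equiv (quadruples S \<A> H X) (germ_rel S \<A> H X)"
proof (rule equivI)
  show "germ_rel S \<A> H X \<subseteq> quadruples S \<A> H X \<times> quadruples S \<A> H X"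
    by (auto simp: germ_rel_def)
  show "refl_on (quadruples S \<A> H X) (germ_rel S \<A> H X)"
  proof (rule refl_onI)
    fix q assume q: "q \<in> quadruples S \<A> H X"
    obtain x k \<eta> y where [simp]: "q = (x, k, \<eta>, y)" by (cases q) auto
    have "openin (subtopology S X) (dom \<eta>)" "x \<in> dom \<eta>"
      using q by (auto simp: quadruples_def local_transfers_def local_maps_def)
    then show "(q, q) \<in> germ_rel S \<A> H X"
      using q unfolding germ_rel_def by auto
  qed
  show "sym (germ_rel S \<A> H X)"
  proof (rule symI)
    fix p q assume "(p, q) \<in> germ_rel S \<A> H X"
    moreover obtain x k \<eta> y where p: "p = (x, k, \<eta>, y)" by (cases p) auto
    moreover obtain x' k' \<eta>' y' where q: "q = (x', k', \<eta>', y')" by (cases q) auto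
    ultimately obtain W where
      W: "openin (subtopology S X) W" "x \<in> W" "W \<subseteq> dom \<eta> \<inter> dom \<eta>'" "\<forall>z \<in> W. \<eta> z = \<eta>' z" and
      eq: "(x, k, \<eta>, y) \<in> quadruples S \<A> H X" "(x', k', \<eta>', y') \<in> quadruples S \<A> H X"
          "x = x'" "k = k'" "y = y'"
      unfolding germ_rel_def by auto
    have "x' \<in> W" "W \<subseteq> dom \<eta>' \<inter> dom \<eta>" "\<forall>z \<in> W. \<eta>' z = \<eta> z"
      using W eq by auto
    then show "(q, p) \<in> germ_rel S \<A> H X"
      unfolding p q germ_rel_def using eq W(1) by blast
  qed
  show "trans (germ_rel S \<A> H X)"
  proof (rule transI)
    fix p q t assume "(p, q) \<in> germ_rel S \<A> H X" "(q, t) \<in> germ_rel S \<A> H X"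
    moreover obtain x k \<eta> y where p: "p = (x, k, \<eta>, y)" by (cases p) auto
    moreover obtain x' k' \<eta>' y' where q: "q = (x', k', \<eta>', y')" by (cases q) auto
    moreover obtain x'' k'' \<eta>'' y'' where t: "t = (x'', k'', \<eta>'', y'')" by (cases t) auto
    ultimately obtain W W' where
      W: "openin (subtopology S X) W" "x \<in> W" "W \<subseteq> dom \<eta> \<inter> dom \<eta>'" "\<forall>z \<in> W. \<eta> z = \<eta>' z" and
      W': "openin (subtopology S X) W'" "x \<in> W'" "W' \<subseteq> dom \<eta>' \<inter> dom \<eta>''" "\<forall>z \<in> W'. \<eta>' z = \<eta>'' z" and
      eq: "(x, k, \<eta>, y) \<in> quadruples S \<A> H X" "(x'', k'', \<eta>'', y'') \<in> quadruples S \<A> H X"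
          "x = x''" "k = k''" "y = y''"
      unfolding germ_rel_def by auto
    have "openin (subtopology S X) (W \<inter> W')" "x \<in> W \<inter> W'" "W \<inter> W' \<subseteq> dom \<eta> \<inter> dom \<eta>''"
         "\<forall>z \<in> W \<inter> W'. \<eta> z = \<eta>'' z"
      using W W' by (auto intro: openin_Int)
    then show "(p, t) \<in> germ_rel S \<A> H X"
      unfolding p t germ_rel_def using eq by blast
  qed
qed

lemma germ_eq_iff:
  assumes "(x, k, \<eta>, y) \<in> quadruples S \<A> H X" "(x', k', \<eta>', y') \<in> quadruples S \<A> H X"
  shows "germ S \<A> H X x k \<eta> y = germ S \<A> H X x' k' \<eta>' y' \<longleftrightarrow>
         ((x, k, \<eta>, y), (x', k', \<eta>', y')) \<in> germ_rel S \<A> H X"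
  unfolding germ_def using assms eq_equiv_class_iff[OF germ_rel_equiv] by metis

lemma empty_local_transfer: "Map.empty \<in> local_transfers S \<A> H X k"
proof -
  have "biholomorphic S \<A> {} {} id"
    by (auto simp: biholomorphic_def surface_holomorphic_on_def holomorphic_on_def)
  then have "\<exists>U\<^sub>1 V\<^sub>1 \<eta>\<^sub>1. openin S U\<^sub>1 \<and> openin S V\<^sub>1 \<and> biholomorphic S \<A> U\<^sub>1 V\<^sub>1 \<eta>\<^sub>1 \<and>
      U\<^sub>1 \<inter> X = {} \<and> V\<^sub>1 \<inter> X = {}"
    by (intro exI[of _ "{}"] exI[of _ id]) simp
  moreover have "homeomorphic_map (subtopology S {}) (subtopology S {}) (\<lambda>z. the (Map.empty z))"
    by (simp add: homeomorphic_map_def quotient_map_def)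
  ultimately have "Map.empty \<in> local_maps S \<A> X"
    by (simp add: local_maps_def)
  moreover obtain n m :: nat where "k = int n - int m"
    by (metis int_diff_cases)
  ultimately show ?thesis
    by (auto simp: local_transfers_def)
qed

lemma germ_base_Int:
  assumes "B \<in> germ_base S \<A> H X" "C \<in> germ_base S \<A> H X"
  shows "B \<inter> C \<in> germ_base S \<A> H X"
proof -
  let ?g = "germ S \<A> H X"
  obtain k \<eta> U where B: "B = (\<lambda>z. ?g z k \<eta> (the (\<eta> z))) ` U" and \<eta>: "\<eta> \<in> local_transfers S \<A> H X k"
    and U: "openin (subtopology S X) U" "U \<subseteq> dom \<eta>"
    using assms(1) unfolding germ_base_def by auto
  obtain l \<theta> V where C: "C = (\<lambda>z. ?g z l \<theta> (the (\<theta> z))) ` V" and \<theta>: "\<theta> \<in> local_transfers S \<A> H X l"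
    and V: "openin (subtopology S X) V" "V \<subseteq> dom \<theta>"
    using assms(2) unfolding germ_base_def by auto
  have q1: "(z, k, \<eta>, the (\<eta> z)) \<in> quadruples S \<A> H X" if "z \<in> U" for z
    using that U \<eta> by (auto simp: quadruples_def)
  have q2: "(z, l, \<theta>, the (\<theta> z)) \<in> quadruples S \<A> H X" if "z \<in> V" for z
    using that V \<theta> by (auto simp: quadruples_def)
  show ?thesis
  proof (cases "k = l")
    case False
    then have "B \<inter> C = {}"
      unfolding B C using germ_eq_iff[OF q1 q2] by (auto simp: germ_rel_def)
    then show ?thesis
      unfolding germ_base_def using empty_local_transfer[of S \<A> H X k] by force
  next
    case True
    define W where "W = \<Union>{T. openin (subtopology S X) T \<and> T \<subseteq> U \<inter> V \<and> (\<forall>z\<in>T. \<eta> z = \<theta> z)}"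
    have W: "openin (subtopology S X) W" "W \<subseteq> U" "W \<subseteq> V" "\<And>z. z \<in> W \<Longrightarrow> \<eta> z = \<theta> z"
      unfolding W_def by auto
    have WI: "z \<in> W" if z: "z \<in> U" "z \<in> V" "((z, k, \<eta>, y), (z, l, \<theta>, y')) \<in> germ_rel S \<A> H X" for z y y'
    proof -
      obtain T where T: "openin (subtopology S X) T" "z \<in> T" "\<forall>z\<in>T. \<eta> z = \<theta> z"
        using z(3) unfolding germ_rel_def by auto
      have "openin (subtopology S X) (T \<inter> (U \<inter> V))"
        using T U V by (intro openin_Int)
      then show ?thesis
        unfolding W_def using T z by blast
    qed
    have "B \<inter> C = (\<lambda>z. ?g z k \<eta> (the (\<eta> z))) ` W"
    proof (intro subset_antisym subsetI)
      fix c assume "c \<in> B \<inter> C"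
      then obtain z z' where z: "z \<in> U" "z' \<in> V" "c = ?g z k \<eta> (the (\<eta> z))"
          "?g z k \<eta> (the (\<eta> z)) = ?g z' l \<theta> (the (\<theta> z'))"
        unfolding B C by auto
      then have r: "((z, k, \<eta>, the (\<eta> z)), (z', l, \<theta>, the (\<theta> z'))) \<in> germ_rel S \<A> H X"
        using germ_eq_iff[OF q1 q2] by blast
      then have "z' = z" by (auto simp: germ_rel_def)
      then show "c \<in> (\<lambda>z. ?g z k \<eta> (the (\<eta> z))) ` W"
        using r z WI by blast
    next
      fix c assume "c \<in> (\<lambda>z. ?g z k \<eta> (the (\<eta> z))) ` W"
      then obtain z where z: "z \<in> W" "c = ?g z k \<eta> (the (\<eta> z))" by auto
      then have zU: "z \<in> U" "z \<in> V" using W by auto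
      have "((z, k, \<eta>, the (\<eta> z)), (z, l, \<theta>, the (\<theta> z))) \<in> germ_rel S \<A> H X"
        unfolding germ_rel_def using q1[OF zU(1)] q2[OF zU(2)] W U V z(1) True
        by (auto intro!: exI[of _ W])
      then have "c = ?g z l \<theta> (the (\<theta> z))"
        using germ_eq_iff[OF q1[OF zU(1)] q2[OF zU(2)]] z by simp
      then show "c \<in> B \<inter> C"
        unfolding B C using z zU by blast
    qed
    then show ?thesis
      unfolding germ_base_def using \<eta> W U by blast
  qed
qed

lemma openin_germ_topology:
  "openin (germ_topology S \<A> H X) = arbitrary union_of (\<lambda>B. B \<in> germ_base S \<A> H X)"
  unfolding germ_topology_def by (simp add: istopology_base germ_base_Int topology_inverse')

lemma topspace_germ_topology: "topspace (germ_topology S \<A> H X) = germs S \<A> H X"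
proof -
  have "topspace (germ_topology S \<A> H X) = \<Union>(germ_base S \<A> H X)"
  proof (rule subset_antisym)
    show "topspace (germ_topology S \<A> H X) \<subseteq> \<Union>(germ_base S \<A> H X)"
      unfolding topspace_def openin_germ_topology union_of_def arbitrary_def by auto
    show "\<Union>(germ_base S \<A> H X) \<subseteq> topspace (germ_topology S \<A> H X)"
      by (intro Union_least openin_subset) (simp add: openin_germ_topology arbitrary_union_of_inc)
  qed
  also have "\<dots> = germs S \<A> H X"
  proof (intro subset_antisym subsetI)
    fix c assume "c \<in> \<Union>(germ_base S \<A> H X)"
    then obtain k \<eta> U z where "c = germ S \<A> H X z k \<eta> (the (\<eta> z))" "z \<in> U" "U \<subseteq> dom \<eta>"
        "\<eta> \<in> local_transfers S \<A> H X k"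
      unfolding germ_base_def by auto
    then show "c \<in> germs S \<A> H X"
      unfolding germs_def germ_def by (intro quotientI[THEN back_subst[of "\<lambda>c. c \<in> _"]])
        (auto simp: quadruples_def)
  next
    fix c assume "c \<in> germs S \<A> H X"
    then obtain x k \<eta> y where c: "c = germ S \<A> H X x k \<eta> y" "(x, k, \<eta>, y) \<in> quadruples S \<A> H X"
      unfolding germs_def germ_def by (auto elim!: quotientE)
    then have "\<eta> \<in> local_transfers S \<A> H X k" "\<eta> x = Some y" "openin (subtopology S X) (dom \<eta>)"
      by (auto simp: quadruples_def local_transfers_def local_maps_def)
    then have "(\<lambda>z. germ S \<A> H X z k \<eta> (the (\<eta> z))) ` dom \<eta> \<in> germ_base S \<A> H X"
      "c \<in> (\<lambda>z. germ S \<A> H X z k \<eta> (the (\<eta> z))) ` dom \<eta>"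
      unfolding germ_base_def using c by (blast, force)
    then show "c \<in> \<Union>(germ_base S \<A> H X)" by blast
  qed
  finally show ?thesis .
qed

section \<open>Etale groupoids\<close>

text \<open>
  Groupoids \<open>G\<close> are presented with their unit space as a separate set \<open>X\<close>, embedded in \<open>G\<close> by \<open>e\<close>.
  The product \<open>m g h\<close> is defined when \<open>s g = r h\<close>; its values at other pairs are irrelevant.
\<close>

locale groupoid =
  fixes G :: "'g set" and X :: "'x set"
    and r s :: "'g \<Rightarrow> 'x" and e :: "'x \<Rightarrow> 'g" and m :: "'g \<Rightarrow> 'g \<Rightarrow> 'g" and i :: "'g \<Rightarrow> 'g"
  assumes range_in: "g \<in> G \<Longrightarrow> r g \<in> X"
    and source_in: "g \<in> G \<Longrightarrow> s g \<in> X"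
    and unit_in: "x \<in> X \<Longrightarrow> e x \<in> G"
    and range_unit: "x \<in> X \<Longrightarrow> r (e x) = x"
    and source_unit: "x \<in> X \<Longrightarrow> s (e x) = x"
    and mult_in: "\<lbrakk>g \<in> G; h \<in> G; s g = r h\<rbrakk> \<Longrightarrow> m g h \<in> G"
    and range_mult: "\<lbrakk>g \<in> G; h \<in> G; s g = r h\<rbrakk> \<Longrightarrow> r (m g h) = r g"
    and source_mult: "\<lbrakk>g \<in> G; h \<in> G; s g = r h\<rbrakk> \<Longrightarrow> s (m g h) = s h"
    and mult_assoc:
      "\<lbrakk>g \<in> G; h \<in> G; k \<in> G; s g = r h; s h = r k\<rbrakk> \<Longrightarrow> m (m g h) k = m g (m h k)"
    and unit_left: "g \<in> G \<Longrightarrow> m (e (r g)) g = g"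
    and unit_right: "g \<in> G \<Longrightarrow> m g (e (s g)) = g"
    and inv_in: "g \<in> G \<Longrightarrow> i g \<in> G"
    and range_inv: "g \<in> G \<Longrightarrow> r (i g) = s g"
    and source_inv: "g \<in> G \<Longrightarrow> s (i g) = r g"
    and inv_right: "g \<in> G \<Longrightarrow> m g (i g) = e (r g)"
    and inv_left: "g \<in> G \<Longrightarrow> m (i g) g = e (s g)"

text \<open>
  Since \<open>r\<close> and \<open>e\<close> are continuous and \<open>r (e x) = x\<close>, the map \<open>e\<close> is a homeomorphism from the
  unit space onto the set of units with the topology inherited from the groupoid.
\<close>

locale topological_groupoid =
  groupoid "topspace G" "topspace X" r s e m i
  for G :: "'g topology" and X :: "'x topology" and r s e m i +
  assumes continuous_range: "continuous_map G X r"
    and continuous_source: "continuous_map G X s"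
    and continuous_unit: "continuous_map X G e"
    and continuous_mult:
      "continuous_map
         (subtopology (prod_topology G G) {(g, h). g \<in> topspace G \<and> h \<in> topspace G \<and> s g = r h})
         G (\<lambda>(g, h). m g h)"
    and continuous_inv: "continuous_map G G i"

definition local_homeomorphism_map :: "'a topology \<Rightarrow> 'b topology \<Rightarrow> ('a \<Rightarrow> 'b) \<Rightarrow> bool" where
  "local_homeomorphism_map A B f \<longleftrightarrow>
     (\<forall>x \<in> topspace A. \<exists>U. openin A U \<and> x \<in> U \<and> openin B (f ` U) \<and>
        homeomorphic_map (subtopology A U) (subtopology B (f ` U)) f)"

locale etale_groupoid = topological_groupoid G X r s e m i
  for G :: "'g topology" and X :: "'x topology" and r s e m i +
  assumes etale_range: "local_homeomorphism_map G X r"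
    and etale_source: "local_homeomorphism_map G X s"

end

theory Submission
  imports Defs "HOL-Complex_Analysis.Complex_Analysis"
begin

text \<open>
  The case of the identity map with \<open>X = S\<close> shows what is at stake: there the groupoid contains
  \<open>S\<close> as its unit space, so second countability includes Rado's theorem that a connected Riemann
  surface has a countable base. Given that theorem, the rest is the identity theorem for holomorphic
  maps together with bookkeeping for germs.

  Rado's theorem (\<open>Rado\<close>) is obtained from canonical neighbourhoods. Suppose that every point \<open>p\<close> has
  countably many sets \<open>N p n\<close>, defined without any choice, and that for each \<open>q\<close> a single \<open>n\<close> makes
  \<open>N p n\<close> contain a fixed neighbourhood of \<open>q\<close> and stay inside a fixed chart for all \<open>p\<close> near \<open>q\<close>.
  Starting from one point, adjoin again and again countable dense subsets of the sets \<open>N p n\<close>. The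
  closure of the resulting countable set is open, hence everything
  (\<open>second_countable_if_canonical_neighbourhoods\<close>).

  Sublevel sets of the Green function with pole \<open>p\<close>, the supremum of the competitors described next,
  have this property. Only two estimates are needed, so neither the Green function nor any other
  harmonic function has to be constructed. Fix a closed disc \<open>D\<close> in a
  chart and consider all nonpositive subharmonic functions on the complement of \<open>D\<close> with a
  logarithmic pole at \<open>p\<close>. By the maximum principle all of them are very negative near \<open>p\<close>
  (\<open>log_pole_function_le\<close>). Conversely, one of them is bounded below away from \<open>p\<close>
  (\<open>log_pole_function_exists\<close>): a pole can be glued into a bounded function that is strictly
  subharmonic near \<open>p\<close>. Bounded functions of this kind exist near every point
  (\<open>strictly_subharmonic_everywhere\<close>): the first one is a cut-off \<open>1/\<bar>z\<bar>\<^sup>2\<close> around \<open>D\<close>, capped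
  inside \<open>D\<close>, where no condition is imposed. Where a function is strictly subharmonic in a small disc it can
  absorb the cap of another such bump, which is strictly subharmonic in the larger disc around it;
  connectedness then carries the property to every point. Subharmonicity is taken in the viscosity
  sense. It is then a local and coordinate-free condition, stable under gluing with maxima, and the
  maximum principle is immediate.

  For the groupoid, a transfer is handled through its biholomorphic extension. The Hausdorff property
  holds because two extensions which agree near one point of a perfect set agree on a connected
  neighbourhood (\<open>equal_on_connected\<close>), so two distinct germs at the same point have no common germ
  nearby. For second countability (\<open>second_countable_germs\<close>), let \<open>H\<^sup>n = H\<^sup>m \<circ> \<eta>\<close> and let the
  extension of \<open>\<eta>\<close> be defined on a connected set \<open>D\<close>. Since \<open>H\<^sup>m\<close> is locally injective off isolated points
  (\<open>holomorphic_locally_injective\<close>) and \<open>X\<close> is perfect, there is a point \<open>q\<close> of a countable dense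
  subset of \<open>X\<close> in \<open>D\<close> such that \<open>H\<^sup>m\<close> is injective on a basic neighbourhood \<open>B\<close> of \<open>\<eta> q\<close>. The tuple
  \<open>(n, m, D, q, B)\<close> determines \<open>\<eta>\<close> near \<open>q\<close>, and hence on \<open>D \<inter> X\<close>. There are countably many such
  tuples, so countably many sections over subsets of \<open>X\<close> cover the groupoid. This count avoids any
  discussion of critical points and of the number of branches there.
\<close>

section \<open>Subharmonic functions in the plane\<close>

text \<open>
  Viscosity formulation of the inequality \<open>\<Delta>g \<ge> 4\<kappa>\<close> at \<open>b\<close>: no function
  \<open>const - Re f - \<gamma>\<bar>z - b\<bar>\<^sup>2\<close> with \<open>f\<close> holomorphic and \<open>\<gamma> > - \<kappa>\<close> touches \<open>g\<close> from above at \<open>b\<close>.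
  For \<open>\<kappa> = 0\<close> this is subharmonicity; a positive \<open>\<kappa>\<close> measures how strict it is. The condition concerns
  only germs at \<open>b\<close>, and holomorphic changes of the coordinate preserve the class of test functions.
\<close>

definition subharmonic_at :: "real \<Rightarrow> (complex \<Rightarrow> real) \<Rightarrow> complex \<Rightarrow> bool" where
  "subharmonic_at \<kappa> g b \<longleftrightarrow>
     (\<forall>f e \<gamma>. 0 < e \<and> f holomorphic_on ball b e \<and> - \<kappa> < \<gamma> \<longrightarrow>
        (\<exists>z \<in> ball b e. g b + Re (f b) < g z + Re (f z) + \<gamma> * (cmod (z - b))\<^sup>2))"

text \<open>
  A term that lies above \<open>Re f + \<mu>\<bar>z - b\<bar>\<^sup>2\<close>, with contact at \<open>b\<close>, improves \<open>\<kappa>\<close> by \<open>\<mu>\<close>, because the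
  lower bound can be moved into the test function. For negative \<open>\<mu>\<close> this says how much strictness a
  bad term uses up. All explicit functions below are treated in this way.
\<close>

lemma subharmonic_at_support:
  assumes g: "subharmonic_at \<kappa> g b" and e: "0 < e" "f holomorphic_on ball b e"
    and le: "\<And>z. z \<in> ball b e \<Longrightarrow>
      g z + Re (f z) + \<mu> * (cmod (z - b))\<^sup>2 - (g b + Re (f b)) \<le> g' z - g' b"
    and \<nu>: "\<nu> \<le> \<kappa> + \<mu>"
  shows "subharmonic_at \<nu> g' b"
  unfolding subharmonic_at_def
proof (intro allI impI, elim conjE)
  fix F d \<gamma> assume d: "0 < (d::real)" "F holomorphic_on ball b d" "- \<nu> < \<gamma>"
  let ?r = "min d e"
  have "(\<lambda>z. f z + F z) holomorphic_on ball b ?r"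
    using e d by (intro holomorphic_on_add; elim holomorphic_on_subset) auto
  moreover have "- \<kappa> < \<gamma> + \<mu>" "0 < ?r" using d e \<nu> by auto
  ultimately obtain z where z: "z \<in> ball b ?r"
    and lt: "g b + Re (f b + F b) < g z + Re (f z + F z) + (\<gamma> + \<mu>) * (cmod (z - b))\<^sup>2"
    using g unfolding subharmonic_at_def by blast
  then have "z \<in> ball b d" "z \<in> ball b e" by auto
  moreover have "g' b + Re (F b) < g' z + Re (F z) + \<gamma> * (cmod (z - b))\<^sup>2"
    using le[OF \<open>z \<in> ball b e\<close>] lt by (simp add: algebra_simps)
  ultimately show "\<exists>z \<in> ball b d. g' b + Re (F b) < g' z + Re (F z) + \<gamma> * (cmod (z - b))\<^sup>2"
    by blast
qed

text \<open>
  Only a comparison from below with contact at \<open>b\<close> is used, so passing to a pointwise maximum costs nothing.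
\<close>

lemma subharmonic_at_touching:
  assumes "subharmonic_at \<kappa> g b" "0 < e" "g b = g' b" "\<And>z. z \<in> ball b e \<Longrightarrow> g z \<le> g' z" "\<nu> \<le> \<kappa>"
  shows "subharmonic_at \<nu> g' b"
  by (rule subharmonic_at_support[where f = "\<lambda>_. 0" and \<mu> = 0, OF assms(1,2)]) (use assms in auto)

lemma subharmonic_at_const: "subharmonic_at 0 (\<lambda>z. c) b"
  unfolding subharmonic_at_def
proof (intro allI impI, elim conjE, rule ccontr)
  fix f e \<gamma> assume e: "0 < (e::real)" "f holomorphic_on ball b e" "- 0 < (\<gamma>::real)"
    and "\<not> (\<exists>z\<in>ball b e. c + Re (f b) < c + Re (f z) + \<gamma> * (cmod (z - b))\<^sup>2)"
  then have le: "Re (f z) + \<gamma> * (cmod (z - b))\<^sup>2 \<le> Re (f b)" if "z \<in> ball b e" for z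
    using that by force
  \<comment> \<open>By the open mapping theorem the real part of a non-constant \<open>f\<close> has no local maximum.\<close>
  have "f constant_on ball b e"
  proof (rule ccontr)
    assume "\<not> f constant_on ball b e"
    then have "open (f ` ball b e)"
      by (intro open_mapping_thm[OF e(2)]) auto
    moreover have "f b \<in> f ` ball b e" using e by auto
    ultimately obtain r where r: "r > 0" "ball (f b) r \<subseteq> f ` ball b e"
      using open_contains_ball by blast
    then have "f b + of_real (r/2) \<in> f ` ball b e"
      by (intro subsetD[OF r(2)]) (auto simp: dist_norm)
    then obtain z where "z \<in> ball b e" "f z = f b + of_real (r/2)" by auto
    then have "Re (f z) = Re (f b) + r/2" by simp
    moreover have "0 \<le> \<gamma> * (cmod (z - b))\<^sup>2" using e by simp
    ultimately show False using le[OF \<open>z \<in> ball b e\<close>] r by linarith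
  qed
  moreover have "b + of_real (e/2) \<in> ball b e" "b \<in> ball b e" using e by (auto simp: dist_norm)
  ultimately have "f (b + of_real (e/2)) = f b"
    unfolding constant_on_def by metis
  moreover have "cmod (b + of_real (e/2) - b) = e/2" using e by simp
  then have "0 < \<gamma> * (cmod (b + of_real (e/2) - b))\<^sup>2" using e by simp
  ultimately show False using le[OF \<open>b + of_real (e/2) \<in> ball b e\<close>] by (metis add_le_same_cancel1 not_less)
qed

text \<open>
  A test function for \<open>g'\<close> is pulled back by the inverse coordinate change \<open>\<sigma>\<close>. The quadratic term is
  not transformed into a quadratic term, but the Lipschitz bounds for \<open>\<tau>\<close> and \<open>\<sigma>\<close> compare the two,
  and an inequality suffices. Its direction depends on the sign of \<open>\<gamma>\<close>, which is why bounds for both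
  maps are needed.
\<close>

lemma subharmonic_at_compose:
  assumes g: "subharmonic_at \<kappa> g (\<tau> b)"
    and \<tau>: "0 < e" "\<And>z. z \<in> ball b e \<Longrightarrow> g' z = g (\<tau> z)" "\<And>z. z \<in> ball b e \<Longrightarrow> cmod (\<tau> z - \<tau> b) \<le> L * cmod (z - b)"
    and \<sigma>: "0 < d" "\<sigma> holomorphic_on ball (\<tau> b) d" "\<sigma> (\<tau> b) = b" "\<And>w. w \<in> ball (\<tau> b) d \<Longrightarrow> \<tau> (\<sigma> w) = w"
      "\<And>w. w \<in> ball (\<tau> b) d \<Longrightarrow> cmod (\<sigma> w - b) \<le> K * cmod (w - \<tau> b)"
    and KL: "0 < L" "0 < K" "0 \<le> \<nu>" "\<nu> * K\<^sup>2 \<le> \<kappa>"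
  shows "subharmonic_at \<nu> g' b"
  unfolding subharmonic_at_def
proof (intro allI impI, elim conjE)
  fix f r \<gamma> assume r: "0 < (r::real)" "f holomorphic_on ball b r" "- \<nu> < \<gamma>"
  \<comment> \<open>The coefficient that remains of the quadratic term in the other coordinate.\<close>
  define \<delta> where "\<delta> = (if 0 \<le> \<gamma> then \<gamma> / L\<^sup>2 else \<gamma> * K\<^sup>2)"
  have \<delta>: "- \<kappa> < \<delta>"
  proof (cases "0 \<le> \<gamma>")
    case True
    have "0 \<le> \<kappa>" using KL by (meson mult_nonneg_nonneg order_trans zero_le_power2)
    moreover have "0 < \<kappa>" if "\<gamma> = 0" using KL r that
      by (metis less_le_trans linorder_neqE_linordered_idom mult_pos_pos neg_0_less_iff_less neg_equal_0_iff_equal neg_le_0_iff_le not_less zero_less_power)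
    ultimately show ?thesis using True KL unfolding \<delta>_def
      by (smt (verit, best) divide_eq_0_iff divide_nonneg_nonneg zero_le_power2 zero_less_divide_iff zero_less_power)
  next
    case False
    have "- \<nu> * K\<^sup>2 < \<gamma> * K\<^sup>2" using r KL by (intro mult_strict_right_mono) auto
    then show ?thesis using False KL unfolding \<delta>_def by simp
  qed
  \<comment> \<open>This radius makes \<open>\<sigma>\<close> take values in both balls around \<open>b\<close>.\<close>
  define m where "m = Min {d, e / K, r / K}"
  have m: "0 < m" "m \<le> d" "m * K \<le> e" "m * K \<le> r"
    using \<tau> \<sigma> r KL unfolding m_def by (auto simp: min_def field_simps)
  have \<sigma>b: "\<sigma> w \<in> ball b e" "\<sigma> w \<in> ball b r" if "w \<in> ball (\<tau> b) m" for w
  proof -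
    have "cmod (\<sigma> w - b) \<le> K * cmod (w - \<tau> b)"
      using \<sigma>(5) that m by auto
    moreover have "K * cmod (w - \<tau> b) < K * m"
      using that KL by (simp add: dist_norm norm_minus_commute)
    ultimately have "cmod (\<sigma> w - b) < K * m" by linarith
    then show "\<sigma> w \<in> ball b e" "\<sigma> w \<in> ball b r"
      using m by (auto simp: dist_norm norm_minus_commute mult.commute)
  qed
  have "(f \<circ> \<sigma>) holomorphic_on ball (\<tau> b) m"
    using \<sigma>(2) r(2) m \<sigma>b by (intro holomorphic_on_compose_gen[OF holomorphic_on_subset[OF \<sigma>(2)] r(2)]) auto
  then obtain w where w: "w \<in> ball (\<tau> b) m"
     and lt: "g (\<tau> b) + Re ((f \<circ> \<sigma>) (\<tau> b)) < g w + Re ((f \<circ> \<sigma>) w) + \<delta> * (cmod (w - \<tau> b))\<^sup>2"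
    using g m(1) \<delta> unfolding subharmonic_at_def by blast
  have ws: "\<tau> (\<sigma> w) = w" using \<sigma> w m by auto
  have "\<delta> * (cmod (w - \<tau> b))\<^sup>2 \<le> \<gamma> * (cmod (\<sigma> w - b))\<^sup>2"
  proof (cases "0 \<le> \<gamma>")
    case True
    have "cmod (w - \<tau> b) \<le> L * cmod (\<sigma> w - b)"
      using \<tau>(3)[OF \<sigma>b(1)[OF w]] ws by simp
    then have "(cmod (w - \<tau> b))\<^sup>2 \<le> L\<^sup>2 * (cmod (\<sigma> w - b))\<^sup>2"
      by (metis norm_ge_zero power_mono power_mult_distrib)
    then have "(cmod (w - \<tau> b))\<^sup>2 / L\<^sup>2 \<le> (cmod (\<sigma> w - b))\<^sup>2"
      using KL by (simp add: field_simps)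
    then show ?thesis using True mult_left_mono[of _ _ \<gamma>] unfolding \<delta>_def by fastforce
  next
    case False
    have "cmod (\<sigma> w - b) \<le> K * cmod (w - \<tau> b)"
      using \<sigma>(5) w m by auto
    then have "(cmod (\<sigma> w - b))\<^sup>2 \<le> K\<^sup>2 * (cmod (w - \<tau> b))\<^sup>2"
      by (metis norm_ge_zero power_mono power_mult_distrib)
    then show ?thesis using False mult_left_mono_neg[of _ _ \<gamma>] unfolding \<delta>_def by (simp add: mult.assoc)
  qed
  moreover have "g' b = g (\<tau> b)" "g' (\<sigma> w) = g w"
    using \<tau>(1) \<tau>(2)[OF \<sigma>b(1)[OF w]] \<tau>(2)[of b] ws by auto
  ultimately have "g' b + Re (f b) < g' (\<sigma> w) + Re (f (\<sigma> w)) + \<gamma> * (cmod (\<sigma> w - b))\<^sup>2"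
    using lt \<sigma>(3) by simp
  then show "\<exists>z\<in>ball b r. g' b + Re (f b) < g' z + Re (f z) + \<gamma> * (cmod (z - b))\<^sup>2"
    using \<sigma>b(2)[OF w] by blast
qed

lemma subharmonic_at_affine:
  assumes g: "subharmonic_at 0 g b" and c: "0 < c"
  shows "subharmonic_at 0 (\<lambda>z. (g z - d) / c) b"
  unfolding subharmonic_at_def
proof (intro allI impI, elim conjE)
  fix f e \<gamma> assume e: "0 < (e::real)" "f holomorphic_on ball b e" "- 0 < (\<gamma>::real)"
  have "(\<lambda>z. of_real c * f z) holomorphic_on ball b e" "- 0 < c * \<gamma>"
    using e c by (auto intro: holomorphic_intros)
  then obtain z where z: "z \<in> ball b e"
    and lt: "g b + Re (of_real c * f b) < g z + Re (of_real c * f z) + c * \<gamma> * (cmod (z - b))\<^sup>2"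
    using g e(1) unfolding subharmonic_at_def by blast
  have eq: "c * ((t - d) / c + a) = t - d + c * a" for t a
    using c by (simp add: distrib_left)
  have "c * ((g b - d) / c + Re (f b)) < c * ((g z - d) / c + Re (f z) + \<gamma> * (cmod (z - b))\<^sup>2)"
    using lt unfolding add.assoc eq by (simp add: ring_distribs)
  then show "\<exists>z\<in>ball b e. (g b - d) / c + Re (f b) < (g z - d) / c + Re (f z) + \<gamma> * (cmod (z - b))\<^sup>2"
    using z c by auto
qed

lemma Re_of_real_mult: "Re (of_real c * w) = c * Re w"
  by simp

text \<open>
  Moving the centre of the square changes it by the real part of a holomorphic function.
\<close>

lemma norm_power2_shift:
  "(cmod z)\<^sup>2 = (cmod (z - a))\<^sup>2 + Re (2 * cnj a * z) - (cmod a)\<^sup>2"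
  unfolding cmod_power2 by (simp add: power2_eq_square algebra_simps)

text \<open>
  After adding \<open>\<epsilon>\<bar>z\<bar>\<^sup>2\<close> an interior maximum would be a test function touching from above, which is
  excluded by definition. It is enough that \<open>h\<close> is locally the real part of a holomorphic function;
  this admits the logarithm on an annulus.
\<close>

lemma subharmonic_max_principle:
  assumes K: "compact K" and g: "continuous_on K g" "\<And>a. a \<in> interior K \<Longrightarrow> subharmonic_at 0 g a"
    and h: "continuous_on K h"
      "\<And>a. a \<in> interior K \<Longrightarrow> \<exists>e>0. \<exists>f. f holomorphic_on ball a e \<and> (\<forall>z\<in>ball a e. h z = Re (f z))"
    and M: "\<And>z. z \<in> frontier K \<Longrightarrow> g z + h z \<le> M"
    and "z \<in> K"
  shows "g z + h z \<le> M"
proof (rule ccontr)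
  assume gt: "\<not> g z + h z \<le> M"
  obtain R where R: "\<And>z. z \<in> K \<Longrightarrow> cmod z \<le> R" "R > 0"
    using compact_imp_bounded[OF K] unfolding bounded_pos by auto
  \<comment> \<open>So small that the perturbation cannot move the maximum to the frontier.\<close>
  define \<epsilon> where "\<epsilon> = (g z + h z - M) / (2 * R\<^sup>2)"
  have "\<epsilon> * R\<^sup>2 = (g z + h z - M) / 2"
    using R unfolding \<epsilon>_def by simp
  moreover have "\<epsilon> > 0"
    using gt R unfolding \<epsilon>_def by simp
  ultimately have \<epsilon>: "\<epsilon> > 0" "\<epsilon> * R\<^sup>2 < g z + h z - M"
    using gt by auto
  define G where "G z = g z + h z + \<epsilon> * (cmod z)\<^sup>2" for z
  have "continuous_on K G"
    unfolding G_def by (intro continuous_intros g h)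
  then obtain a where a: "a \<in> K" "\<And>w. w \<in> K \<Longrightarrow> G w \<le> G a"
    using continuous_attains_sup[OF K] \<open>z \<in> K\<close> by blast
  have "a \<notin> frontier K"
  proof
    assume "a \<in> frontier K"
    then have "G a \<le> M + \<epsilon> * R\<^sup>2"
      using M[of a] R(1)[OF a(1)] \<epsilon>(1) unfolding G_def
      by (intro add_mono mult_left_mono power_mono) auto
    also have "\<dots> < g z + h z" using \<epsilon> by simp
    also have "\<dots> \<le> G z" unfolding G_def using \<epsilon> by simp
    finally show False using a(2)[OF \<open>z \<in> K\<close>] by simp
  qed
  then have int: "a \<in> interior K"
    using a(1) closure_subset[of K] unfolding frontier_def by auto
  then obtain e f where e: "e > 0" "f holomorphic_on ball a e" "\<forall>z\<in>ball a e. h z = Re (f z)"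
    using h(2) by blast
  obtain d where d: "d > 0" "ball a d \<subseteq> K"
    using int by (meson mem_interior)
  let ?r = "min d e" and ?f = "\<lambda>z. f z + of_real \<epsilon> * (2 * cnj a * z)"
  have "?f holomorphic_on ball a ?r"
    using e by (intro holomorphic_intros) (auto elim: holomorphic_on_subset)
  moreover have "0 < ?r" "- 0 < \<epsilon>" using d e \<epsilon> by auto
  ultimately obtain w where w: "w \<in> ball a ?r"
    and lt: "g a + Re (?f a) < g w + Re (?f w) + \<epsilon> * (cmod (w - a))\<^sup>2"
    using g(2)[OF int] unfolding subharmonic_at_def by blast
  have eqs: "h w = Re (f w)" "h a = Re (f a)" using e w by auto
  have "G a = g a + Re (?f a) - \<epsilon> * (cmod a)\<^sup>2"
    using norm_power2_shift[of a a] unfolding G_def eqs by (simp add: algebra_simps)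
  also have "\<dots> < g w + Re (?f w) + \<epsilon> * (cmod (w - a))\<^sup>2 - \<epsilon> * (cmod a)\<^sup>2"
    using lt by simp
  also have "\<dots> = G w"
    using arg_cong[OF norm_power2_shift[of w a], of "\<lambda>t. \<epsilon> * t"]
    unfolding G_def eqs by (simp add: algebra_simps)
  finally show False using a(2)[of w] w d by force
qed

lemma holomorphic_locally_Lipschitz:
  assumes "\<tau> holomorphic_on T" "open T" "b \<in> T"
  obtains L e where "L > 0" "e > 0" "ball b e \<subseteq> T"
    "\<And>z w. z \<in> ball b e \<Longrightarrow> w \<in> ball b e \<Longrightarrow> cmod (\<tau> z - \<tau> w) \<le> L * cmod (z - w)"
proof -
  obtain e where e: "e > 0" "cball b e \<subseteq> T"
    using assms open_contains_cball by blast
  have "continuous_on (cball b e) (deriv \<tau>)"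
    using e assms by (meson continuous_on_subset holomorphic_deriv holomorphic_on_imp_continuous_on)
  then have "bounded (deriv \<tau> ` cball b e)"
    by (intro compact_imp_bounded compact_continuous_image) auto
  then obtain L where L: "L > 0" "\<And>z. z \<in> cball b e \<Longrightarrow> cmod (deriv \<tau> z) \<le> L"
    unfolding bounded_pos by auto
  have "cmod (\<tau> z - \<tau> w) \<le> L * cmod (z - w)" if "z \<in> ball b e" "w \<in> ball b e" for z w
  proof (rule field_differentiable_bound[where S = "ball b e" and f' = "deriv \<tau>"])
    show "(\<tau> has_field_derivative deriv \<tau> x) (at x within ball b e)" if "x \<in> ball b e" for x
      using that e assms
      by (meson ball_subset_cball has_field_derivative_at_within holomorphic_derivI subsetD)
  qed (use that L in auto)
  then show ?thesis using that[of L e] L e by (meson ball_subset_cball order_trans)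
qed

lemma holomorphic_on_if_locally:
  assumes "\<And>z. z \<in> A \<Longrightarrow> \<exists>T. open T \<and> z \<in> T \<and> f holomorphic_on T"
  shows "f holomorphic_on A"
  unfolding holomorphic_on_def
  using assms holomorphic_on_imp_differentiable_at field_differentiable_at_within by metis

section \<open>Radial subharmonic bumps\<close>

text \<open>
  The function \<open>1/\<rho>\<close>, continued below \<open>s\<close> by its tangent at \<open>s\<close>.
\<close>

definition capped_inverse :: "real \<Rightarrow> real \<Rightarrow> real" where
  "capped_inverse s \<rho> = 1 / max s \<rho> + (s - min s \<rho>) / s\<^sup>2"

text \<open>
  The function \<open>1/\<bar>z\<bar>\<^sup>2\<close> is strictly subharmonic away from the origin, being the squared modulus of
  the holomorphic function \<open>1/z\<close>. Subtracting the constant and taking the positive part gives compact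
  support. The cap makes the function bounded, at the price of a term \<open>- \<bar>z\<bar>\<^sup>2 / s\<^sup>2\<close> on the inner disc.
\<close>

definition bump :: "real \<Rightarrow> real \<Rightarrow> complex \<Rightarrow> real" where
  "bump s R z = max 0 (capped_inverse s ((cmod z)\<^sup>2) - 1 / R\<^sup>2)"

lemma capped_inverse_ge_tangent:
  assumes "0 < s" shows "2 / s - \<rho> / s\<^sup>2 \<le> capped_inverse s \<rho>"
proof (cases "s \<le> \<rho>")
  case True
  have "0 \<le> (s - \<rho>)\<^sup>2 / (\<rho> * s\<^sup>2)" using assms True by simp
  also have "\<dots> = 1 / \<rho> - (2 / s - \<rho> / s\<^sup>2)"
    using assms True by (simp add: field_simps power2_eq_square)
  finally show ?thesis using True by (simp add: capped_inverse_def)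
qed (use assms in \<open>simp add: capped_inverse_def field_simps power2_eq_square\<close>)

lemma capped_inverse_low:
  assumes "0 < s" "\<rho> \<le> s" shows "capped_inverse s \<rho> = 2 / s - \<rho> / s\<^sup>2"
  using assms by (simp add: capped_inverse_def field_simps power2_eq_square)

lemma capped_inverse_high: "s \<le> \<rho> \<Longrightarrow> capped_inverse s \<rho> = 1 / \<rho>"
  by (simp add: capped_inverse_def)

lemma capped_inverse_antimono:
  assumes "0 < s" "\<rho> \<le> \<rho>'" shows "capped_inverse s \<rho>' \<le> capped_inverse s \<rho>"
  unfolding capped_inverse_def using assms
  by (intro add_mono divide_left_mono divide_right_mono) auto

lemma bump_nonneg: "0 \<le> bump s R z"
  by (simp add: bump_def)

lemma bump_le: "0 < s \<Longrightarrow> bump s R z \<le> 2 / s"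
  using capped_inverse_antimono[of s 0 "(cmod z)\<^sup>2"]
  by (auto simp: bump_def capped_inverse_low intro: order_trans[of _ "capped_inverse s ((cmod z)\<^sup>2)"])

lemma bump_outside:
  assumes "0 < s" "s < R\<^sup>2" "0 < R" "R \<le> cmod z" shows "bump s R z = 0"
proof -
  have "R\<^sup>2 \<le> (cmod z)\<^sup>2" using assms by (intro power_mono) auto
  moreover from this have "1 / (cmod z)\<^sup>2 \<le> 1 / R\<^sup>2" using assms by (intro frac_le) auto
  moreover have "s \<le> (cmod z)\<^sup>2" using calculation(1) assms by linarith
  ultimately show ?thesis
    by (simp add: bump_def capped_inverse_high)
qed

lemma continuous_on_bump:
  assumes "0 < s" shows "continuous_on A (\<lambda>z. bump s R (z - b))"
proof -
  have "max s ((cmod (z - b))\<^sup>2) \<noteq> 0" for z using assms by linarith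
  then show ?thesis
    unfolding bump_def capped_inverse_def using assms
    by (intro continuous_intros) auto
qed

text \<open>
  In the capped part the tangent lies below the bump and touches it, and it is the square
  \<open>- \<bar>z - b\<bar>\<^sup>2 / s\<^sup>2\<close> up to a constant. The strictness of \<open>g\<close> pays for it.
\<close>

lemma subharmonic_bump_low:
  assumes g: "subharmonic_at \<kappa> g a" and s: "0 < s" "(cmod (a - b))\<^sup>2 \<le> s" "s < R\<^sup>2"
    and A: "0 < A" "A / s\<^sup>2 \<le> \<kappa>"
  shows "subharmonic_at 0 (\<lambda>z. g z + A * bump s R (z - b)) a"
proof (rule subharmonic_at_support[OF g, where e = 1 and \<mu> = "- (A / s\<^sup>2)"
      and f = "\<lambda>z. - of_real (A / s\<^sup>2) * (2 * cnj (a - b) * (z - b))"])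
  fix z
  let ?T = "\<lambda>z. 2 / s - (cmod (z - b))\<^sup>2 / s\<^sup>2 - 1 / R\<^sup>2"
  have "0 < ?T a"
  proof -
    have "(cmod (a - b))\<^sup>2 / s\<^sup>2 \<le> s / s\<^sup>2" using s by (intro divide_right_mono) auto
    also have "s / s\<^sup>2 = 2 / s - 1 / s" using s by (simp add: field_simps power2_eq_square)
    also have "1 / R\<^sup>2 < 1 / s" using s by (intro divide_strict_left_mono mult_pos_pos) linarith+
    ultimately show ?thesis by (simp add: field_simps)
  qed
  then have "bump s R (a - b) = ?T a"
    using s by (simp add: bump_def capped_inverse_low)
  moreover have "?T z \<le> bump s R (z - b)"
    using capped_inverse_ge_tangent[OF s(1), of "(cmod (z - b))\<^sup>2"] by (simp add: bump_def)
  ultimately have "?T z - ?T a \<le> bump s R (z - b) - bump s R (a - b)" by simp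
  then have le: "A * (?T z - ?T a) \<le> A * (bump s R (z - b) - bump s R (a - b))"
    using A by (intro mult_left_mono) auto
  define c where "c = A / s\<^sup>2"
  have "A * (?T z - ?T a) = - (c * ((cmod (z - b))\<^sup>2 - (cmod (a - b))\<^sup>2))"
    unfolding c_def by (simp add: algebra_simps diff_divide_distrib)
  also have "(cmod (z - b))\<^sup>2 - (cmod (a - b))\<^sup>2
      = (cmod (z - a))\<^sup>2 + Re (2 * cnj (a - b) * (z - b)) - Re (2 * cnj (a - b) * (a - b))"
    using norm_power2_shift[of "z - b" "a - b"] norm_power2_shift[of "a - b" "a - b"]
    by simp
  finally have "A * (?T z - ?T a) = - (c * (cmod (z - a))\<^sup>2)
      + Re (- of_real c * (2 * cnj (a - b) * (z - b))) - Re (- of_real c * (2 * cnj (a - b) * (a - b)))"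
    by (simp add: algebra_simps)
  with le show "g z + Re (- of_real (A / s\<^sup>2) * (2 * cnj (a - b) * (z - b)))
      + - (A / s\<^sup>2) * (cmod (z - a))\<^sup>2 - (g a + Re (- of_real (A / s\<^sup>2) * (2 * cnj (a - b) * (a - b))))
      \<le> g z + A * bump s R (z - b) - (g a + A * bump s R (a - b))"
    unfolding c_def[symmetric] by (simp add: algebra_simps)
qed (use A in \<open>auto intro!: holomorphic_intros\<close>)

text \<open>
  Here the bump is \<open>\<bar>h\<bar>\<^sup>2\<close> up to a constant, with \<open>h z = 1/(z - b)\<close>, and
  \<open>\<bar>h\<bar>\<^sup>2 = \<bar>h - h a\<bar>\<^sup>2 + Re (2 cnj (h a) h) - \<bar>h a\<bar>\<^sup>2\<close>. The first term is the gain, because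
  \<open>\<bar>h z - h a\<bar> = \<bar>z - a\<bar> / \<bar>(z - b)(a - b)\<bar> \<ge> \<bar>z - a\<bar> / R\<^sup>2\<close>.
\<close>

lemma subharmonic_bump_high:
  assumes g: "subharmonic_at 0 g a" and s: "0 < s" "s < (cmod (a - b))\<^sup>2" "cmod (a - b) < R"
    and A: "0 < A"
  shows "subharmonic_at (A / R ^ 4) (\<lambda>z. g z + A * bump s R (z - b)) a"
proof -
  have R: "0 < R" using s norm_ge_zero[of "a - b"] by linarith
  have "open {z. s < (cmod (z - b))\<^sup>2 \<and> cmod (z - b) < R}"
    by (intro open_Collect_conj open_Collect_less continuous_intros)
  then obtain e where e: "e > 0" "ball a e \<subseteq> {z. s < (cmod (z - b))\<^sup>2 \<and> cmod (z - b) < R}"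
    using s open_contains_ball by blast
  have nz: "z \<noteq> b" if "z \<in> ball a e" for z using e(2) that s by fastforce
  have ab: "a \<in> ball a e" using e by simp
  let ?h = "\<lambda>z. 1 / (z - b)"
  have bump: "bump s R (z - b) = (cmod (?h z))\<^sup>2 - 1 / R\<^sup>2" if "z \<in> ball a e" for z
  proof -
    have "s < (cmod (z - b))\<^sup>2" "cmod (z - b) < R" using e that by auto
    moreover from this have "(cmod (z - b))\<^sup>2 \<le> R\<^sup>2" by (intro power_mono) auto
    then have "1 / R\<^sup>2 \<le> 1 / (cmod (z - b))\<^sup>2" using nz[OF that] by (intro frac_le) auto
    ultimately show ?thesis
      by (simp add: bump_def capped_inverse_high norm_divide power_divide)
  qed
  show ?thesis
  proof (rule subharmonic_at_support[OF g e(1), where \<mu> = "A / R ^ 4" and f = "\<lambda>z. of_real A * (2 * cnj (?h a) * ?h z)"])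
    show "(\<lambda>z. of_real A * (2 * cnj (?h a) * ?h z)) holomorphic_on ball a e"
      using nz by (intro holomorphic_intros) auto
    fix z assume z: "z \<in> ball a e"
    have "1 / R ^ 4 * (cmod (z - a))\<^sup>2 \<le> (cmod (?h z - ?h a))\<^sup>2"
    proof -
      have "cmod (z - b) < R" "cmod (a - b) < R" using e z s by auto
      then have "cmod (z - b) * cmod (a - b) \<le> R * R" by (intro mult_mono) (use R in auto)
      then have "(cmod (z - b) * cmod (a - b))\<^sup>2 \<le> (R * R)\<^sup>2" by (intro power_mono) auto
      then have "(cmod (z - a))\<^sup>2 / R ^ 4 \<le> (cmod (z - a))\<^sup>2 / (cmod (z - b) * cmod (a - b))\<^sup>2"
        using nz[OF z] nz[OF ab] R by (intro divide_left_mono) (auto simp: power_mult_distrib power2_eq_square eval_nat_numeral)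
      also have "?h z - ?h a = (a - z) / ((z - b) * (a - b))"
        using nz[OF z] nz[OF ab] by (simp add: field_simps)
      then have "(cmod (z - a))\<^sup>2 / (cmod (z - b) * cmod (a - b))\<^sup>2 = (cmod (?h z - ?h a))\<^sup>2"
        by (simp add: norm_divide norm_mult power_divide norm_minus_commute)
      finally show ?thesis by simp
    qed
    also have "\<dots> = (cmod (?h z))\<^sup>2 - (cmod (?h a))\<^sup>2 - Re (2 * cnj (?h a) * ?h z) + Re (2 * cnj (?h a) * ?h a)"
      using norm_power2_shift[of "?h z" "?h a"] norm_power2_shift[of "?h a" "?h a"] by simp
    finally have "A * (1 / R ^ 4 * (cmod (z - a))\<^sup>2) \<le> A * ((cmod (?h z))\<^sup>2 - (cmod (?h a))\<^sup>2
        - Re (2 * cnj (?h a) * ?h z) + Re (2 * cnj (?h a) * ?h a))"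
      using A by (intro mult_left_mono) auto
    then show "g z + Re (of_real A * (2 * cnj (?h a) * ?h z)) + A / R ^ 4 * (cmod (z - a))\<^sup>2
        - (g a + Re (of_real A * (2 * cnj (?h a) * ?h a)))
      \<le> g z + A * bump s R (z - b) - (g a + A * bump s R (a - b))"
      unfolding bump[OF z] bump[OF ab] Re_of_real_mult
      by (simp only: ring_distribs) simp
  qed auto
qed

text \<open>
  A logarithm plus an inverted paraboloid, both vanishing at radius \<open>R\<close>, extended by zero. The factor
  \<open>\<kappa> R\<^sup>2 / 2\<close> is chosen such that the function is nonnegative between the radii \<open>R/2\<close> and \<open>R\<close>; hence
  near radius \<open>R\<close> it is bounded below by zero and the extension is harmless for subharmonicity. The
  square uses up exactly the strictness \<open>\<kappa>\<close>.
\<close>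

definition log_pole :: "real \<Rightarrow> real \<Rightarrow> complex \<Rightarrow> real" where
  "log_pole \<kappa> R z = \<kappa> * R\<^sup>2 / 2 * ln (min (cmod z) R / R) + \<kappa> * (R\<^sup>2 - (min (cmod z) R)\<^sup>2)"

lemma log_pole_outside: "0 < R \<Longrightarrow> R \<le> cmod z \<Longrightarrow> log_pole \<kappa> R z = 0"
  by (simp add: log_pole_def min_def)

lemma log_pole_nonneg:
  assumes "0 < R" "0 < \<kappa>" "R / 2 \<le> cmod z" shows "0 \<le> log_pole \<kappa> R z"
proof -
  define x where "x = min (cmod z) R / R"
  have x: "1/2 \<le> x" "x \<le> 1" using assms unfolding x_def by (auto simp: field_simps min_def)
  have "1 - 1 / x \<le> ln x"
    using ln_le_minus_one[of "1 / x"] x by (simp add: ln_div)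
  moreover have "1 / (2 * x) \<le> 1" using x by simp
  then have "0 \<le> (1 - x) * ((1 + x) - 1 / (2 * x))"
    using x by (intro mult_nonneg_nonneg) linarith+
  moreover have "(1 - x) * ((1 + x) - 1 / (2 * x)) = (1 - 1 / x) / 2 + (1 - x\<^sup>2)"
    using x by (simp add: field_simps power2_eq_square)
  moreover have "(1 - 1 / x) / 2 \<le> ln x / 2" using calculation(1) by simp
  ultimately have "0 \<le> ln x / 2 + (1 - x\<^sup>2)" by linarith
  then have "0 \<le> \<kappa> * R\<^sup>2 * (ln x / 2 + (1 - x\<^sup>2))" using assms by simp
  also have "\<dots> = \<kappa> * R\<^sup>2 / 2 * ln x + \<kappa> * (R\<^sup>2 - (x * R)\<^sup>2)"
    by (simp add: algebra_simps power_mult_distrib)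
  also have "x * R = min (cmod z) R" using assms by (simp add: x_def)
  finally show ?thesis by (simp add: log_pole_def x_def)
qed

lemma log_pole_le:
  assumes "0 < R" "0 < \<kappa>" "z \<noteq> 0"
  shows "log_pole \<kappa> R z \<le> \<kappa> * R\<^sup>2" "cmod z < R \<Longrightarrow> log_pole \<kappa> R z \<le> \<kappa> * R\<^sup>2 / 2 * ln (cmod z) + (\<kappa> * R\<^sup>2 - \<kappa> * R\<^sup>2 / 2 * ln R)"
proof -
  have "ln (min (cmod z) R / R) \<le> 0" using assms by (simp add: min_def)
  then have "\<kappa> * R\<^sup>2 / 2 * ln (min (cmod z) R / R) \<le> 0"
    using assms by (intro mult_nonneg_nonpos) auto
  moreover have "\<kappa> * (R\<^sup>2 - (min (cmod z) R)\<^sup>2) \<le> \<kappa> * R\<^sup>2" using assms by (intro mult_left_mono) auto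
  ultimately show "log_pole \<kappa> R z \<le> \<kappa> * R\<^sup>2" unfolding log_pole_def by linarith
  assume "cmod z < R"
  moreover have "0 \<le> \<kappa> * (cmod z)\<^sup>2" using assms by simp
  ultimately show "log_pole \<kappa> R z \<le> \<kappa> * R\<^sup>2 / 2 * ln (cmod z) + (\<kappa> * R\<^sup>2 - \<kappa> * R\<^sup>2 / 2 * ln R)"
    using assms by (simp add: log_pole_def ln_div algebra_simps diff_divide_distrib)
qed

lemma continuous_on_log_pole:
  assumes "0 < R" "b \<notin> A" shows "continuous_on A (\<lambda>z. log_pole \<kappa> R (z - b))"
proof -
  have "0 < min (cmod (z - b)) R" if "z \<in> A" for z using assms that by auto
  then have "min (cmod (z - b)) R / R \<noteq> 0" if "z \<in> A" for z
    using assms that by (metis divide_eq_0_iff less_irrefl)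
  then show ?thesis
    unfolding log_pole_def using assms
    by (intro continuous_intros) auto
qed

text \<open>
  On the disc around \<open>a\<close> that reaches to \<open>b\<close>, the function \<open>ln \<bar>z - b\<bar>\<close> is therefore the real part of
  a holomorphic function.
\<close>

lemma quotient_notin_nonpos_Reals:
  fixes a b z :: complex
  assumes "cmod (z - a) < cmod (a - b)"
  shows "(z - b) / (a - b) \<notin> \<real>\<^sub>\<le>\<^sub>0"
proof -
  have ab: "a \<noteq> b" using assms norm_ge_zero[of "z - a"] by auto
  then have eq: "(z - b) / (a - b) = 1 + (z - a) / (a - b)" by (simp add: field_simps)
  have "cmod ((z - a) / (a - b)) < 1" using assms ab by (simp add: norm_divide)
  then have "\<bar>Re ((z - a) / (a - b))\<bar> < 1"
    using abs_Re_le_cmod order.strict_trans1 by blast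
  then have "0 < Re ((z - b) / (a - b))" unfolding eq by simp
  then show ?thesis by (auto simp: complex_nonpos_Reals_iff)
qed

lemma subharmonic_log_pole:
  assumes g: "subharmonic_at \<kappa> g a" and R: "0 < R" "a \<noteq> b" "cmod (a - b) < R" and \<kappa>: "0 < \<kappa>"
  shows "subharmonic_at 0 (\<lambda>z. g z + log_pole \<kappa> R (z - b)) a"
proof -
  define e where "e = min (cmod (a - b)) (R - cmod (a - b))"
  have e: "0 < e" using R by (simp add: e_def)
  let ?q = "\<lambda>z. (z - b) / (a - b)"
  have q: "?q z \<notin> \<real>\<^sub>\<le>\<^sub>0" "z \<noteq> b" "cmod (z - b) < R" if "z \<in> ball a e" for z
  proof -
    have za: "cmod (z - a) < e" using that by (simp add: dist_norm norm_minus_commute)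
    show "?q z \<notin> \<real>\<^sub>\<le>\<^sub>0"
      using za by (intro quotient_notin_nonpos_Reals) (simp add: e_def)
    then show "z \<noteq> b" by auto
    show "cmod (z - b) < R"
      using za norm_triangle_ineq[of "z - a" "a - b"] by (simp add: e_def)
  qed
  define c where "c = \<kappa> * R\<^sup>2 / 2"
  let ?f = "\<lambda>z. of_real c * Ln (?q z) - of_real \<kappa> * (2 * cnj (a - b) * (z - b))"
  have pole: "log_pole \<kappa> R (z - b) = c * (ln (cmod (z - b)) - ln R) + \<kappa> * (R\<^sup>2 - (cmod (z - b))\<^sup>2)"
    if "z \<in> ball a e" for z
    using q[OF that] R by (simp add: log_pole_def c_def ln_div)
  have LnRe: "Re (Ln (?q z)) = ln (cmod (z - b)) - ln (cmod (a - b))" if "z \<in> ball a e" for z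
    using q[OF that] R by (simp add: Re_Ln norm_divide ln_div)
  have ab: "a \<in> ball a e" using e by simp
  show ?thesis
  proof (rule subharmonic_at_support[OF g e, where \<mu> = "- \<kappa>" and f = ?f])
    show "?f holomorphic_on ball a e"
      using q R by (intro holomorphic_intros) auto
    fix z assume z: "z \<in> ball a e"
    have "(cmod (z - b))\<^sup>2 - (cmod (a - b))\<^sup>2
      = (cmod (z - a))\<^sup>2 + Re (2 * cnj (a - b) * (z - b)) - Re (2 * cnj (a - b) * (a - b))"
      using norm_power2_shift[of "z - b" "a - b"] norm_power2_shift[of "a - b" "a - b"] by simp
    then have "\<kappa> * ((cmod (z - b))\<^sup>2 - (cmod (a - b))\<^sup>2)
      = \<kappa> * ((cmod (z - a))\<^sup>2 + Re (2 * cnj (a - b) * (z - b)) - Re (2 * cnj (a - b) * (a - b)))"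
      by simp
    then show "g z + Re (?f z) + - \<kappa> * (cmod (z - a))\<^sup>2 - (g a + Re (?f a))
      \<le> g z + log_pole \<kappa> R (z - b) - (g a + log_pole \<kappa> R (a - b))"
      unfolding pole[OF z] pole[OF ab] minus_complex.sel Re_of_real_mult LnRe[OF z] LnRe[OF ab]
      by (simp only: ring_distribs)
  qed auto
qed

lemma subharmonic_log_pole_outside:
  assumes g: "subharmonic_at \<mu> g a" and R: "0 < R" "R \<le> cmod (a - b)" and \<kappa>: "0 < \<kappa>"
  shows "subharmonic_at \<mu> (\<lambda>z. g z + log_pole \<kappa> R (z - b)) a"
proof (rule subharmonic_at_touching[OF g])
  show "0 < R / 2" using R by simp
  fix z assume "z \<in> ball a (R / 2)"
  then have "R / 2 \<le> cmod (z - b)"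
    using R norm_triangle_ineq[of "a - z" "z - b"] by (simp add: dist_norm)
  then show "g z \<le> g z + log_pole \<kappa> R (z - b)" using log_pole_nonneg R \<kappa> by simp
qed (use log_pole_outside R \<kappa> in auto)

section \<open>Second countability from canonical neighbourhoods\<close>

text \<open>
  The sets \<open>N p n\<close> with second countable surroundings are separable. Closing up a point under the
  choice of countable dense subsets of them gives a countable set \<open>C\<close>. A limit point \<open>q\<close> of \<open>C\<close> has
  some \<open>p \<in> C\<close> in its neighbourhood \<open>V\<close>, and then \<open>V\<close> is contained in \<open>N p n\<close>; here it matters that
  \<open>V\<close> and \<open>n\<close> depend on \<open>q\<close> alone. So the closure of \<open>C\<close> is open.
\<close>

lemma second_countable_if_canonical_neighbourhoods:
  fixes N :: "'a \<Rightarrow> nat \<Rightarrow> 'a set"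
  assumes conn: "connected_space S"
    and canon: "\<And>q. q \<in> topspace S \<Longrightarrow> \<exists>n V W. openin S V \<and> q \<in> V \<and> openin S W \<and>
      second_countable (subtopology S W) \<and> (\<forall>p \<in> V. V \<subseteq> N p n \<and> N p n \<subseteq> W)"
  shows "second_countable S"
proof (cases "topspace S = {}")
  case True
  then show ?thesis
    unfolding second_countable_def by (auto intro!: exI[of _ "{}"] dest: openin_subset)
next
  case False
  then obtain x0 where x0: "x0 \<in> topspace S" by blast
  define good where "good p n \<longleftrightarrow> (\<exists>W. openin S W \<and> second_countable (subtopology S W) \<and> N p n \<subseteq> W)" for p n
  have "\<exists>C. countable C \<and> C \<subseteq> N p n \<and> N p n \<subseteq> S closure_of C" if "good p n" for p n
  proof -
    obtain W where W: "openin S W" "second_countable (subtopology S W)" "N p n \<subseteq> W"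
      using \<open>good p n\<close> good_def by blast
    have sub: "N p n \<subseteq> topspace S" using W openin_subset by blast
    have "second_countable (subtopology (subtopology S W) (N p n))"
      using W second_countable_subtopology by blast
    then have "separable_space (subtopology S (N p n))"
      using W(3) second_countable_imp_separable_space by (simp add: subtopology_subtopology Int_absorb1)
    then obtain C where C: "countable C" "C \<subseteq> N p n" "subtopology S (N p n) closure_of C = N p n"
      using sub unfolding separable_space_def by (auto simp: Int_absorb1)
    then have "N p n \<subseteq> S closure_of C"
      by (metis closure_of_subtopology_subset)
    then show ?thesis using C by blast
  qed
  then obtain d where d: "\<And>p n. good p n \<Longrightarrow> countable (d p n)" "\<And>p n. good p n \<Longrightarrow> d p n \<subseteq> N p n"
    "\<And>p n. good p n \<Longrightarrow> N p n \<subseteq> S closure_of d p n"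
    by metis
  define step where "step A = A \<union> (\<Union>p\<in>A. \<Union>n\<in>{n. good p n}. d p n)" for A
  define C where "C = (\<Union>k. (step ^^ k) {x0})"
  have "countable ((step ^^ k) {x0})" for k
  proof (induction k)
    case (Suc k)
    then show ?case
      unfolding funpow.simps o_apply step_def[of "(step ^^ k) {x0}"]
      by (intro countable_Un countable_UN) (auto simp: d(1))
  qed simp
  then have countC: "countable C" unfolding C_def by blast
  have dC: "d p n \<subseteq> C" if "p \<in> C" "good p n" for p n
  proof -
    obtain k where "p \<in> (step ^^ k) {x0}" using \<open>p \<in> C\<close> C_def by blast
    then have "d p n \<subseteq> (step ^^ Suc k) {x0}" using \<open>good p n\<close> unfolding step_def by auto
    then show ?thesis unfolding C_def by blast
  qed
  have "x0 \<in> (step ^^ 0) {x0}" by simp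
  then have x0C: "x0 \<in> C" unfolding C_def by blast
  define T where "T = (\<Union>p\<in>C. \<Union>n\<in>{n. good p n}. N p n)"
  have TC: "T \<subseteq> S closure_of C"
    unfolding T_def
  proof (intro UN_least)
    fix p n assume "p \<in> C" "n \<in> {n. good p n}"
    then show "N p n \<subseteq> S closure_of C"
      using d(3)[of p n] closure_of_mono[OF dC[of p n], of S] by auto
  qed
  \<comment> \<open>The uniform choice of \<open>V\<close> and \<open>n\<close> is used here.\<close>
  have nbhd: "\<exists>p\<in>C. \<exists>n. good p n \<and> q \<in> S interior_of N p n" if q: "q \<in> S closure_of C" for q
  proof -
    have "q \<in> topspace S" using q by (simp add: in_closure_of)
    then obtain n V W where V: "openin S V" "q \<in> V" "openin S W" "second_countable (subtopology S W)"
      "\<And>p. p \<in> V \<Longrightarrow> V \<subseteq> N p n \<and> N p n \<subseteq> W"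
      using canon by metis
    then obtain p where p: "p \<in> C" "p \<in> V" using q unfolding in_closure_of by blast
    then have "good p n" "V \<subseteq> N p n" using V unfolding good_def by blast+
    moreover from this have "q \<in> S interior_of N p n"
      using interior_of_maximal[OF _ V(1)] V(2) by blast
    ultimately show ?thesis using p(1) by blast
  qed
  define T' where "T' = (\<Union>p\<in>C. \<Union>n\<in>{n. good p n}. S interior_of N p n)"
  have T'T: "T' \<subseteq> T"
    unfolding T_def T'_def by (intro UN_mono subset_refl interior_of_subset)
  have CT': "S closure_of C \<subseteq> T'"
  proof
    fix q assume "q \<in> S closure_of C"
    from nbhd[OF this] show "q \<in> T'" unfolding T'_def by blast
  qed
  have clT: "S closure_of C \<subseteq> T" using CT' T'T by (rule order_trans)
  then have "T = S closure_of C" using TC by (intro subset_antisym)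
  then have "closedin S T" by simp
  moreover have "T = T'" using T'T TC CT' by (intro subset_antisym) (auto dest: subsetD)
  then have "openin S T" unfolding T'_def by (auto intro!: openin_Union)
  ultimately have "T = {} \<or> T = topspace S"
    using conn unfolding connected_space_clopen_in by blast
  moreover have "x0 \<in> T" using subsetD[OF clT] subsetD[OF closure_of_subset_Int[of S C]] x0 x0C by simp
  ultimately have T: "T = topspace S" by blast
  have "second_countable (subtopology S (S interior_of N p n))" if "good p n" for p n
  proof -
    obtain W where W: "second_countable (subtopology S W)" "N p n \<subseteq> W"
      using \<open>good p n\<close> good_def by blast
    have "subtopology S (S interior_of N p n) = subtopology (subtopology S W) (S interior_of N p n)"
      using W interior_of_subset[of S "N p n"] by (simp add: subtopology_subtopology Int_absorb1)
    then show ?thesis using W second_countable_subtopology by metis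
  qed
  then have "\<exists>\<B>. countable \<B> \<and> (\<forall>V\<in>\<B>. openin S V) \<and>
      (\<forall>U x. openin S U \<and> x \<in> U \<and> x \<in> S interior_of N p n \<longrightarrow> (\<exists>V\<in>\<B>. x \<in> V \<and> V \<subseteq> U))" if "good p n" for p n
  proof -
    let ?I = "S interior_of N p n"
    obtain \<B> where \<B>: "countable \<B>" "\<And>V. V \<in> \<B> \<Longrightarrow> openin (subtopology S ?I) V"
      "\<And>U x. openin (subtopology S ?I) U \<Longrightarrow> x \<in> U \<Longrightarrow> \<exists>V\<in>\<B>. x \<in> V \<and> V \<subseteq> U"
      using \<open>good p n\<close> \<open>\<And>p n. good p n \<Longrightarrow> second_countable _\<close> unfolding second_countable_def by metis
    have "\<exists>V\<in>\<B>. x \<in> V \<and> V \<subseteq> U" if "openin S U" "x \<in> U" "x \<in> ?I" for U x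
      using \<B>(3)[of "U \<inter> ?I" x] that by (auto simp: openin_subtopology)
    then show ?thesis using \<B> openin_trans_full openin_interior_of by metis
  qed
  then obtain B where B: "\<And>p n. good p n \<Longrightarrow> countable (B p n)" "\<And>p n V. good p n \<Longrightarrow> V \<in> B p n \<Longrightarrow> openin S V"
    "\<And>p n U x. good p n \<Longrightarrow> openin S U \<Longrightarrow> x \<in> U \<Longrightarrow> x \<in> S interior_of N p n \<Longrightarrow> \<exists>V\<in>B p n. x \<in> V \<and> V \<subseteq> U"
    by metis
  let ?B = "\<Union>p\<in>C. \<Union>n\<in>{n. good p n}. B p n"
  have "countable ?B" using countC B(1) by auto
  moreover have "\<exists>V\<in>?B. x \<in> V \<and> V \<subseteq> U" if "openin S U" "x \<in> U" for U x
  proof -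
    have "x \<in> topspace S" using openin_subset[OF that(1)] that(2) by (rule subsetD)
    then have "x \<in> S closure_of C" using T TC by (intro subsetD[OF TC]) simp
    then obtain p n where pn: "p \<in> C" "good p n" "x \<in> S interior_of N p n"
      using nbhd[of x] by blast
    from B(3)[OF pn(2) that pn(3)] show ?thesis using pn(1,2) by blast
  qed
  ultimately show ?thesis unfolding second_countable_def using B(2) by (intro exI[of _ ?B]) auto
qed

text \<open>
  One set with property \<open>P\<close> is chosen between any two members of a countable base that admit such a set.
\<close>

lemma second_countable_refinement:
  assumes sc: "second_countable T"
    and P: "\<And>W x. openin T W \<Longrightarrow> x \<in> W \<Longrightarrow> \<exists>D. openin T D \<and> P D \<and> x \<in> D \<and> D \<subseteq> W"
  shows "\<exists>\<D>. countable \<D> \<and> (\<forall>D \<in> \<D>. openin T D \<and> P D) \<and>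
    (\<forall>W x. openin T W \<and> x \<in> W \<longrightarrow> (\<exists>D \<in> \<D>. x \<in> D \<and> D \<subseteq> W))"
proof -
  obtain \<B> where \<B>: "countable \<B>" "\<And>V. V \<in> \<B> \<Longrightarrow> openin T V"
    "\<And>U x. openin T U \<Longrightarrow> x \<in> U \<Longrightarrow> \<exists>V \<in> \<B>. x \<in> V \<and> V \<subseteq> U"
    using sc unfolding second_countable_def by metis
  define Q where "Q p D \<longleftrightarrow> openin T D \<and> P D \<and> fst p \<subseteq> D \<and> D \<subseteq> snd p" for p D
  define c where "c p = (SOME D. Q p D)" for p
  define \<D> where "\<D> = c ` {p \<in> \<B> \<times> \<B>. \<exists>D. Q p D}"
  have Qc: "Q p (c p)" if "\<exists>D. Q p D" for p unfolding c_def using that by (rule someI_ex)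
  have "countable \<D>" unfolding \<D>_def using \<B>(1) 
    by (intro countable_image countable_subset[OF _ countable_SIGMA[of \<B> "\<lambda>_. \<B>"]]) auto
  moreover have "openin T D \<and> P D" if D: "D \<in> \<D>" for D
  proof -
    obtain p where "D = c p" "\<exists>D. Q p D" using D unfolding \<D>_def by blast
    then show ?thesis using Qc[of p] unfolding Q_def by simp
  qed
  moreover have "\<exists>D \<in> \<D>. x \<in> D \<and> D \<subseteq> W" if W: "openin T W" "x \<in> W" for W x
  proof -
    obtain B' where B': "B' \<in> \<B>" "x \<in> B'" "B' \<subseteq> W" using \<B>(3)[OF W] by blast
    obtain D where D: "openin T D" "P D" "x \<in> D" "D \<subseteq> B'" using P[OF \<B>(2)[OF B'(1)] B'(2)] by blast
    obtain B where B: "B \<in> \<B>" "x \<in> B" "B \<subseteq> D" using \<B>(3)[OF D(1,3)] by blast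
    have ex: "\<exists>D. Q (B, B') D" unfolding Q_def using D B by auto
    then have "c (B, B') \<in> \<D>" unfolding \<D>_def using B(1) B'(1) by auto
    moreover have "x \<in> c (B, B')" "c (B, B') \<subseteq> W" using Qc[OF ex] B(2) B'(3) unfolding Q_def by auto
    ultimately show ?thesis by blast
  qed
  ultimately show ?thesis by (intro exI[of _ \<D>] conjI ballI allI impI) blast+
qed

section \<open>Charts of a Riemann surface\<close>

locale surface =
  fixes S :: "'a topology" and \<A> :: "('a set \<times> ('a \<Rightarrow> complex)) set"
  assumes surface: "riemann_surface S \<A>"
begin

lemma Hausdorff: "Hausdorff_space S"
  using surface by (simp add: riemann_surface_def)

lemma chart_at:
  assumes "x \<in> topspace S" obtains U \<phi> where "(U, \<phi>) \<in> \<A>" "x \<in> U"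
  using surface assms unfolding riemann_surface_def by blast

lemma chart_transition:
  assumes "(U, \<phi>) \<in> \<A>" "(V, \<psi>) \<in> \<A>"
  shows "(\<psi> \<circ> inv_into U \<phi>) holomorphic_on \<phi> ` (U \<inter> V)"
proof -
  have "\<forall>(U, \<phi>) \<in> \<A>. \<forall>(V, \<psi>) \<in> \<A>. (\<psi> \<circ> inv_into U \<phi>) holomorphic_on (\<phi> ` (U \<inter> V))"
    using surface by (simp add: riemann_surface_def)
  from bspec[OF this assms(1)] show ?thesis using assms(2) by auto
qed

context
  fixes U \<phi> assumes chart: "(U, \<phi>) \<in> \<A>"
begin

lemma chart_homeomorphic: "homeomorphic_map (subtopology S U) (top_of_set (\<phi> ` U)) \<phi>"
  using surface chart unfolding riemann_surface_def complex_chart_def by blast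

lemma chart_openin: "openin S U"
  using surface chart unfolding riemann_surface_def complex_chart_def by blast

lemma chart_subset: "U \<subseteq> topspace S"
  using chart_openin openin_subset by blast

lemma chart_open: "open (\<phi> ` U)"
  using surface chart unfolding riemann_surface_def complex_chart_def by blast

lemma chart_inj: "inj_on \<phi> U"
  using homeomorphic_imp_injective_map[OF chart_homeomorphic] chart_subset
  by (simp add: Int_absorb1)

lemma chart_inv [simp]: "x \<in> U \<Longrightarrow> inv_into U \<phi> (\<phi> x) = x"
  by (simp add: chart_inj)

lemma chart_inv_image: "W \<subseteq> U \<Longrightarrow> z \<in> \<phi> ` W \<Longrightarrow> inv_into U \<phi> z \<in> W \<and> \<phi> (inv_into U \<phi> z) = z"
  using chart_inv by auto

lemma continuous_chart: "continuous_map (subtopology S U) euclidean \<phi>"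
  using homeomorphic_imp_continuous_map[OF chart_homeomorphic] by (simp add: continuous_map_in_subtopology)

lemma continuous_chart_inv: "continuous_map (top_of_set (\<phi> ` U)) S (inv_into U \<phi>)"
proof -
  obtain g where g: "homeomorphic_maps (subtopology S U) (top_of_set (\<phi> ` U)) \<phi> g"
    using chart_homeomorphic homeomorphic_map_maps by blast
  then have "continuous_map (top_of_set (\<phi> ` U)) S g"
    by (auto simp: homeomorphic_maps_def continuous_map_in_subtopology)
  then show ?thesis
  proof (rule continuous_map_eq)
    fix z assume "z \<in> topspace (top_of_set (\<phi> ` U))"
    then obtain x where x: "x \<in> U" "z = \<phi> x" by auto
    then show "g z = inv_into U \<phi> z"
      using g chart_subset by (auto simp: homeomorphic_maps_def)
  qed
qed

lemma chart_vimage_openin: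
  assumes "open T" shows "openin S {x \<in> U. \<phi> x \<in> T}"
proof -
  have "openin (subtopology S U) {x \<in> topspace (subtopology S U). \<phi> x \<in> T}"
    using continuous_chart assms by (intro openin_continuous_map_preimage) auto
  moreover have "{x \<in> topspace (subtopology S U). \<phi> x \<in> T} = {x \<in> U. \<phi> x \<in> T}"
    using chart_subset by auto
  ultimately show ?thesis using chart_openin openin_trans_full by metis
qed

lemma chart_image_open:
  assumes "openin S W" shows "open (\<phi> ` (U \<inter> W))"
proof -
  have "openin (top_of_set (\<phi> ` U)) {z \<in> topspace (top_of_set (\<phi> ` U)). inv_into U \<phi> z \<in> W}"
    using continuous_chart_inv assms by (rule openin_continuous_map_preimage)
  moreover have "{z \<in> topspace (top_of_set (\<phi> ` U)). inv_into U \<phi> z \<in> W} = \<phi> ` (U \<inter> W)"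
    using chart_inv by auto
  ultimately show ?thesis using chart_open by (metis openin_open_trans)
qed

lemma chart_ball:
  assumes "openin S W" "x \<in> U" "x \<in> W"
  obtains e where "e > 0" "ball (\<phi> x) e \<subseteq> \<phi> ` (U \<inter> W)"
  using chart_image_open[OF assms(1)] assms open_contains_ball
  by (metis IntI imageI)

text \<open>
  Compact sets are closed because the surface is Hausdorff. Hence a function with compact support in a
  chart extends continuously by zero.
\<close>

lemma chart_compact_closedin:
  assumes "compact C" "C \<subseteq> \<phi> ` U"
  shows "closedin S {x \<in> U. \<phi> x \<in> C}"
proof -
  have "compactin (top_of_set (\<phi> ` U)) C"
    using assms by (simp add: compactin_subtopology)
  then have "compactin S (inv_into U \<phi> ` C)"
    using continuous_chart_inv image_compactin by blast
  moreover have "inv_into U \<phi> ` C = {x \<in> U. \<phi> x \<in> C}"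
  proof (intro subset_antisym subsetI)
    fix x assume "x \<in> inv_into U \<phi> ` C"
    then obtain z where z: "z \<in> C" "x = inv_into U \<phi> z" by auto
    then have "z \<in> \<phi> ` U" using assms by auto
    then show "x \<in> {x \<in> U. \<phi> x \<in> C}" using chart_inv_image[of U z] z by auto
  qed (metis (mono_tags, lifting) chart_inv image_eqI mem_Collect_eq)
  ultimately show ?thesis
    using Hausdorff compactin_imp_closedin by auto
qed

definition extend_by_zero :: "(complex \<Rightarrow> real) \<Rightarrow> 'a \<Rightarrow> real" where
  "extend_by_zero k x = (if x \<in> U then k (\<phi> x) else 0)"

lemma continuous_extend_by_zero:
  assumes C: "compact C" "C \<subseteq> \<phi> ` U" "\<And>z. z \<notin> C \<Longrightarrow> k z = 0"
    and k: "continuous_on (- Q) k" "closed Q"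
  shows "continuous_map (subtopology S (topspace S - {x \<in> U. \<phi> x \<in> Q})) euclideanreal (extend_by_zero k)"
proof -
  let ?T = "subtopology S (topspace S - {x \<in> U. \<phi> x \<in> Q})"
  have "openin ?T {x \<in> topspace ?T. extend_by_zero k x \<in> R}" if "open R" for R
  proof -
    have "open (- Q \<inter> k -` R)"
      using k \<open>open R\<close> by (intro continuous_open_preimage) auto
    then have 1: "openin S {x \<in> U. \<phi> x \<in> - Q \<inter> k -` R}"
      by (rule chart_vimage_openin)
    have 2: "openin S (topspace S - {x \<in> U. \<phi> x \<in> C})"
      using chart_compact_closedin[OF C(1,2)] by blast
    define N where "N = (if 0 \<in> R then topspace S - {x \<in> U. \<phi> x \<in> C} else {})"
    have "openin S N" using 2 by (simp add: N_def)
    then have "openin S ({x \<in> U. \<phi> x \<in> - Q \<inter> k -` R} \<union> N)" using 1 by blast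
    moreover have "{x \<in> topspace ?T. extend_by_zero k x \<in> R}
        = ({x \<in> U. \<phi> x \<in> - Q \<inter> k -` R} \<union> N) \<inter> (topspace S - {x \<in> U. \<phi> x \<in> Q})"
      using C(3) chart_subset by (auto simp: extend_by_zero_def N_def split: if_splits)
    ultimately show ?thesis
      unfolding openin_subtopology by blast
  qed
  then show ?thesis by (auto simp: continuous_map_def)
qed

end

lemma chart_second_countable:
  assumes U: "(U, \<phi>) \<in> \<A>" and "W \<subseteq> U" shows "second_countable (subtopology S W)"
proof -
  obtain B :: "complex set set" where B: "countable B" "topological_basis B"
    using ex_countable_basis by blast
  have "second_countable (euclidean :: complex topology)"
    unfolding second_countable_def
  proof (intro exI[of _ B] conjI ballI allI impI)
    show "openin euclidean V" if "V \<in> B" for V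
      using topological_basis_open[OF B(2) that] by simp
    show "\<exists>V\<in>B. x \<in> V \<and> V \<subseteq> U" if "openin euclidean U \<and> x \<in> U" for U x
      using topological_basisE[OF B(2), of U x] that by (metis open_openin)
  qed (rule B(1))
  then have "second_countable (top_of_set (\<phi> ` U))"
    by (rule second_countable_subtopology)
  then have "second_countable (subtopology S U)"
    using homeomorphic_space_second_countability chart_homeomorphic[OF U] homeomorphic_map_imp_homeomorphic_space by blast
  then have "second_countable (subtopology (subtopology S U) W)" by (rule second_countable_subtopology)
  then show ?thesis using assms by (simp add: subtopology_subtopology Int_absorb1)
qed

section \<open>Subharmonic functions on a Riemann surface\<close>

lemma transition_Lipschitz:
  assumes "(U, \<phi>) \<in> \<A>" "(V, \<psi>) \<in> \<A>" "x \<in> U \<inter> V"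
  obtains L e where "L > 0" "e > 0" "ball (\<phi> x) e \<subseteq> \<phi> ` (U \<inter> V)"
    "\<And>z w. z \<in> ball (\<phi> x) e \<Longrightarrow> w \<in> ball (\<phi> x) e \<Longrightarrow>
       cmod ((\<psi> \<circ> inv_into U \<phi>) z - (\<psi> \<circ> inv_into U \<phi>) w) \<le> L * cmod (z - w)"
  using holomorphic_locally_Lipschitz[OF chart_transition[OF assms(1,2)] chart_image_open[OF assms(1) chart_openin[OF assms(2)]]]
    assms(3) by (metis imageI)

text \<open>
  The factor \<open>K\<^sup>2\<close> is uniform near \<open>x\<close>, so strictness on a neighbourhood does not depend on the chart.
  For \<open>\<kappa> = \<nu> = 0\<close> it disappears.
\<close>

lemma subharmonic_chart_change:
  assumes U: "(U, \<phi>) \<in> \<A>" and V: "(V, \<psi>) \<in> \<A>" and x: "x \<in> U" "x \<in> V"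
  obtains K e where "K > 0" "e > 0"
    "\<And>y u \<kappa> \<nu>. y \<in> U \<Longrightarrow> \<phi> y \<in> ball (\<phi> x) e \<Longrightarrow> subharmonic_at \<kappa> (u \<circ> inv_into V \<psi>) (\<psi> y) \<Longrightarrow>
       0 \<le> \<nu> \<Longrightarrow> \<nu> * K\<^sup>2 \<le> \<kappa> \<Longrightarrow> subharmonic_at \<nu> (u \<circ> inv_into U \<phi>) (\<phi> y)"
proof -
  let ?\<tau> = "\<psi> \<circ> inv_into U \<phi>" and ?\<sigma> = "\<phi> \<circ> inv_into V \<psi>"
  obtain L e where e: "L > 0" "e > 0" "ball (\<phi> x) e \<subseteq> \<phi> ` (U \<inter> V)"
    "\<And>z w. z \<in> ball (\<phi> x) e \<Longrightarrow> w \<in> ball (\<phi> x) e \<Longrightarrow> cmod (?\<tau> z - ?\<tau> w) \<le> L * cmod (z - w)"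
    using transition_Lipschitz[OF U V] x by blast
  obtain K d where d: "K > 0" "d > 0" "ball (\<psi> x) d \<subseteq> \<psi> ` (V \<inter> U)"
    "\<And>z w. z \<in> ball (\<psi> x) d \<Longrightarrow> w \<in> ball (\<psi> x) d \<Longrightarrow> cmod (?\<sigma> z - ?\<sigma> w) \<le> K * cmod (z - w)"
    using transition_Lipschitz[OF V U] x by blast
  define m where "m = min e (d / L)"
  have m: "m > 0" "m \<le> e" "L * m \<le> d" using e d by (auto simp: m_def min_def field_simps)
  show ?thesis
  proof (rule that[OF d(1) m(1)])
    fix y u \<kappa> \<nu> assume y: "y \<in> U" "\<phi> y \<in> ball (\<phi> x) m"
      and g: "subharmonic_at \<kappa> (u \<circ> inv_into V \<psi>) (\<psi> y)" and \<nu>: "0 \<le> \<nu>" "\<nu> * K\<^sup>2 \<le> \<kappa>"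
    have ye: "\<phi> y \<in> ball (\<phi> x) e" using y m by auto
    then have yV: "y \<in> V" using e(3) chart_inv[OF U y(1)] chart_inv_image[OF U] by (metis Int_iff inf_le1 subsetD)
    have \<tau>y: "?\<tau> (\<phi> y) = \<psi> y" using y chart_inv[OF U] by simp
    have "cmod (?\<tau> (\<phi> y) - ?\<tau> (\<phi> x)) \<le> L * cmod (\<phi> y - \<phi> x)"
      using e(4)[OF ye] e(2) by simp
    also have "\<dots> < L * m" using y e by (simp add: dist_norm norm_minus_commute)
    finally have yd: "\<psi> y \<in> ball (\<psi> x) d"
      using m \<tau>y chart_inv[OF U x(1)] by (simp add: dist_norm norm_minus_commute)
    define r where "r = min (e - dist (\<phi> x) (\<phi> y)) (d - dist (\<psi> x) (\<psi> y))"
    have r: "r > 0" using ye yd by (simp add: r_def)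
    have be: "ball (\<phi> y) r \<subseteq> ball (\<phi> x) e" "ball (\<psi> y) r \<subseteq> ball (\<psi> x) d"
      unfolding ball_subset_ball_iff by (auto simp: r_def dist_commute)
    have invV: "inv_into V \<psi> w \<in> U \<inter> V" "\<psi> (inv_into V \<psi> w) = w" if "w \<in> ball (\<psi> y) r" for w
      using subsetD[OF be(2) that] d(3) chart_inv_image[OF V Int_lower1, of w U] by auto
    have invU: "inv_into U \<phi> w \<in> U \<inter> V" if "w \<in> ball (\<phi> y) r" for w
      using subsetD[OF be(1) that] e(3) chart_inv_image[OF U Int_lower1, of w V] by auto
    show "subharmonic_at \<nu> (u \<circ> inv_into U \<phi>) (\<phi> y)"
    proof (rule subharmonic_at_compose[where g = "u \<circ> inv_into V \<psi>" and \<tau> = ?\<tau> and \<sigma> = ?\<sigma> and L = L and K = K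
          and e = r and d = r and \<kappa> = \<kappa>])
      show "?\<sigma> holomorphic_on ball (?\<tau> (\<phi> y)) r"
        unfolding \<tau>y using be(2) d(3) by (intro holomorphic_on_subset[OF chart_transition[OF V U]]) auto
      show "(u \<circ> inv_into U \<phi>) z = (u \<circ> inv_into V \<psi>) (?\<tau> z)" if "z \<in> ball (\<phi> y) r" for z
        using invU[OF that] chart_inv[OF V] by simp
      show "cmod (?\<tau> z - ?\<tau> (\<phi> y)) \<le> L * cmod (z - \<phi> y)" if "z \<in> ball (\<phi> y) r" for z
        using e(4) that be ye by blast
      show "?\<tau> (?\<sigma> w) = w" if "w \<in> ball (?\<tau> (\<phi> y)) r" for w
        using that unfolding \<tau>y using invV chart_inv[OF U] by simp
      show "cmod (?\<sigma> w - \<phi> y) \<le> K * cmod (w - ?\<tau> (\<phi> y))" if "w \<in> ball (?\<tau> (\<phi> y)) r" for w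
        using that d(4)[of w "\<psi> y"] be(2) yd chart_inv[OF V yV] unfolding \<tau>y by auto
      show "?\<sigma> (?\<tau> (\<phi> y)) = \<phi> y" unfolding \<tau>y using chart_inv[OF V yV] by simp
    qed (use g \<tau>y r e d \<nu> in auto)
  qed
qed

definition surface_subharmonic :: "('a \<Rightarrow> real) \<Rightarrow> 'a \<Rightarrow> bool" where
  "surface_subharmonic u x \<longleftrightarrow>
     (\<forall>(U, \<phi>) \<in> \<A>. x \<in> U \<longrightarrow> subharmonic_at 0 (u \<circ> inv_into U \<phi>) (\<phi> x))"

lemma surface_subharmonic_chart:
  assumes "(U, \<phi>) \<in> \<A>" "x \<in> U" "subharmonic_at 0 (u \<circ> inv_into U \<phi>) (\<phi> x)"
  shows "surface_subharmonic u x"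
  unfolding surface_subharmonic_def
proof (clarify)
  fix V \<psi> assume V: "(V, \<psi>) \<in> \<A>" "x \<in> V"
  obtain K e where "K > 0" "e > 0" "\<And>y u \<kappa> \<nu>. y \<in> V \<Longrightarrow> \<psi> y \<in> ball (\<psi> x) e \<Longrightarrow>
      subharmonic_at \<kappa> (u \<circ> inv_into U \<phi>) (\<phi> y) \<Longrightarrow> 0 \<le> \<nu> \<Longrightarrow> \<nu> * K\<^sup>2 \<le> \<kappa> \<Longrightarrow>
      subharmonic_at \<nu> (u \<circ> inv_into V \<psi>) (\<psi> y)"
    using subharmonic_chart_change[OF V(1) assms(1) V(2) assms(2)] by metis
  from this(3)[OF V(2) _ assms(3), of 0] this(2)
  show "subharmonic_at 0 (u \<circ> inv_into V \<psi>) (\<psi> x)" by simp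
qed

lemma surface_subharmonic_cong:
  assumes "openin S W" "x \<in> W" "\<And>y. y \<in> W \<Longrightarrow> u y = u' y" "surface_subharmonic u x"
  shows "surface_subharmonic u' x"
  unfolding surface_subharmonic_def
proof (clarify)
  fix U \<phi> assume U: "(U, \<phi>) \<in> \<A>" "x \<in> U"
  obtain e where e: "e > 0" "ball (\<phi> x) e \<subseteq> \<phi> ` (U \<inter> W)"
    using chart_ball[OF U(1) assms(1) U(2) assms(2)] .
  show "subharmonic_at 0 (u' \<circ> inv_into U \<phi>) (\<phi> x)"
  proof (rule subharmonic_at_touching[OF _ e(1)])
    show "subharmonic_at 0 (u \<circ> inv_into U \<phi>) (\<phi> x)"
      using assms U unfolding surface_subharmonic_def by auto
    show "(u \<circ> inv_into U \<phi>) z \<le> (u' \<circ> inv_into U \<phi>) z" if "z \<in> ball (\<phi> x) e" for z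
      using that e(2) assms(3) chart_inv_image[OF U(1), of "U \<inter> W" z] by auto
    show "(u \<circ> inv_into U \<phi>) (\<phi> x) = (u' \<circ> inv_into U \<phi>) (\<phi> x)"
      using assms U chart_inv[OF U] by simp
  qed simp
qed

lemma subharmonic_add_extension:
  assumes U: "(U, \<phi>) \<in> \<A>" "x \<in> U" and
    k: "subharmonic_at \<nu> (\<lambda>z. (u \<circ> inv_into U \<phi>) z + k z) (\<phi> x)"
  shows "subharmonic_at \<nu> ((\<lambda>y. u y + extend_by_zero U \<phi> k y) \<circ> inv_into U \<phi>) (\<phi> x)"
proof -
  obtain e where e: "e > 0" "ball (\<phi> x) e \<subseteq> \<phi> ` U"
    using chart_ball[OF U(1) chart_openin[OF U(1)] U(2,2)] by auto
  show ?thesis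
    by (rule subharmonic_at_touching[OF k e(1)])
      (use e(2) chart_inv_image[OF U(1) subset_refl] U chart_inv[OF U] extend_by_zero_def[OF U(1)] in auto)
qed

lemma surface_subharmonic_add_extension:
  assumes U: "(U, \<phi>) \<in> \<A>" and C: "compact C" "C \<subseteq> \<phi> ` U" "\<And>z. z \<notin> C \<Longrightarrow> k z = 0"
    and x: "x \<in> topspace S" "surface_subharmonic u x"
    and k: "x \<in> U \<Longrightarrow> subharmonic_at 0 (\<lambda>z. (u \<circ> inv_into U \<phi>) z + k z) (\<phi> x)"
  shows "surface_subharmonic (\<lambda>y. u y + extend_by_zero U \<phi> k y) x"
proof (cases "x \<in> U")
  case True
  then show ?thesis
    using surface_subharmonic_chart[OF U] subharmonic_add_extension[OF U] k by blast
next
  case False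
  show ?thesis
  proof (rule surface_subharmonic_cong[OF _ _ _ x(2)])
    show "openin S (topspace S - {x \<in> U. \<phi> x \<in> C})"
      using chart_compact_closedin[OF U C(1,2)] by blast
  qed (use x False C in \<open>auto simp: extend_by_zero_def[OF U]\<close>)
qed

section \<open>Strictly subharmonic functions\<close>

definition strictly_subharmonic_near :: "('a \<Rightarrow> real) \<Rightarrow> 'a \<Rightarrow> bool" where
  "strictly_subharmonic_near u x \<longleftrightarrow> (\<exists>U \<phi> \<kappa> e. (U, \<phi>) \<in> \<A> \<and> x \<in> U \<and> 0 < \<kappa> \<and> 0 < e \<and>
     (\<forall>y \<in> U. \<phi> y \<in> ball (\<phi> x) e \<longrightarrow> subharmonic_at \<kappa> (u \<circ> inv_into U \<phi>) (\<phi> y)))"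

lemma strictly_subharmonic_nearI:
  assumes "(U, \<phi>) \<in> \<A>" "x \<in> U" "0 < \<kappa>" "open T" "\<phi> x \<in> T"
    "\<And>y. y \<in> U \<Longrightarrow> \<phi> y \<in> T \<Longrightarrow> subharmonic_at \<kappa> (u \<circ> inv_into U \<phi>) (\<phi> y)"
  shows "strictly_subharmonic_near u x"
proof -
  obtain e where "e > 0" "ball (\<phi> x) e \<subseteq> T" using assms(4,5) open_contains_ball by blast
  then show ?thesis using assms unfolding strictly_subharmonic_near_def by blast
qed

lemma strictly_subharmonic_near_chart:
  assumes "strictly_subharmonic_near u x" "(U, \<phi>) \<in> \<A>" "x \<in> U"
  obtains \<kappa> e where "0 < \<kappa>" "0 < e"
    "\<And>y. y \<in> U \<Longrightarrow> \<phi> y \<in> ball (\<phi> x) e \<Longrightarrow> subharmonic_at \<kappa> (u \<circ> inv_into U \<phi>) (\<phi> y)"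
proof -
  obtain V \<psi> \<kappa> d where V: "(V, \<psi>) \<in> \<A>" "x \<in> V" and \<kappa>: "0 < \<kappa>" "0 < d"
    "\<And>y. y \<in> V \<Longrightarrow> \<psi> y \<in> ball (\<psi> x) d \<Longrightarrow> subharmonic_at \<kappa> (u \<circ> inv_into V \<psi>) (\<psi> y)"
    using assms(1) unfolding strictly_subharmonic_near_def by blast
  obtain K e where e: "K > 0" "e > 0" "\<And>y u \<kappa> \<nu>. y \<in> U \<Longrightarrow> \<phi> y \<in> ball (\<phi> x) e \<Longrightarrow>
      subharmonic_at \<kappa> (u \<circ> inv_into V \<psi>) (\<psi> y) \<Longrightarrow> 0 \<le> \<nu> \<Longrightarrow> \<nu> * K\<^sup>2 \<le> \<kappa> \<Longrightarrow>
      subharmonic_at \<nu> (u \<circ> inv_into U \<phi>) (\<phi> y)"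
    using subharmonic_chart_change[OF assms(2) V(1) assms(3) V(2)] by metis
  have "openin S {y \<in> V. \<psi> y \<in> ball (\<psi> x) d}"
    by (intro chart_vimage_openin[OF V(1)] open_ball)
  moreover have "x \<in> {y \<in> V. \<psi> y \<in> ball (\<psi> x) d}"
    using V \<kappa> by auto
  ultimately obtain c where c: "c > 0" "ball (\<phi> x) c \<subseteq> \<phi> ` (U \<inter> {y \<in> V. \<psi> y \<in> ball (\<psi> x) d})"
    using chart_ball[OF assms(2)] assms(3) by blast
  show ?thesis
  proof (rule that[of "\<kappa> / K\<^sup>2" "min c e"])
    fix y assume y: "y \<in> U" "\<phi> y \<in> ball (\<phi> x) (min c e)"
    then have "\<phi> y \<in> \<phi> ` (U \<inter> {y \<in> V. \<psi> y \<in> ball (\<psi> x) d})" using c(2) by auto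
    then have "y \<in> V" "\<psi> y \<in> ball (\<psi> x) d"
      using chart_inv_image[OF assms(2) Int_lower1] chart_inv[OF assms(2) y(1)] by (metis (lifting) Int_iff mem_Collect_eq)+
    then show "subharmonic_at (\<kappa> / K\<^sup>2) (u \<circ> inv_into U \<phi>) (\<phi> y)"
      using e y \<kappa>(1) by (intro e(3)[OF _ _ \<kappa>(3)]) auto
  qed (use \<kappa> e c in auto)
qed

lemma strictly_subharmonic_near_open:
  assumes "strictly_subharmonic_near u x"
  obtains W where "openin S W" "x \<in> W" "\<And>y. y \<in> W \<Longrightarrow> strictly_subharmonic_near u y"
proof -
  obtain U \<phi> \<kappa> e where U: "(U, \<phi>) \<in> \<A>" "x \<in> U" "0 < \<kappa>" "0 < e"
     "\<forall>y \<in> U. \<phi> y \<in> ball (\<phi> x) e \<longrightarrow> subharmonic_at \<kappa> (u \<circ> inv_into U \<phi>) (\<phi> y)"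
    using assms unfolding strictly_subharmonic_near_def by blast
  show ?thesis
  proof (rule that)
    show "openin S {y \<in> U. \<phi> y \<in> ball (\<phi> x) e}" using chart_vimage_openin[OF U(1)] by blast
    show "strictly_subharmonic_near u y" if "y \<in> {y \<in> U. \<phi> y \<in> ball (\<phi> x) e}" for y
      using that U by (intro strictly_subharmonic_nearI[OF U(1) _ U(3) open_ball]) auto
  qed (use U in auto)
qed

text \<open>
  Subharmonicity at the points of \<open>D\<close> cannot be asked for: on a compact surface only the constants
  are subharmonic everywhere.
\<close>

definition bounded_subharmonic_off :: "'a set \<Rightarrow> ('a \<Rightarrow> real) \<Rightarrow> bool" where
  "bounded_subharmonic_off D u \<longleftrightarrow> continuous_map S euclideanreal u \<and>
     (\<exists>M. \<forall>x \<in> topspace S. \<bar>u x\<bar> \<le> M) \<and> (\<forall>x \<in> topspace S - D. surface_subharmonic u x)"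

lemma bounded_subharmonic_off_zero: "bounded_subharmonic_off D (\<lambda>x. 0)"
  unfolding bounded_subharmonic_off_def surface_subharmonic_def
  by (auto simp: o_def subharmonic_at_const)

lemma bounded_subharmonic_off_bump:
  assumes u: "bounded_subharmonic_off D u" and U: "(U, \<phi>) \<in> \<A>"
    and R: "cball b R \<subseteq> \<phi> ` U" "0 < s" "s < R\<^sup>2" "0 < R" and A: "0 < A" "A / s\<^sup>2 \<le> \<kappa>"
    and low: "\<And>x. x \<in> U \<Longrightarrow> x \<notin> D \<Longrightarrow> (cmod (\<phi> x - b))\<^sup>2 \<le> s \<Longrightarrow> subharmonic_at \<kappa> (u \<circ> inv_into U \<phi>) (\<phi> x)"
  defines "u' \<equiv> \<lambda>x. u x + extend_by_zero U \<phi> (\<lambda>z. A * bump s R (z - b)) x"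
  shows "bounded_subharmonic_off D u'"
    and "\<And>x. x \<in> U \<Longrightarrow> x \<notin> D \<Longrightarrow> s < (cmod (\<phi> x - b))\<^sup>2 \<Longrightarrow> cmod (\<phi> x - b) < R \<Longrightarrow>
           subharmonic_at (A / R ^ 4) (u' \<circ> inv_into U \<phi>) (\<phi> x)"
proof -
  let ?k = "\<lambda>z. A * bump s R (z - b)"
  have k0: "?k z = 0" if "z \<notin> cball b R" for z
    using that R bump_outside[of s R "z - b"] by (simp add: dist_norm norm_minus_commute)
  have sub: "subharmonic_at 0 (u \<circ> inv_into U \<phi>) (\<phi> x)" if "x \<in> U" "x \<notin> D" for x
    using u U that chart_subset[OF U] unfolding bounded_subharmonic_off_def surface_subharmonic_def by blast
  show high: "subharmonic_at (A / R ^ 4) (u' \<circ> inv_into U \<phi>) (\<phi> x)"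
    if "x \<in> U" "x \<notin> D" "s < (cmod (\<phi> x - b))\<^sup>2" "cmod (\<phi> x - b) < R" for x
    unfolding u'_def by (intro subharmonic_add_extension[OF U] subharmonic_bump_high sub) (use that R A in auto)
  have "continuous_on (- {}) ?k"
    using R by (intro continuous_on_mult_left continuous_on_bump)
  from continuous_extend_by_zero[OF U compact_cball R(1) k0 this]
  have "continuous_map S euclideanreal (extend_by_zero U \<phi> ?k)" by simp
  then have cont: "continuous_map S euclideanreal u'"
    using u unfolding u'_def bounded_subharmonic_off_def by (intro continuous_map_add) auto
  obtain M where M: "\<And>x. x \<in> topspace S \<Longrightarrow> \<bar>u x\<bar> \<le> M"
    using u unfolding bounded_subharmonic_off_def by blast
  have "\<bar>extend_by_zero U \<phi> ?k x\<bar> \<le> A * (2 / s)" for x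
    using mult_left_mono[OF bump_le[OF R(2), of R "\<phi> x - b"], of A] A R bump_nonneg[of s R "\<phi> x - b"]
    by (auto simp: extend_by_zero_def[OF U] abs_mult)
  then have bdd: "\<bar>u' x\<bar> \<le> M + A * (2 / s)" if "x \<in> topspace S" for x
    unfolding u'_def by (intro order_trans[OF abs_triangle_ineq] add_mono M that)
  have "surface_subharmonic u' x" if x: "x \<in> topspace S - D" for x
    unfolding u'_def
  proof (rule surface_subharmonic_add_extension[OF U compact_cball R(1)])
    show "surface_subharmonic u x" using u x unfolding bounded_subharmonic_off_def by blast
    assume xU: "x \<in> U"
    consider "(cmod (\<phi> x - b))\<^sup>2 \<le> s" | "s < (cmod (\<phi> x - b))\<^sup>2" "cmod (\<phi> x - b) < R" | "R \<le> cmod (\<phi> x - b)"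
      by linarith
    then show "subharmonic_at 0 (\<lambda>z. (u \<circ> inv_into U \<phi>) z + ?k z) (\<phi> x)"
    proof cases
      case 1
      then show ?thesis using low[OF xU] x A R by (intro subharmonic_bump_low[of \<kappa>]) (auto simp: o_def)
    next
      case 2
      have "subharmonic_at 0 (u \<circ> inv_into U \<phi>) (\<phi> x)" using sub[OF xU] x by blast
      from subharmonic_bump_high[OF this R(2) 2 A(1)] show ?thesis
        by (rule subharmonic_at_touching[where e = 1]) (use A R in auto)
    next
      case 3
      then have "?k (\<phi> x) = 0" using bump_outside[OF R(2,3,4)] by simp
      moreover have "0 \<le> ?k z" for z using bump_nonneg[of s R "z - b"] A(1) by simp
      moreover have "subharmonic_at 0 (u \<circ> inv_into U \<phi>) (\<phi> x)" using sub[OF xU] x by blast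
      ultimately show ?thesis
        using subharmonic_at_touching[of 0 "u \<circ> inv_into U \<phi>" "\<phi> x" 1 "\<lambda>z. (u \<circ> inv_into U \<phi>) z + ?k z" 0]
        by (simp only: zero_less_one add_0_right le_add_same_cancel1 order_refl simp_thms)
    qed
  qed (use x k0 in auto)
  then show "bounded_subharmonic_off D u'"
    unfolding bounded_subharmonic_off_def using cont bdd by blast
qed

text \<open>
  The set of good points together with the open disc \<open>D'\<close> is open and closed. The points of \<open>D'\<close>
  outside \<open>D\<close> are good, because a bump around \<open>D\<close> has its cap inside \<open>D\<close>, where no condition is imposed. If a
  good point \<open>y\<close> lies close to \<open>x\<close>, a bump around \<open>y\<close> is added to the function \<open>u\<close> that belongs to
  \<open>y\<close>. Its cap is kept inside the small disc on which \<open>u\<close> is strictly subharmonic, and its outer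
  part reaches beyond \<open>x\<close>.
\<close>

lemma strictly_subharmonic_everywhere:
  assumes conn: "connected_space S" and U0: "(U\<^sub>0, \<phi>\<^sub>0) \<in> \<A>" and R0: "0 < R\<^sub>0" "cball b\<^sub>0 R\<^sub>0 \<subseteq> \<phi>\<^sub>0 ` U\<^sub>0"
  defines "D \<equiv> {x \<in> U\<^sub>0. \<phi>\<^sub>0 x \<in> cball b\<^sub>0 (R\<^sub>0 / 2)}"
  assumes q: "q \<in> topspace S - D"
  shows "\<exists>u. bounded_subharmonic_off D u \<and> strictly_subharmonic_near u q"
proof -
  define good where "good x \<longleftrightarrow> x \<in> topspace S - D \<and> (\<exists>u. bounded_subharmonic_off D u \<and> strictly_subharmonic_near u x)" for x
  define D' where "D' = {x \<in> U\<^sub>0. \<phi>\<^sub>0 x \<in> ball b\<^sub>0 R\<^sub>0}"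
  have "closedin S D"
    unfolding D_def using R0 by (intro chart_compact_closedin[OF U0 compact_cball] order_trans[OF _ R0(2)]) auto
  then have openD: "openin S (topspace S - D)" by blast
  have D': "openin S D'" "D \<subseteq> D'"
    unfolding D'_def using chart_vimage_openin[OF U0 open_ball] R0 by (blast, auto simp: D_def)
  have good_D': "good x" if x: "x \<in> D' - D" for x
  proof -
    let ?u = "\<lambda>x. 0 + extend_by_zero U\<^sub>0 \<phi>\<^sub>0 (\<lambda>z. 1 * bump ((R\<^sub>0 / 2)\<^sup>2) R\<^sub>0 (z - b\<^sub>0)) x"
    have low: "y \<in> D" if "y \<in> U\<^sub>0" "(cmod (\<phi>\<^sub>0 y - b\<^sub>0))\<^sup>2 \<le> (R\<^sub>0 / 2)\<^sup>2" for y
      using that R0 power2_le_imp_le[of "cmod (\<phi>\<^sub>0 y - b\<^sub>0)" "R\<^sub>0 / 2"]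
      by (auto simp: D_def dist_norm norm_minus_commute)
    have s: "0 < (R\<^sub>0 / 2)\<^sup>2" "(R\<^sub>0 / 2)\<^sup>2 < R\<^sub>0\<^sup>2" "0 < (1::real)" "1 / ((R\<^sub>0 / 2)\<^sup>2)\<^sup>2 \<le> 1 / ((R\<^sub>0 / 2)\<^sup>2)\<^sup>2"
      using R0 by (auto simp: power2_eq_square)
    note bump = bounded_subharmonic_off_bump[OF bounded_subharmonic_off_zero U0 R0(2) s(1,2) R0(1) s(3,4)]
    have 1: "bounded_subharmonic_off D ?u" by (rule bump(1)) (use low in auto)
    have 2: "subharmonic_at (1 / R\<^sub>0 ^ 4) (?u \<circ> inv_into U\<^sub>0 \<phi>\<^sub>0) (\<phi>\<^sub>0 y)"
      if "y \<in> U\<^sub>0" "y \<notin> D" "\<phi>\<^sub>0 y \<in> ball b\<^sub>0 R\<^sub>0" for y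
      by (rule bump(2)[where D = D]) (use low that in \<open>auto simp: dist_norm norm_minus_commute not_less[symmetric]\<close>)
    have "strictly_subharmonic_near ?u x"
    proof (rule strictly_subharmonic_nearI[OF U0])
      show "open (ball b\<^sub>0 R\<^sub>0 - cball b\<^sub>0 (R\<^sub>0 / 2))" by auto
      show "subharmonic_at (1 / R\<^sub>0 ^ 4) (?u \<circ> inv_into U\<^sub>0 \<phi>\<^sub>0) (\<phi>\<^sub>0 y)"
        if "y \<in> U\<^sub>0" "\<phi>\<^sub>0 y \<in> ball b\<^sub>0 R\<^sub>0 - cball b\<^sub>0 (R\<^sub>0 / 2)" for y
        using that by (intro 2) (auto simp: D_def)
    qed (use x R0 in \<open>auto simp: D_def D'_def\<close>)
    then show ?thesis using 1 x D' openin_subset unfolding good_def by blast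
  qed
  have good_open: "\<exists>W. openin S W \<and> x \<in> W \<and> W \<subseteq> {x. good x}" if x: "good x" for x
  proof -
    obtain u W where "bounded_subharmonic_off D u" "openin S W" "x \<in> W" "\<And>y. y \<in> W \<Longrightarrow> strictly_subharmonic_near u y"
      using x strictly_subharmonic_near_open unfolding good_def by metis
    then have "openin S (W \<inter> (topspace S - D))" "x \<in> W \<inter> (topspace S - D)" "W \<inter> (topspace S - D) \<subseteq> {x. good x}"
      using openD x unfolding good_def by auto
    then show ?thesis by blast
  qed
  define T where "T = {x. good x} \<union> D'"
  have "openin S {x. good x}"
    using good_open by (subst openin_subopen) blast
  then have openT: "openin S T"
    unfolding T_def using D' by blast
  have "S closure_of T \<subseteq> T"
  proof
    fix x assume x: "x \<in> S closure_of T"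
    show "x \<in> T"
    proof (cases "x \<in> D'")
      case False
      then have xD: "x \<in> topspace S - D" using D' x by (auto simp: in_closure_of)
      obtain U \<phi> where U: "(U, \<phi>) \<in> \<A>" "x \<in> U" using chart_at xD by blast
      obtain e where e: "e > 0" "ball (\<phi> x) e \<subseteq> \<phi> ` (U \<inter> (topspace S - D))"
        using chart_ball[OF U(1) openD U(2) xD] .
      define r where "r = e / 4"
      have r: "r > 0" "e = 4 * r" using e by (auto simp: r_def)
      define W where "W = {y \<in> U. \<phi> y \<in> ball (\<phi> x) r}"
      have "openin S W" unfolding W_def by (intro chart_vimage_openin[OF U(1) open_ball])
      moreover have "x \<in> W" using U r by (simp add: W_def)
      ultimately obtain y where "y \<in> T" "y \<in> W"
        using x unfolding in_closure_of by blast
      then have y: "y \<in> T" "y \<in> U" "\<phi> y \<in> ball (\<phi> x) r" by (auto simp: W_def)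
      have inD: "y' \<notin> D" if "y' \<in> U" "\<phi> y' \<in> ball (\<phi> x) e" for y'
        using chart_inv_image[OF U(1) Int_lower1 subsetD[OF e(2) that(2)]] chart_inv[OF U(1) that(1)]
        by simp
      have "y \<notin> D" using y r by (intro inD) auto
      then have "good y" using y(1) good_D' T_def by blast
      then obtain u where u: "bounded_subharmonic_off D u" "strictly_subharmonic_near u y"
        unfolding good_def by blast
      obtain \<kappa> d where \<kappa>: "0 < \<kappa>" "0 < d"
         "\<And>z. z \<in> U \<Longrightarrow> \<phi> z \<in> ball (\<phi> y) d \<Longrightarrow> subharmonic_at \<kappa> (u \<circ> inv_into U \<phi>) (\<phi> z)"
        using strictly_subharmonic_near_chart[OF u(2) U(1) y(2)] by blast
      let ?b = "\<phi> y"
      have "good x"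
      proof (cases "\<phi> x \<in> ball ?b d")
        case True
        then have "strictly_subharmonic_near u x"
          using U \<kappa> by (intro strictly_subharmonic_nearI[OF U \<kappa>(1) open_ball]) auto
        then show ?thesis using u xD unfolding good_def by blast
      next
        case False
        \<comment> \<open>The cap has radius \<open>min d r / 2\<close>, inside the disc of strictness and with \<open>x\<close> outside.\<close>
        define s where "s = (min d r / 2)\<^sup>2"
        have "min d r / 2 < 2 * r" "0 < min d r / 2" using \<kappa>(1,2) r by auto
        then have "s < (2 * r)\<^sup>2"
          unfolding s_def by (intro power_strict_mono) auto
        moreover have "0 < s" unfolding s_def using \<kappa>(1,2) r by simp
        ultimately have s: "0 < s" "s < (2 * r)\<^sup>2" "0 < 2 * r" "0 < \<kappa> * s\<^sup>2" "\<kappa> * s\<^sup>2 / s\<^sup>2 \<le> \<kappa>"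
          using \<kappa>(1,2) r by auto
        have cb: "cball ?b (2 * r) \<subseteq> ball (\<phi> x) e"
          using y(3) r by (auto simp: cball_subset_ball_iff dist_commute)
        then have cbU: "cball ?b (2 * r) \<subseteq> \<phi> ` U" using e by auto
        note bump = bounded_subharmonic_off_bump[OF u(1) U(1) cbU s]
        have low: "subharmonic_at \<kappa> (u \<circ> inv_into U \<phi>) (\<phi> z)"
          if "z \<in> U" "(cmod (\<phi> z - ?b))\<^sup>2 \<le> s" for z
        proof -
          have "cmod (\<phi> z - ?b) \<le> min d r / 2"
            using power2_le_imp_le[OF that(2)[unfolded s_def]] \<kappa>(2) r(1) by simp
          then have "cmod (\<phi> z - ?b) < d" using \<kappa>(2) by linarith
          then show ?thesis by (intro \<kappa>(3) that(1)) (simp add: dist_norm norm_minus_commute)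
        qed
        let ?u = "\<lambda>x. u x + extend_by_zero U \<phi> (\<lambda>z. \<kappa> * s\<^sup>2 * bump s (2 * r) (z - ?b)) x"
        have 1: "bounded_subharmonic_off D ?u" by (rule bump(1)) (rule low)
        let ?T = "{z. s < (cmod (z - ?b))\<^sup>2 \<and> cmod (z - ?b) < 2 * r}"
        have "strictly_subharmonic_near ?u x"
        proof (rule strictly_subharmonic_nearI[OF U, where T = ?T])
          show "open ?T" by (intro open_Collect_conj open_Collect_less continuous_intros)
          have "min d r / 2 < cmod (\<phi> x - ?b)" "cmod (\<phi> x - ?b) < 2 * r"
            using False \<kappa>(1,2) y r by (auto simp: dist_norm norm_minus_commute)
          moreover from this have "s < (cmod (\<phi> x - ?b))\<^sup>2"
            unfolding s_def using \<kappa>(1,2) r by (intro power_strict_mono) auto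
          ultimately show "\<phi> x \<in> ?T" by simp
          show "subharmonic_at (\<kappa> * s\<^sup>2 / (2 * r) ^ 4) (?u \<circ> inv_into U \<phi>) (\<phi> z)"
            if z: "z \<in> U" "\<phi> z \<in> ?T" for z
          proof (rule bump(2))
            have "\<phi> z \<in> cball ?b (2 * r)" using z by (simp add: dist_norm norm_minus_commute)
            then show "z \<notin> D" using inD[OF z(1)] cb by blast
            show "z \<in> U" "s < (cmod (\<phi> z - ?b))\<^sup>2" "cmod (\<phi> z - ?b) < 2 * r" using z by auto
          qed (rule low)
        qed (use s in auto)
        then show ?thesis using 1 xD unfolding good_def by blast
      qed
      then show ?thesis unfolding T_def by simp
    qed (simp add: T_def)
  qed
  moreover have "T \<subseteq> topspace S" using openT openin_subset by blast
  ultimately have "closedin S T"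
    by (metis closure_of_subset closure_of_subset_eq subset_antisym)
  moreover have "b\<^sub>0 \<in> \<phi>\<^sub>0 ` U\<^sub>0" using R0 by auto
  then have "T \<noteq> {}" unfolding T_def D'_def using R0 by auto
  ultimately have "T = topspace S"
    using conn openT unfolding connected_space_clopen_in by blast
  then have "good q" using q good_D' unfolding T_def by blast
  then show ?thesis unfolding good_def by blast
qed

section \<open>Functions with a logarithmic pole\<close>

text \<open>
  The competitors for the Green function of the complement of \<open>D\<close>, with pole at \<open>p\<close> and with the sign
  for which the pole is \<open>- \<infinity>\<close>. The pole condition is an upper bound and so allows stronger poles.
\<close>

definition log_pole_functions :: "'a set \<Rightarrow> 'a \<Rightarrow> ('a \<Rightarrow> real) set" where
  "log_pole_functions D p = {v.
     continuous_map (subtopology S (topspace S - D - {p})) euclideanreal v \<and>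
     (\<forall>x \<in> topspace S - D - {p}. v x \<le> 0 \<and> surface_subharmonic v x) \<and>
     (\<forall>(U, \<phi>) \<in> \<A>. p \<in> U \<longrightarrow> (\<exists>C e. 0 < e \<and>
        (\<forall>x \<in> U - {p}. cmod (\<phi> x - \<phi> p) < e \<longrightarrow> v x \<le> ln (cmod (\<phi> x - \<phi> p)) + C)))}"

lemma log_pole_functionsD:
  assumes "v \<in> log_pole_functions D p" "(U, \<phi>) \<in> \<A>" "p \<in> U"
  shows "\<exists>C e. 0 < e \<and> (\<forall>x \<in> U - {p}. cmod (\<phi> x - \<phi> p) < e \<longrightarrow> v x \<le> ln (cmod (\<phi> x - \<phi> p)) + C)"
proof -
  have "\<forall>(U, \<phi>) \<in> \<A>. p \<in> U \<longrightarrow> (\<exists>C e. 0 < e \<and>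
        (\<forall>x \<in> U - {p}. cmod (\<phi> x - \<phi> p) < e \<longrightarrow> v x \<le> ln (cmod (\<phi> x - \<phi> p)) + C))"
    using assms(1) unfolding log_pole_functions_def by (elim CollectE conjE)
  from bspec[OF this assms(2)] show ?thesis using assms(3) by simp
qed

text \<open>
  For \<open>\<theta> < 1\<close>, the maximum principle on an annulus compares \<open>v\<close> with \<open>\<theta>\<close> times the logarithm: on the
  outer circle by \<open>v \<le> 0\<close>, on a small inner circle because the pole of \<open>v\<close> has full strength. The
  bound is uniform over all competitors.
\<close>

lemma log_pole_function_le:
  assumes v: "v \<in> log_pole_functions D p" and U: "(U, \<phi>) \<in> \<A>" "p \<in> U"
    and R: "cball (\<phi> p) R \<subseteq> \<phi> ` (U - D)"
    and x: "x \<in> U" "x \<noteq> p" "cmod (\<phi> x - \<phi> p) \<le> R"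
  shows "v x \<le> ln (cmod (\<phi> x - \<phi> p) / R)"
proof -
  let ?b = "\<phi> p" and ?i = "inv_into U \<phi>"
  have xb: "\<phi> x \<noteq> ?b" using chart_inj[OF U(1)] x U by (auto dest: inj_onD)
  then have R0: "0 < R" using x by (smt (verit) zero_less_norm_iff right_minus_eq)
  obtain C e where e: "0 < e" "\<And>y. y \<in> U - {p} \<Longrightarrow> cmod (\<phi> y - ?b) < e \<Longrightarrow> v y \<le> ln (cmod (\<phi> y - ?b)) + C"
    using log_pole_functionsD[OF v U] by metis
  have inv: "?i z \<in> topspace S - D - {p}" "?i z \<in> U" "\<phi> (?i z) = z" if "z \<in> cball ?b R" "z \<noteq> ?b" for z
    using chart_inv_image[OF U(1) Diff_subset, of z D] subsetD[OF R that(1)] that chart_subset[OF U(1)]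
    by auto
  have le: "v x \<le> \<theta> * ln (cmod (\<phi> x - ?b) / R)" if \<theta>: "0 < \<theta>" "\<theta> < 1" for \<theta>
  proof -
    \<comment> \<open>On a circle of this radius the logarithm beats the constant in the pole condition.\<close>
    define m where "m = (\<bar>C\<bar> + \<bar>\<theta> * ln R\<bar>) / (1 - \<theta>)"
    define \<delta> where "\<delta> = Min {e / 2, cmod (\<phi> x - ?b), exp (- m)}"
    have \<delta>: "0 < \<delta>" "\<delta> < e" "\<delta> \<le> cmod (\<phi> x - ?b)" "\<delta> \<le> exp (- m)"
      using e xb by (auto simp: \<delta>_def min_def)
    have "ln \<delta> \<le> - m" using \<delta> by (metis ln_exp ln_mono exp_gt_zero)
    then have "(1 - \<theta>) * ln \<delta> \<le> (1 - \<theta>) * (- m)" using \<theta> by (intro mult_left_mono) auto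
    also have "\<dots> = - (\<bar>C\<bar> + \<bar>\<theta> * ln R\<bar>)" using \<theta> by (simp add: m_def)
    finally have small: "ln \<delta> + C + - \<theta> * ln (\<delta> / R) \<le> 0"
      using \<delta> R0 by (simp add: ln_div algebra_simps)
    let ?K = "cball ?b R - ball ?b \<delta>"
    let ?h = "\<lambda>z. - \<theta> * ln (cmod (z - ?b) / R)"
    have nb: "z \<noteq> ?b" if "z \<in> ?K" for z using that \<delta> by auto
    have int: "interior ?K = ball ?b R - cball ?b \<delta>"
      using \<delta>(1) by (simp add: interior_diff)
    have fr: "z \<in> ?K" "dist ?b z = R \<or> dist ?b z = \<delta>" if "z \<in> frontier ?K" for z
    proof -
      have "closed ?K" by (intro closed_Diff) auto
      then show "z \<in> ?K" using that frontier_subset_closed by blast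
      then show "dist ?b z = R \<or> dist ?b z = \<delta>"
        using that int unfolding frontier_def by auto
    qed
    have "(v \<circ> ?i) (\<phi> x) + ?h (\<phi> x) \<le> 0"
    proof (rule subharmonic_max_principle[where K = ?K and g = "v \<circ> ?i" and h = ?h])
      show "compact ?K" by (intro compact_diff) auto
      have "continuous_map (top_of_set ?K) (subtopology S (topspace S - D - {p})) ?i"
      proof (unfold continuous_map_in_subtopology, intro conjI)
        have "?K \<subseteq> \<phi> ` U" using R by auto
        then show "continuous_map (top_of_set ?K) S ?i"
          using continuous_chart_inv[OF U(1)] continuous_map_from_subtopology_mono by blast
        show "?i \<in> topspace (top_of_set ?K) \<rightarrow> topspace S - D - {p}"
          using inv nb by auto
      qed
      then have "continuous_map (top_of_set ?K) euclideanreal (v \<circ> ?i)"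
        using v unfolding log_pole_functions_def by (intro continuous_map_compose) auto
      then show "continuous_on ?K (v \<circ> ?i)" by simp
      show "continuous_on ?K ?h"
        using nb R0 by (intro continuous_intros) auto
      show "subharmonic_at 0 (v \<circ> ?i) a" if a: "a \<in> interior ?K" for a
      proof -
        have "a \<in> cball ?b R" "a \<noteq> ?b" using a int \<delta> by auto
        then have "surface_subharmonic v (?i a)" "?i a \<in> U" "\<phi> (?i a) = a"
          using v inv[of a] unfolding log_pole_functions_def by auto
        then show ?thesis using U unfolding surface_subharmonic_def by fastforce
      qed
      show "\<exists>e>0. \<exists>f. f holomorphic_on ball a e \<and> (\<forall>z\<in>ball a e. ?h z = Re (f z))" if a: "a \<in> interior ?K" for a
      proof (intro exI conjI ballI)
        have ab: "a \<noteq> ?b" using a int \<delta> by auto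
        then show "0 < cmod (a - ?b)" by simp
        let ?q = "\<lambda>z. (z - ?b) / (a - ?b)"
        let ?f = "\<lambda>z. of_real (- \<theta>) * (Ln (?q z) + of_real (ln (cmod (a - ?b) / R)))"
        have q: "?q z \<notin> \<real>\<^sub>\<le>\<^sub>0" "z \<noteq> ?b" if "z \<in> ball a (cmod (a - ?b))" for z
        proof -
          show "?q z \<notin> \<real>\<^sub>\<le>\<^sub>0"
            using that by (intro quotient_notin_nonpos_Reals) (simp add: dist_norm norm_minus_commute)
          then show "z \<noteq> ?b" by auto
        qed
        then show "?f holomorphic_on ball a (cmod (a - ?b))"
          using ab by (intro holomorphic_intros) auto
        show "?h z = Re (?f z)" if "z \<in> ball a (cmod (a - ?b))" for z
          using q[OF that] ab R0 by (simp add: Re_Ln norm_divide ln_div)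
      qed
      show "\<phi> x \<in> ?K" using x \<delta> by (simp add: dist_norm norm_minus_commute)
      fix z assume z: "z \<in> frontier ?K"
      from fr(2)[OF z] show "(v \<circ> ?i) z + ?h z \<le> 0"
      proof
        assume "dist ?b z = R"
        then have "cmod (z - ?b) / R = 1" using R0 by (simp add: dist_norm norm_minus_commute)
        moreover have "v (?i z) \<le> 0"
          using v inv(1)[of z] fr(1)[OF z] nb[OF fr(1)[OF z]] unfolding log_pole_functions_def by auto
        moreover have "(v \<circ> ?i) z = v (?i z)" by simp
        ultimately show ?thesis by (simp only: ln_one mult_zero_right add_0_right)
      next
        assume *: "dist ?b z = \<delta>"
        then have c: "cmod (z - ?b) = \<delta>" by (simp add: dist_norm norm_minus_commute)
        have "z \<in> cball ?b R" "z \<noteq> ?b" using fr(1)[OF z] nb by auto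
        then have "v (?i z) \<le> ln \<delta> + C"
          using e(2)[of "?i z"] inv[of z] c \<delta> by auto
        then show ?thesis using small c by simp
      qed
    qed
    then show ?thesis using chart_inv[OF U(1) x(1)] by simp
  qed
  have "((\<lambda>\<theta>. \<theta> * ln (cmod (\<phi> x - ?b) / R)) \<longlongrightarrow> 1 * ln (cmod (\<phi> x - ?b) / R)) (at_left 1)"
    by (intro tendsto_intros)
  moreover have "eventually (\<lambda>\<theta>. v x \<le> \<theta> * ln (cmod (\<phi> x - ?b) / R)) (at_left 1)"
    using le eventually_at_left_real[of 0 1] by (auto elim: eventually_mono)
  ultimately show ?thesis
    using tendsto_lowerbound[of _ _ "at_left (1::real)"] by simp
qed

text \<open>
  The logarithmic pole is added to a function \<open>u\<close> that is strictly subharmonic near \<open>q\<close>. Outside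
  the disc of radius \<open>r\<close> around \<open>p\<close> nothing changes, so the bounds of \<open>u\<close> bound the result from
  below there. Radius, strictness and bounds do not depend on \<open>p\<close>, and therefore one \<open>n\<close> serves all
  \<open>p\<close> near \<open>q\<close>.
\<close>

lemma log_pole_function_exists:
  assumes u: "bounded_subharmonic_off D u" "strictly_subharmonic_near u q"
    and q: "q \<in> topspace S - D" and D: "closedin S D"
  obtains U \<phi> r n where "(U, \<phi>) \<in> \<A>" "q \<in> U" "0 < r" "ball (\<phi> q) (4 * r) \<subseteq> \<phi> ` (U - D)"
    "\<And>p. p \<in> U \<Longrightarrow> \<phi> p \<in> ball (\<phi> q) r \<Longrightarrow> \<exists>v \<in> log_pole_functions D p.
       \<forall>x \<in> topspace S - D. \<not> (x \<in> U \<and> \<phi> x \<in> ball (\<phi> q) (2 * r)) \<longrightarrow> - real n < v x"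
proof -
  obtain U \<phi> where U: "(U, \<phi>) \<in> \<A>" "q \<in> U" using chart_at q by blast
  obtain \<kappa> e where \<kappa>: "0 < \<kappa>" "0 < e"
    "\<And>y. y \<in> U \<Longrightarrow> \<phi> y \<in> ball (\<phi> q) e \<Longrightarrow> subharmonic_at \<kappa> (u \<circ> inv_into U \<phi>) (\<phi> y)"
    using strictly_subharmonic_near_chart[OF u(2) U] by metis
  have "openin S (topspace S - D)" using D by blast
  then obtain e' where e': "e' > 0" "ball (\<phi> q) e' \<subseteq> \<phi> ` (U \<inter> (topspace S - D))"
    using chart_ball[OF U(1) _ U(2) q] by metis
  define r where "r = min e e' / 4"
  have r: "0 < r" "4 * r \<le> e" "4 * r \<le> e'" using \<kappa> e' by (auto simp: r_def)
  have U_D: "ball (\<phi> q) (4 * r) \<subseteq> \<phi> ` (U - D)"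
    using e'(2) subset_ball[OF r(3), of "\<phi> q"] by blast
  obtain M where M: "\<And>x. x \<in> topspace S \<Longrightarrow> \<bar>u x\<bar> \<le> M"
    using u unfolding bounded_subharmonic_off_def by blast
  define c where "c = \<kappa> * r\<^sup>2 / 2"
  have c: "0 < c" using \<kappa> r by (simp add: c_def)
  \<comment> \<open>Outside the disc the function \<open>v\<close> below is at least \<open>(- M - (M + 2 * c)) / c\<close>.\<close>
  obtain n :: nat where n: "(2 * M + 2 * c) / c < real n" using reals_Archimedean2 by blast
  show ?thesis
  proof (rule that[OF U r(1) U_D, of n])
    fix p assume p: "p \<in> U" "\<phi> p \<in> ball (\<phi> q) r"
    let ?b = "\<phi> p"
    let ?k = "\<lambda>z. log_pole \<kappa> r (z - ?b)"
    define w where "w x = u x + extend_by_zero U \<phi> ?k x" for x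
    \<comment> \<open>The constant makes \<open>v\<close> nonpositive, and the factor turns the coefficient \<open>c\<close> of the logarithm into 1.\<close>
    define v where "v x = (w x - (M + 2 * c)) / c" for x
    have cb: "cball ?b r \<subseteq> ball (\<phi> q) (2 * r)"
      using p r by (auto simp: cball_subset_ball_iff dist_commute)
    moreover have "ball (\<phi> q) (2 * r) \<subseteq> ball (\<phi> q) (4 * r)" using r by (intro subset_ball) auto
    ultimately have cbU: "cball ?b r \<subseteq> \<phi> ` U" using U_D by blast
    have k0: "?k z = 0" if "z \<notin> cball ?b r" for z
      using that r log_pole_outside[of r "z - ?b"] by (simp add: dist_norm norm_minus_commute)
    have pU: "{x \<in> U. \<phi> x \<in> {?b}} = {p}" using chart_inj[OF U(1)] p by (auto dest: inj_onD)
    have xp: "\<phi> x \<noteq> ?b" if "x \<in> U" "x \<noteq> p" for x using pU that by auto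
    have "continuous_on (- {?b}) ?k" using r by (intro continuous_on_log_pole) auto
    from continuous_extend_by_zero[OF U(1) compact_cball cbU k0 this closed_singleton]
    have contk: "continuous_map (subtopology S (topspace S - {p})) euclideanreal (extend_by_zero U \<phi> ?k)"
      by (simp only: pU simp_thms)
    have "continuous_map (subtopology S (topspace S - D - {p})) euclideanreal (extend_by_zero U \<phi> ?k)"
      by (rule continuous_map_from_subtopology_mono[OF contk]) auto
    moreover have "continuous_map (subtopology S (topspace S - D - {p})) euclideanreal u"
      using u(1) unfolding bounded_subharmonic_off_def by (intro continuous_map_from_subtopology) auto
    ultimately have contv: "continuous_map (subtopology S (topspace S - D - {p})) euclideanreal v"
      unfolding v_def w_def divide_inverse by (intro continuous_intros) auto
    have kle: "extend_by_zero U \<phi> ?k x \<le> 2 * c" if "x \<noteq> p" for x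
    proof (cases "x \<in> U")
      case True
      then show ?thesis using log_pole_le(1)[OF r(1) \<kappa>(1), of "\<phi> x - ?b"] xp[OF True that]
        by (simp add: extend_by_zero_def[OF U(1)] c_def)
    next
      case False
      then show ?thesis using c by (simp add: extend_by_zero_def[OF U(1)])
    qed
    have v0: "v x \<le> 0" if "x \<in> topspace S" "x \<noteq> p" for x
    proof -
      have "w x \<le> M + 2 * c" unfolding w_def using M[OF that(1)] kle[OF that(2)] by linarith
      then show ?thesis unfolding v_def using c by (simp add: divide_nonpos_pos)
    qed
    have subv: "surface_subharmonic v x" if x: "x \<in> topspace S - D - {p}" for x
    proof -
      have "surface_subharmonic w x"
        unfolding w_def
      proof (rule surface_subharmonic_add_extension[OF U(1) compact_cball cbU k0])
        show ux: "surface_subharmonic u x" using u x unfolding bounded_subharmonic_off_def by blast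
        assume xU: "x \<in> U"
        have sub0: "subharmonic_at 0 (u \<circ> inv_into U \<phi>) (\<phi> x)"
          using ux U(1) xU unfolding surface_subharmonic_def by fastforce
        show "subharmonic_at 0 (\<lambda>z. (u \<circ> inv_into U \<phi>) z + ?k z) (\<phi> x)"
        proof (cases "cmod (\<phi> x - ?b) < r")
          case True
          then have "\<phi> x \<in> cball ?b r" by (simp add: dist_norm norm_minus_commute)
          then have "\<phi> x \<in> ball (\<phi> q) e" using cb r by (fastforce simp: subset_iff)
          then have "subharmonic_at \<kappa> (u \<circ> inv_into U \<phi>) (\<phi> x)" using \<kappa>(3) xU by blast
          moreover have "\<phi> x \<noteq> ?b" using xp xU x by blast
          ultimately show ?thesis by (rule subharmonic_log_pole[OF _ r(1) _ True \<kappa>(1)])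
        next
          case False
          then have "r \<le> cmod (\<phi> x - ?b)" by simp
          then show ?thesis by (rule subharmonic_log_pole_outside[OF sub0 r(1) _ \<kappa>(1)])
        qed
      qed (use x in auto)
      then have "subharmonic_at 0 (w \<circ> inv_into V \<psi>) (\<psi> x)" if "(V, \<psi>) \<in> \<A>" "x \<in> V" for V \<psi>
        using that unfolding surface_subharmonic_def by blast
      from subharmonic_at_affine[OF this c] show ?thesis
        unfolding surface_subharmonic_def v_def by (auto simp: o_def)
    qed
    have pole: "\<exists>C e. 0 < e \<and> (\<forall>x\<in>V - {p}. cmod (\<psi> x - \<psi> p) < e \<longrightarrow> v x \<le> ln (cmod (\<psi> x - \<psi> p)) + C)"
      if V: "(V, \<psi>) \<in> \<A>" "p \<in> V" for V \<psi>
    proof -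
      let ?\<tau> = "\<phi> \<circ> inv_into V \<psi>"
      obtain L d where d: "L > 0" "d > 0" "ball (\<psi> p) d \<subseteq> \<psi> ` (V \<inter> U)"
        "\<And>z w. z \<in> ball (\<psi> p) d \<Longrightarrow> w \<in> ball (\<psi> p) d \<Longrightarrow> cmod (?\<tau> z - ?\<tau> w) \<le> L * cmod (z - w)"
        using transition_Lipschitz[OF V(1) U(1)] V p by blast
      define C where "C = ln L + (2 * c - c * ln r) / c - 2"
      have "v x \<le> ln (cmod (\<psi> x - \<psi> p)) + C"
        if x: "x \<in> V" "x \<noteq> p" "cmod (\<psi> x - \<psi> p) < min d (r / L)" for x
      proof -
        have xb: "\<psi> x \<in> ball (\<psi> p) d" using x by (simp add: dist_norm norm_minus_commute)
        then have xU: "x \<in> U"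
          using chart_inv_image[OF V(1) Int_lower1 subsetD[OF d(3) xb]] chart_inv[OF V(1) x(1)] by simp
        have le: "cmod (\<phi> x - ?b) \<le> L * cmod (\<psi> x - \<psi> p)"
          using d(4)[OF xb, of "\<psi> p"] d(2) chart_inv[OF V(1)] V(2) x(1) by simp
        also have "\<dots> < L * (r / L)" using x d by (intro mult_strict_left_mono) auto
        finally have lt: "cmod (\<phi> x - ?b) < r" using d by simp
        have pos: "0 < cmod (\<phi> x - ?b)" using xp[OF xU x(2)] by simp
        have "\<psi> x \<noteq> \<psi> p" using pos le by auto
        then have "ln (cmod (\<phi> x - ?b)) \<le> ln L + ln (cmod (\<psi> x - \<psi> p))"
          using le pos d by (metis ln_le_cancel_iff ln_mult_pos mult_pos_pos zero_less_norm_iff right_minus_eq)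
        then have "c * ln (cmod (\<phi> x - ?b)) \<le> c * (ln L + ln (cmod (\<psi> x - \<psi> p)))"
          using c by simp
        moreover have "w x \<le> M + (c * ln (cmod (\<phi> x - ?b)) + (2 * c - c * ln r))"
          using log_pole_le(2)[OF r(1) \<kappa>(1) _ lt] pos M[of x] xU chart_subset[OF U(1)]
          by (auto simp: w_def extend_by_zero_def[OF U(1)] c_def)
        ultimately have "w x - (M + 2 * c) \<le> c * (ln L + ln (cmod (\<psi> x - \<psi> p))) + (2 * c - c * ln r) - 2 * c"
          by simp
        then have "v x \<le> (c * (ln L + ln (cmod (\<psi> x - \<psi> p))) + (2 * c - c * ln r) - 2 * c) / c"
          unfolding v_def using c by (intro divide_right_mono) auto
        also have "\<dots> = ln (cmod (\<psi> x - \<psi> p)) + C"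
          using c by (simp add: C_def field_simps)
        finally show ?thesis .
      qed
      then show ?thesis using d r by (intro exI[of _ C] exI[of _ "min d (r / L)"]) auto
    qed
    have "v \<in> log_pole_functions D p"
      unfolding log_pole_functions_def using contv v0 subv pole by auto
    moreover have "- real n < v x" if x: "x \<in> topspace S - D" "\<not> (x \<in> U \<and> \<phi> x \<in> ball (\<phi> q) (2 * r))" for x
    proof -
      have "extend_by_zero U \<phi> ?k x = 0"
        using x(2) subsetD[OF cb, of "\<phi> x"] k0[of "\<phi> x"] by (auto simp: extend_by_zero_def[OF U(1)])
      then have "- (2 * M + 2 * c) \<le> w x - (M + 2 * c)"
        using M[of x] x by (simp add: w_def)
      then have "- (2 * M + 2 * c) / c \<le> v x"
        unfolding v_def using c by (intro divide_right_mono) auto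
      then show ?thesis using n minus_divide_left[of "2 * M + 2 * c" c] by linarith
    qed
    ultimately show "\<exists>v \<in> log_pole_functions D p.
       \<forall>x \<in> topspace S - D. \<not> (x \<in> U \<and> \<phi> x \<in> ball (\<phi> q) (2 * r)) \<longrightarrow> - real n < v x"
      by blast
  qed
qed

section \<open>The theorem of Rado\<close>

text \<open>
  The canonical neighbourhoods are the sets where every competitor with pole at \<open>p\<close> is at most \<open>- k\<close>.
  The upper bound for all competitors makes them large and the existence of one good competitor makes
  them small. Competitors live off \<open>D\<close> only, so the index \<open>0\<close> is reserved for the chart around \<open>D\<close>.
\<close>

theorem Rado:
  assumes conn: "connected_space S"
  shows "second_countable S"
proof (cases "topspace S = {}")
  case True
  then show ?thesis
    unfolding second_countable_def by (auto intro!: exI[of _ "{}"] dest: openin_subset)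
next
  case False
  then obtain o' where o': "o' \<in> topspace S" by blast
  obtain U\<^sub>0 \<phi>\<^sub>0 where U0: "(U\<^sub>0, \<phi>\<^sub>0) \<in> \<A>" "o' \<in> U\<^sub>0" using chart_at o' by blast
  obtain R\<^sub>0 where R0: "0 < R\<^sub>0" "cball (\<phi>\<^sub>0 o') R\<^sub>0 \<subseteq> \<phi>\<^sub>0 ` U\<^sub>0"
    using chart_open[OF U0(1)] U0(2) open_contains_cball by blast
  define D where "D = {x \<in> U\<^sub>0. \<phi>\<^sub>0 x \<in> cball (\<phi>\<^sub>0 o') (R\<^sub>0 / 2)}"
  have D: "closedin S D"
    unfolding D_def using R0 by (intro chart_compact_closedin[OF U0(1) compact_cball] order_trans[OF _ R0(2)]) auto
  have DU: "D \<subseteq> U\<^sub>0" by (auto simp: D_def)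
  define N where "N p n = (case n of 0 \<Rightarrow> U\<^sub>0
    | Suc k \<Rightarrow> {x \<in> topspace S - D. x = p \<or> (\<forall>v \<in> log_pole_functions D p. v x \<le> - real k)})" for p n
  show ?thesis
  proof (rule second_countable_if_canonical_neighbourhoods[OF conn])
    fix q assume q: "q \<in> topspace S"
    show "\<exists>n V W. openin S V \<and> q \<in> V \<and> openin S W \<and>
      second_countable (subtopology S W) \<and> (\<forall>p \<in> V. V \<subseteq> N p n \<and> N p n \<subseteq> W)"
    proof (cases "q \<in> U\<^sub>0")
      case True
      then show ?thesis
        using chart_openin[OF U0(1)] chart_second_countable[OF U0(1) subset_refl]
        by (intro exI[of _ 0] exI[of _ U\<^sub>0]) (auto simp: N_def)
    next
      case False
      then have qD: "q \<in> topspace S - D" using q DU by blast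
      then obtain u where u: "bounded_subharmonic_off D u" "strictly_subharmonic_near u q"
        using strictly_subharmonic_everywhere[OF conn U0(1) R0] unfolding D_def by blast
      obtain U \<phi> r n where U: "(U, \<phi>) \<in> \<A>" "q \<in> U" and r: "0 < r" "ball (\<phi> q) (4 * r) \<subseteq> \<phi> ` (U - D)"
        and n: "\<And>p. p \<in> U \<Longrightarrow> \<phi> p \<in> ball (\<phi> q) r \<Longrightarrow> \<exists>v \<in> log_pole_functions D p.
          \<forall>x \<in> topspace S - D. \<not> (x \<in> U \<and> \<phi> x \<in> ball (\<phi> q) (2 * r)) \<longrightarrow> - real n < v x"
        using log_pole_function_exists[OF u qD D] by metis
      \<comment> \<open>The bound \<open>ln (\<bar>\<phi> x - \<phi> p\<bar> / (2 * r))\<close> is at most \<open>- n\<close> within distance \<open>2 * \<delta>\<close>.\<close>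
      define \<delta> where "\<delta> = r * exp (- real n)"
      have \<delta>: "0 < \<delta>" "\<delta> \<le> r" "\<delta> / r = exp (- real n)" using r by (auto simp: \<delta>_def)
      let ?V = "{x \<in> U. \<phi> x \<in> ball (\<phi> q) \<delta>}"
      have inD: "x \<in> topspace S - D" if "x \<in> U" "\<phi> x \<in> ball (\<phi> q) (4 * r)" for x
        using chart_inv_image[OF U(1) Diff_subset subsetD[OF r(2) that(2)]] chart_inv[OF U(1) that(1)]
          chart_subset[OF U(1)] that(1) by auto
      have "?V \<subseteq> N p (Suc n) \<and> N p (Suc n) \<subseteq> U" if p: "p \<in> ?V" for p
      proof
        have pr: "\<phi> p \<in> ball (\<phi> q) r" "p \<in> U" using p \<delta> by auto
        show "N p (Suc n) \<subseteq> U"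
        proof
          fix x assume x: "x \<in> N p (Suc n)"
          obtain v where "v \<in> log_pole_functions D p"
            "\<forall>x \<in> topspace S - D. \<not> (x \<in> U \<and> \<phi> x \<in> ball (\<phi> q) (2 * r)) \<longrightarrow> - real n < v x"
            using n pr by metis
          then show "x \<in> U" using x pr(2) unfolding N_def by fastforce
        qed
        have cb: "cball (\<phi> p) (2 * r) \<subseteq> \<phi> ` (U - D)"
          using r pr by (intro order_trans[OF _ r(2)]) (auto simp: cball_subset_ball_iff dist_commute)
        show "?V \<subseteq> N p (Suc n)"
        proof
          fix x assume x: "x \<in> ?V"
          have "v x \<le> - real n" if "x \<noteq> p" "v \<in> log_pole_functions D p" for v
          proof -
            have "dist (\<phi> x) (\<phi> p) < 2 * \<delta>"
              using x p dist_triangle[of "\<phi> x" "\<phi> p" "\<phi> q"] by (simp add: dist_commute)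
            then have lt: "cmod (\<phi> x - \<phi> p) < 2 * \<delta>" by (simp add: dist_norm)
            have "\<phi> x \<noteq> \<phi> p" using chart_inj[OF U(1)] x pr that by (auto dest: inj_onD)
            then have "0 < cmod (\<phi> x - \<phi> p) / (2 * r)" using r by simp
            moreover have "cmod (\<phi> x - \<phi> p) / (2 * r) \<le> \<delta> / r"
              using lt r by (simp add: field_simps)
            ultimately have "ln (cmod (\<phi> x - \<phi> p) / (2 * r)) \<le> ln (\<delta> / r)"
              by simp
            moreover have "v x \<le> ln (cmod (\<phi> x - \<phi> p) / (2 * r))"
              by (rule log_pole_function_le[OF that(2) U(1) pr(2) cb]) (use x that lt \<delta> in auto)
            ultimately show ?thesis using \<delta>(3) by simp
          qed
          moreover have "x \<in> topspace S - D" using x \<delta> r by (intro inD) auto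
          ultimately show "x \<in> N p (Suc n)" unfolding N_def by auto
        qed
      qed
      then have "\<forall>p \<in> ?V. ?V \<subseteq> N p (Suc n) \<and> N p (Suc n) \<subseteq> U" by (intro ballI)
      moreover have "openin S ?V" by (intro chart_vimage_openin[OF U(1)] open_ball)
      moreover have "q \<in> ?V" using U \<delta> by simp
      ultimately have "openin S ?V \<and> q \<in> ?V \<and> openin S U \<and> second_countable (subtopology S U) \<and>
          (\<forall>p \<in> ?V. ?V \<subseteq> N p (Suc n) \<and> N p (Suc n) \<subseteq> U)"
        using chart_openin[OF U(1)] chart_second_countable[OF U(1) subset_refl] by (intro conjI)
      then show ?thesis by (intro exI)
    qed
  qed
qed

section \<open>Holomorphic maps between Riemann surfaces\<close>

lemma surface_holomorphicD:
  assumes "surface_holomorphic_on S \<A> D f"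
  shows "openin S D" "continuous_map (subtopology S D) S f"
    "\<And>U \<phi> V \<psi>. (U, \<phi>) \<in> \<A> \<Longrightarrow> (V, \<psi>) \<in> \<A> \<Longrightarrow>
       (\<psi> \<circ> f \<circ> inv_into U \<phi>) holomorphic_on (\<phi> ` {z \<in> U \<inter> D. f z \<in> V})"
proof -
  show "openin S D" "continuous_map (subtopology S D) S f"
    using assms by (simp_all add: surface_holomorphic_on_def)
  fix U \<phi> V \<psi> assume UV: "(U, \<phi>) \<in> \<A>" "(V, \<psi>) \<in> \<A>"
  have "\<forall>(U, \<phi>) \<in> \<A>. \<forall>(V, \<psi>) \<in> \<A>.
        (\<psi> \<circ> f \<circ> inv_into U \<phi>) holomorphic_on (\<phi> ` {z \<in> U \<inter> D. f z \<in> V})"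
    using assms unfolding surface_holomorphic_on_def by (elim conjE)
  from bspec[OF this UV(1)] show "(\<psi> \<circ> f \<circ> inv_into U \<phi>) holomorphic_on (\<phi> ` {z \<in> U \<inter> D. f z \<in> V})"
    using UV(2) by auto
qed

lemma surface_holomorphicI:
  assumes "openin S D" "continuous_map (subtopology S D) S f"
    "\<And>U \<phi> V \<psi>. (U, \<phi>) \<in> \<A> \<Longrightarrow> (V, \<psi>) \<in> \<A> \<Longrightarrow>
       (\<psi> \<circ> f \<circ> inv_into U \<phi>) holomorphic_on (\<phi> ` {z \<in> U \<inter> D. f z \<in> V})"
  shows "surface_holomorphic_on S \<A> D f"
  using assms unfolding surface_holomorphic_on_def by blast

lemma surface_holomorphic_preimage:
  assumes f: "surface_holomorphic_on S \<A> D f" and E: "openin S E"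
  shows "openin S {z \<in> D. f z \<in> E}"
proof -
  have D: "openin S D" using f by (rule surface_holomorphicD)
  have "openin (subtopology S D) {z \<in> topspace (subtopology S D). f z \<in> E}"
    using surface_holomorphicD(2)[OF f] E by (rule openin_continuous_map_preimage)
  moreover have "topspace (subtopology S D) = D"
    using openin_subset[OF D] by auto
  ultimately show ?thesis using D openin_trans_full by metis
qed

lemma surface_holomorphic_image:
  assumes f: "surface_holomorphic_on S \<A> D f" and "z \<in> D"
  shows "f z \<in> topspace S"
  using continuous_map_image_subset_topspace[OF surface_holomorphicD(2)[OF f]]
    openin_subset[OF surface_holomorphicD(1)[OF f]] assms(2) by auto

lemma surface_holomorphic_compose:
  assumes f: "surface_holomorphic_on S \<A> D f" and g: "surface_holomorphic_on S \<A> E g"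
  shows "surface_holomorphic_on S \<A> {z \<in> D. f z \<in> E} (g \<circ> f)"
proof (rule surface_holomorphicI)
  let ?D = "{z \<in> D. f z \<in> E}"
  show D: "openin S ?D"
    using surface_holomorphic_preimage[OF f surface_holomorphicD(1)[OF g]] .
  have "continuous_map (subtopology S ?D) (subtopology S E) f"
    using continuous_map_from_subtopology_mono[OF surface_holomorphicD(2)[OF f], of ?D]
    by (auto simp: continuous_map_in_subtopology)
  then show "continuous_map (subtopology S ?D) S (g \<circ> f)"
    using surface_holomorphicD(2)[OF g] by (rule continuous_map_compose)
  fix U \<phi> V \<psi> assume U: "(U, \<phi>) \<in> \<A>" and V: "(V, \<psi>) \<in> \<A>"
  show "(\<psi> \<circ> (g \<circ> f) \<circ> inv_into U \<phi>) holomorphic_on \<phi> ` {z \<in> U \<inter> ?D. (g \<circ> f) z \<in> V}"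
  proof (rule holomorphic_on_if_locally)
    fix w assume "w \<in> \<phi> ` {z \<in> U \<inter> ?D. (g \<circ> f) z \<in> V}"
    then obtain z where z: "w = \<phi> z" "z \<in> U" "z \<in> D" "f z \<in> E" "g (f z) \<in> V" by auto
    obtain W \<rho> where W: "(W, \<rho>) \<in> \<A>" "f z \<in> W"
      using chart_at surface_holomorphic_image[OF f z(3)] by blast
    let ?N = "{y \<in> D. f y \<in> {y \<in> E. g y \<in> V} \<inter> W}"
    have N: "openin S ?N"
      by (intro surface_holomorphic_preimage[OF f] openin_Int surface_holomorphic_preimage[OF g] chart_openin[OF V] chart_openin[OF W(1)])
    have hf: "(\<rho> \<circ> f \<circ> inv_into U \<phi>) holomorphic_on \<phi> ` (U \<inter> ?N)"
      by (rule holomorphic_on_subset[OF surface_holomorphicD(3)[OF f U W(1)]]) auto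
    have hg: "(\<psi> \<circ> g \<circ> inv_into W \<rho>) holomorphic_on \<rho> ` {y \<in> W \<inter> E. g y \<in> V}"
      by (rule surface_holomorphicD(3)[OF g W(1) V])
    have inv: "inv_into U \<phi> y \<in> U \<inter> ?N" if "y \<in> \<phi> ` (U \<inter> ?N)" for y
      using chart_inv_image[OF U Int_lower1 that] by blast
    have "((\<psi> \<circ> g \<circ> inv_into W \<rho>) \<circ> (\<rho> \<circ> f \<circ> inv_into U \<phi>)) holomorphic_on \<phi> ` (U \<inter> ?N)"
      using inv by (intro holomorphic_on_compose_gen[OF hf hg]) auto
    then have "(\<psi> \<circ> (g \<circ> f) \<circ> inv_into U \<phi>) holomorphic_on \<phi> ` (U \<inter> ?N)"
    proof (rule holomorphic_transform)
      fix y assume "y \<in> \<phi> ` (U \<inter> ?N)"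
      from inv[OF this] show "((\<psi> \<circ> g \<circ> inv_into W \<rho>) \<circ> (\<rho> \<circ> f \<circ> inv_into U \<phi>)) y = (\<psi> \<circ> (g \<circ> f) \<circ> inv_into U \<phi>) y"
        using chart_inv[OF W(1)] by simp
    qed
    moreover have "open (\<phi> ` (U \<inter> ?N))" by (rule chart_image_open[OF U N])
    moreover have "w \<in> \<phi> ` (U \<inter> ?N)" using z W by auto
    ultimately show "\<exists>T. open T \<and> w \<in> T \<and> (\<psi> \<circ> (g \<circ> f) \<circ> inv_into U \<phi>) holomorphic_on T"
      by blast
  qed
qed

lemma surface_holomorphic_mono:
  assumes f: "surface_holomorphic_on S \<A> D f" and D': "openin S D'" "D' \<subseteq> D"
    and fg: "\<And>z. z \<in> D' \<Longrightarrow> f z = g z"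
  shows "surface_holomorphic_on S \<A> D' g"
proof -
  have "continuous_map (subtopology S D') S g"
    by (rule continuous_map_eq[OF continuous_map_from_subtopology_mono[OF surface_holomorphicD(2)[OF f] D'(2)]])
      (use fg in auto)
  moreover have "(\<psi> \<circ> g \<circ> inv_into U \<phi>) holomorphic_on (\<phi> ` {z \<in> U \<inter> D'. g z \<in> V})"
    if U: "(U, \<phi>) \<in> \<A>" and V: "(V, \<psi>) \<in> \<A>" for U \<phi> V \<psi>
  proof (rule holomorphic_transform[OF holomorphic_on_subset[OF surface_holomorphicD(3)[OF f U V]]])
    show "\<phi> ` {z \<in> U \<inter> D'. g z \<in> V} \<subseteq> \<phi> ` {z \<in> U \<inter> D. f z \<in> V}"
      using D' fg by auto
    show "(\<psi> \<circ> f \<circ> inv_into U \<phi>) w = (\<psi> \<circ> g \<circ> inv_into U \<phi>) w"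
      if "w \<in> \<phi> ` {z \<in> U \<inter> D'. g z \<in> V}" for w
      using that fg chart_inv[OF U] by auto
  qed
  ultimately show ?thesis
    using D' by (intro surface_holomorphicI)
qed

lemma surface_holomorphic_id:
  assumes "openin S D" shows "surface_holomorphic_on S \<A> D (\<lambda>z. z)"
proof -
  have "(\<psi> \<circ> (\<lambda>z. z) \<circ> inv_into U \<phi>) holomorphic_on (\<phi> ` {z \<in> U \<inter> D. z \<in> V})"
    if U: "(U, \<phi>) \<in> \<A>" and V: "(V, \<psi>) \<in> \<A>" for U \<phi> V \<psi>
    using holomorphic_on_subset[OF chart_transition[OF U V], of "\<phi> ` {z \<in> U \<inter> D. z \<in> V}"]
    by (auto simp: o_def)
  moreover have "continuous_map (subtopology S D) S (\<lambda>z. z)"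
    by (simp add: continuous_map_from_subtopology)
  ultimately show ?thesis
    using assms by (intro surface_holomorphicI)
qed

lemma surface_holomorphic_const:
  assumes "c \<in> topspace S" shows "surface_holomorphic_on S \<A> (topspace S) (\<lambda>z. c)"
  by (intro surface_holomorphicI) (use assms in \<open>auto simp: o_def\<close>)

section \<open>The identity theorem\<close>

text \<open>
  Equality at the limit point follows from continuity and the Hausdorff property. Then both maps take
  values in one chart near \<open>x\<close>, and the classical identity theorem applies.
\<close>

lemma locally_identical:
  assumes f: "surface_holomorphic_on S \<A> D f" and g: "surface_holomorphic_on S \<A> E g"
    and x: "x \<in> D" "x \<in> E" "x \<in> S derived_set_of {z. f z = g z}"
  shows "\<exists>W. openin S W \<and> x \<in> W \<and> (\<forall>z\<in>W. f z = g z)"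
proof -
  have acc: "\<exists>y. y \<noteq> x \<and> y \<in> W \<and> f y = g y" if "openin S W" "x \<in> W" for W
    using x(3) that unfolding in_derived_set_of by blast
  have fx: "f x \<in> topspace S" and gx: "g x \<in> topspace S"
    using surface_holomorphic_image f g x by blast+
  have eq: "f x = g x"
  proof (rule ccontr)
    assume "f x \<noteq> g x"
    then obtain P Q where PQ: "openin S P" "openin S Q" "f x \<in> P" "g x \<in> Q" "disjnt P Q"
      using Hausdorff fx gx unfolding Hausdorff_space_def by blast
    let ?W = "{z \<in> D. f z \<in> P} \<inter> {z \<in> E. g z \<in> Q}"
    have "openin S ?W"
      using surface_holomorphic_preimage[OF f PQ(1)] surface_holomorphic_preimage[OF g PQ(2)] by blast
    moreover have "x \<in> ?W" using x PQ by auto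
    ultimately obtain y where "y \<in> ?W" "f y = g y" using acc by blast
    then show False using PQ(5) unfolding disjnt_def by auto
  qed
  obtain U \<phi> where U: "(U, \<phi>) \<in> \<A>" "x \<in> U"
    using chart_at x openin_subset[OF surface_holomorphicD(1)[OF f]] by blast
  obtain V \<psi> where V: "(V, \<psi>) \<in> \<A>" "f x \<in> V" using chart_at fx by blast
  let ?W = "{z \<in> D. f z \<in> V} \<inter> {z \<in> E. g z \<in> V}"
  have "openin S ?W"
    using surface_holomorphic_preimage[OF f chart_openin[OF V(1)]]
      surface_holomorphic_preimage[OF g chart_openin[OF V(1)]] by blast
  moreover have "x \<in> ?W" using x V eq by auto
  ultimately obtain e where e: "e > 0" "ball (\<phi> x) e \<subseteq> \<phi> ` (U \<inter> ?W)"
    using chart_ball[OF U(1) _ U(2)] by blast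
  let ?F = "\<psi> \<circ> f \<circ> inv_into U \<phi>" and ?G = "\<psi> \<circ> g \<circ> inv_into U \<phi>"
  have "?F holomorphic_on ball (\<phi> x) e" "?G holomorphic_on ball (\<phi> x) e"
    using e(2) by (auto intro: holomorphic_on_subset[OF surface_holomorphicD(3)[OF f U(1) V(1)]]
        holomorphic_on_subset[OF surface_holomorphicD(3)[OF g U(1) V(1)]])
  then have hol: "(\<lambda>z. ?F z - ?G z) holomorphic_on ball (\<phi> x) e"
    by (rule holomorphic_on_diff)
  have "\<phi> x islimpt {w \<in> ball (\<phi> x) e. ?F w - ?G w = 0}"
    unfolding islimpt_def
  proof (intro allI impI)
    fix T assume T: "\<phi> x \<in> T" "open T"
    have "openin S {z \<in> U. \<phi> z \<in> T \<inter> ball (\<phi> x) e}"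
      using T by (intro chart_vimage_openin[OF U(1)]) auto
    moreover have "x \<in> {z \<in> U. \<phi> z \<in> T \<inter> ball (\<phi> x) e}" using U T e by auto
    ultimately obtain y where y: "y \<noteq> x" "y \<in> U" "\<phi> y \<in> T" "\<phi> y \<in> ball (\<phi> x) e" "f y = g y"
      using acc by blast
    moreover have "\<phi> y \<noteq> \<phi> x" using y chart_inj[OF U(1)] U by (auto dest: inj_onD)
    ultimately show "\<exists>y\<in>{w \<in> ball (\<phi> x) e. ?F w - ?G w = 0}. y \<in> T \<and> y \<noteq> \<phi> x"
      using chart_inv[OF U(1)] by (intro bexI[of _ "\<phi> y"]) auto
  qed
  then have zero: "?F w - ?G w = 0" if "w \<in> ball (\<phi> x) e" for w
    by (rule analytic_continuation[OF hol open_ball connected_ball _ _ _ _ that, rotated 2]) (use e(1) in auto)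
  show ?thesis
  proof (intro exI conjI ballI)
    show "openin S {z \<in> U. \<phi> z \<in> ball (\<phi> x) e}" by (intro chart_vimage_openin[OF U(1)] open_ball)
    show "x \<in> {z \<in> U. \<phi> z \<in> ball (\<phi> x) e}" using U e by auto
    fix z assume z: "z \<in> {z \<in> U. \<phi> z \<in> ball (\<phi> x) e}"
    then have "z \<in> ?W"
      using chart_inv_image[OF U(1) Int_lower1 subsetD[OF e(2)], of "\<phi> z"] chart_inv[OF U(1), of z] by simp
    moreover have "\<psi> (f z) = \<psi> (g z)" using zero[of "\<phi> z"] z chart_inv[OF U(1)] by simp
    ultimately show "f z = g z" using chart_inj[OF V(1)] by (auto dest: inj_onD)
  qed
qed

text \<open>
  The points near which \<open>f\<close> and \<open>g\<close> agree form an open set, whose complement in \<open>B\<close> is open by the local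
  statement.
\<close>

lemma identity_theorem:
  assumes f: "surface_holomorphic_on S \<A> D f" and g: "surface_holomorphic_on S \<A> E g"
    and B: "openin S B" "connectedin S B" "B \<subseteq> D \<inter> E"
    and x: "x \<in> B" "x \<in> S derived_set_of {z. f z = g z}" and z: "z \<in> B"
  shows "f z = g z"
proof -
  define T where "T = {y \<in> B. \<exists>W. openin S W \<and> y \<in> W \<and> (\<forall>z\<in>W. f z = g z)}"
  have TI: "y \<in> T" if y: "y \<in> B" "y \<in> S derived_set_of {z. f z = g z}" for y
  proof -
    have "y \<in> D" "y \<in> E" using y(1) B(3) by auto
    from locally_identical[OF f g this y(2)] show ?thesis using y(1) unfolding T_def by blast
  qed
  have "openin S T"
  proof (subst openin_subopen, intro ballI)
    fix y assume "y \<in> T"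
    then obtain W where W: "y \<in> B" "openin S W" "y \<in> W" "\<forall>z\<in>W. f z = g z" unfolding T_def by blast
    then have "openin S (W \<inter> B)" "y \<in> W \<inter> B" "W \<inter> B \<subseteq> T" using B unfolding T_def by blast+
    then show "\<exists>W. openin S W \<and> y \<in> W \<and> W \<subseteq> T" by blast
  qed
  moreover have "openin S (B - T)"
  proof (subst openin_subopen, intro ballI)
    fix y assume y: "y \<in> B - T"
    have "y \<notin> S derived_set_of {z. f z = g z}" using TI y by blast
    moreover have "y \<in> topspace S" using y subsetD[OF openin_subset[OF B(1)]] by simp
    ultimately obtain N where N: "openin S N" "y \<in> N" "\<And>w. w \<in> N \<Longrightarrow> f w = g w \<Longrightarrow> w = y"
      unfolding in_derived_set_of mem_Collect_eq by metis
    have "N \<inter> T = {}"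
    proof (rule ccontr)
      assume "N \<inter> T \<noteq> {}"
      then obtain t where t: "t \<in> N" "t \<in> T" by auto
      then have "f t = g t" unfolding T_def by auto
      then have "t = y" using N(3) t(1) by simp
      then show False using t(2) y by simp
    qed
    moreover have "openin S (N \<inter> B)" using N(1) B(1) by (rule openin_Int)
    ultimately have "openin S (N \<inter> B)" "y \<in> N \<inter> B" "N \<inter> B \<subseteq> B - T" using N(2) y by auto
    then show "\<exists>W. openin S W \<and> y \<in> W \<and> W \<subseteq> B - T" by blast
  qed
  moreover have "x \<in> T" using TI x by blast
  moreover have "T \<subseteq> B" by (auto simp: T_def)
  then have "B \<subseteq> T \<union> (B - T)" "T \<inter> (B - T) \<inter> B = {}" by auto
  moreover have "\<not> (\<exists>E1 E2. openin S E1 \<and> openin S E2 \<and> B \<subseteq> E1 \<union> E2 \<and>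
      E1 \<inter> E2 \<inter> B = {} \<and> E1 \<inter> B \<noteq> {} \<and> E2 \<inter> B \<noteq> {})"
    using B(2) unfolding connectedin by (rule conjunct2)
  ultimately have "(B - T) \<inter> B = {}" using x(1) by (metis IntI empty_iff)
  then have "z \<in> T" using z by auto
  then show ?thesis unfolding T_def by auto
qed

lemma surface_perfect:
  assumes "openin S W" "x \<in> W" obtains y where "y \<in> W" "y \<noteq> x"
proof -
  obtain U \<phi> where U: "(U, \<phi>) \<in> \<A>" "x \<in> U" using chart_at assms openin_subset by blast
  obtain e where e: "e > 0" "ball (\<phi> x) e \<subseteq> \<phi> ` (U \<inter> W)"
    using chart_ball[OF U(1) assms(1) U(2) assms(2)] .
  have "\<phi> x + of_real (e / 2) \<in> \<phi> ` (U \<inter> W)"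
    using e(1) by (intro subsetD[OF e(2)]) (simp add: dist_norm)
  then obtain y where "y \<in> W" "\<phi> y = \<phi> x + of_real (e / 2)" by auto
  moreover from this have "y \<noteq> x" using e by auto
  ultimately show ?thesis using that by blast
qed

lemma connected_chart_neighbourhood:
  assumes "openin S W" "x \<in> W"
  obtains D where "openin S D" "connectedin S D" "x \<in> D" "D \<subseteq> W"
proof -
  obtain U \<phi> where U: "(U, \<phi>) \<in> \<A>" "x \<in> U" using chart_at assms openin_subset by blast
  obtain e where e: "e > 0" "ball (\<phi> x) e \<subseteq> \<phi> ` (U \<inter> W)"
    using chart_ball[OF U(1) assms(1) U(2) assms(2)] .
  let ?D = "{z \<in> U. \<phi> z \<in> ball (\<phi> x) e}"
  have "connectedin (top_of_set (\<phi> ` U)) (ball (\<phi> x) e)"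
    using e(2) by (auto simp: connectedin_subtopology connectedin_iff_connected)
  then have "connectedin S (inv_into U \<phi> ` ball (\<phi> x) e)"
    using connectedin_continuous_map_image continuous_chart_inv[OF U(1)] by blast
  moreover have "inv_into U \<phi> ` ball (\<phi> x) e = ?D"
  proof (intro subset_antisym subsetI)
    fix y assume "y \<in> inv_into U \<phi> ` ball (\<phi> x) e"
    then obtain w where w: "w \<in> ball (\<phi> x) e" "y = inv_into U \<phi> w" by blast
    then show "y \<in> ?D" using chart_inv_image[OF U(1) Int_lower1 subsetD[OF e(2) w(1)]] by simp
  next
    fix y assume "y \<in> ?D"
    then show "y \<in> inv_into U \<phi> ` ball (\<phi> x) e" by (auto intro!: image_eqI[of _ _ "\<phi> y"] simp: chart_inv[OF U(1)])
  qed
  moreover have "openin S ?D" by (intro chart_vimage_openin[OF U(1)] open_ball)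
  moreover have "x \<in> ?D" using U e by simp
  moreover have "?D \<subseteq> W"
  proof
    fix y assume y: "y \<in> ?D"
    then show "y \<in> W"
      using chart_inv_image[OF U(1) Int_lower1 subsetD[OF e(2)], of "\<phi> y"] chart_inv[OF U(1), of y] by simp
  qed
  ultimately show ?thesis using that by metis
qed

section \<open>Local injectivity of non-constant maps\<close>

definition injective_near :: "('a \<Rightarrow> 'a) \<Rightarrow> 'a \<Rightarrow> bool" where
  "injective_near h x \<longleftrightarrow> (\<exists>N. openin S N \<and> x \<in> N \<and> inj_on h N)"

text \<open>
  The clause \<open>h z \<noteq> h y\<close> makes the property pass to compositions: the outer map is then evaluated off
  the centre of its own punctured neighbourhood.
\<close>

definition locally_injective_off_isolated :: "('a \<Rightarrow> 'a) \<Rightarrow> bool" where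
  "locally_injective_off_isolated h \<longleftrightarrow> continuous_map S S h \<and>
     (\<forall>y \<in> topspace S. \<exists>W. openin S W \<and> y \<in> W \<and> (\<forall>z \<in> W - {y}. h z \<noteq> h y \<and> injective_near h z))"

lemma locally_injective_compose:
  assumes f: "locally_injective_off_isolated f" and g: "locally_injective_off_isolated g"
  shows "locally_injective_off_isolated (g \<circ> f)"
  unfolding locally_injective_off_isolated_def
proof (intro conjI ballI)
  have cf: "continuous_map S S f" and cg: "continuous_map S S g"
    using f g unfolding locally_injective_off_isolated_def by blast+
  then show "continuous_map S S (g \<circ> f)" by (rule continuous_map_compose)
  have pre: "openin S {z \<in> topspace S. f z \<in> W}" if "openin S W" for W
    using cf that by (rule openin_continuous_map_preimage)
  fix y assume y: "y \<in> topspace S"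
  then have fy: "f y \<in> topspace S" using continuous_map_image_subset_topspace[OF cf] by blast
  obtain W where W: "openin S W" "y \<in> W" "\<And>z. z \<in> W - {y} \<Longrightarrow> f z \<noteq> f y \<and> injective_near f z"
    using f y unfolding locally_injective_off_isolated_def by meson
  obtain W' where W': "openin S W'" "f y \<in> W'" "\<And>z. z \<in> W' - {f y} \<Longrightarrow> g z \<noteq> g (f y) \<and> injective_near g z"
    using g fy unfolding locally_injective_off_isolated_def by meson
  let ?W = "W \<inter> {z \<in> topspace S. f z \<in> W'}"
  have "(g \<circ> f) z \<noteq> (g \<circ> f) y \<and> injective_near (g \<circ> f) z" if z: "z \<in> ?W - {y}" for z
  proof
    have fz: "f z \<in> W' - {f y}" "injective_near f z" using W(3)[of z] z by auto
    then show "(g \<circ> f) z \<noteq> (g \<circ> f) y" using W'(3) by simp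
    obtain N where N: "openin S N" "z \<in> N" "inj_on f N"
      using fz(2) unfolding injective_near_def by blast
    have "injective_near g (f z)" using W'(3)[OF fz(1)] by simp
    then obtain N' where N': "openin S N'" "f z \<in> N'" "inj_on g N'"
      unfolding injective_near_def by blast
    let ?N = "N \<inter> {z \<in> topspace S. f z \<in> N'}"
    have "inj_on (g \<circ> f) ?N"
      by (rule comp_inj_on) (use N(3) N'(3) in \<open>auto simp: inj_on_def\<close>)
    moreover have "openin S ?N" using N(1) pre[OF N'(1)] by (rule openin_Int)
    moreover have "z \<in> ?N" using N N' z by auto
    ultimately show "injective_near (g \<circ> f) z" unfolding injective_near_def by blast
  qed
  moreover have "openin S ?W" using W(1) pre[OF W'(1)] by (rule openin_Int)
  moreover have "y \<in> ?W" using W W' y by auto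
  ultimately show "\<exists>W. openin S W \<and> y \<in> W \<and> (\<forall>z\<in>W - {y}. (g \<circ> f) z \<noteq> (g \<circ> f) y \<and> injective_near (g \<circ> f) z)"
    by meson
qed

lemma locally_injective_id: "locally_injective_off_isolated id"
  unfolding locally_injective_off_isolated_def injective_near_def by auto

lemma locally_injective_funpow:
  assumes "locally_injective_off_isolated h" shows "locally_injective_off_isolated (h ^^ n)"
proof (induction n)
  case 0
  then show ?case using locally_injective_id by (simp add: id_def)
next
  case (Suc n)
  show ?case unfolding funpow.simps by (rule locally_injective_compose[OF Suc assms])
qed

lemma nonconstant_on_open:
  assumes conn: "connected_space S" and h: "surface_holomorphic_on S \<A> (topspace S) h"
    and nc: "\<not> (\<exists>c. \<forall>z \<in> topspace S. h z = c)" and W: "openin S W" "y \<in> W"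
  obtains z where "z \<in> W" "h z \<noteq> c"
proof (cases "\<forall>z \<in> W. h z = c")
  case True
  have y: "y \<in> topspace S" using W openin_subset by blast
  then have c: "c \<in> topspace S" using surface_holomorphic_image[OF h y] True W by simp
  have "y \<in> S derived_set_of {z. h z = c}"
    unfolding in_derived_set_of
  proof (intro conjI allI impI y)
    fix T assume T: "y \<in> T \<and> openin S T"
    then have "openin S (T \<inter> W)" "y \<in> T \<inter> W" using W by auto
    then obtain z where "z \<in> T \<inter> W" "z \<noteq> y" by (rule surface_perfect)
    then show "\<exists>z. z \<noteq> y \<and> z \<in> {z. h z = c} \<and> z \<in> T" using True by auto
  qed
  from identity_theorem[OF h surface_holomorphic_const[OF c] openin_topspace _ _ y this]
  have "h z = c" if "z \<in> topspace S" for z using conn that by (simp add: connectedin_topspace)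
  then show ?thesis using nc by blast
qed (use that in blast)

text \<open>
  In charts, the zeros of \<open>k - k b\<close> and of the derivative of \<open>k\<close> are isolated, unless \<open>k\<close> is constant
  on a disc; in that case \<open>h\<close> would be constant on the whole surface.
\<close>

lemma holomorphic_locally_injective:
  assumes conn: "connected_space S" and h: "surface_holomorphic_on S \<A> (topspace S) h"
    and nc: "\<not> (\<exists>c. \<forall>z \<in> topspace S. h z = c)"
  shows "locally_injective_off_isolated h"
  unfolding locally_injective_off_isolated_def
proof (intro conjI ballI)
  show "continuous_map S S h" using surface_holomorphicD(2)[OF h] by simp
  fix y assume y: "y \<in> topspace S"
  obtain U \<phi> where U: "(U, \<phi>) \<in> \<A>" "y \<in> U" using chart_at y by blast
  obtain V \<psi> where V: "(V, \<psi>) \<in> \<A>" "h y \<in> V" using chart_at surface_holomorphic_image[OF h y] by blast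
  let ?W = "{z \<in> topspace S. h z \<in> V}"
  have "openin S ?W" by (rule surface_holomorphic_preimage[OF h chart_openin[OF V(1)]])
  moreover have "y \<in> ?W" using y V by simp
  ultimately obtain e where e: "e > 0" "ball (\<phi> y) e \<subseteq> \<phi> ` (U \<inter> ?W)"
    using chart_ball[OF U(1) _ U(2)] by blast
  define b where "b = \<phi> y"
  define k where "k = \<psi> \<circ> h \<circ> inv_into U \<phi>"
  have inW: "h z \<in> V" if "z \<in> U" "\<phi> z \<in> ball b e" for z
    using chart_inv_image[OF U(1) Int_lower1 subsetD[OF e(2)], of "\<phi> z"] chart_inv[OF U(1) that(1)] that(2)
    by (simp add: b_def)
  have kh: "k (\<phi> z) = \<psi> (h z)" if "z \<in> U" for z
    using chart_inv[OF U(1) that] by (simp add: k_def)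
  have hol: "k holomorphic_on ball b e"
    unfolding k_def b_def using e(2) chart_subset[OF U(1)]
    by (intro holomorphic_on_subset[OF surface_holomorphicD(3)[OF h U(1) V(1)]]) auto
  obtain w where w: "w \<in> ball b e" "k w \<noteq> k b"
  proof -
    have "openin S {z \<in> U. \<phi> z \<in> ball b e}" by (intro chart_vimage_openin[OF U(1)] open_ball)
    moreover have "y \<in> {z \<in> U. \<phi> z \<in> ball b e}" using U e b_def by simp
    ultimately obtain z where z: "z \<in> {z \<in> U. \<phi> z \<in> ball b e}" "h z \<noteq> h y"
      by (rule nonconstant_on_open[OF conn h nc])
    then have "\<psi> (h z) \<noteq> \<psi> (h y)" using chart_inj[OF V(1)] V inW by (auto dest: inj_onD)
    then show ?thesis using that[of "\<phi> z"] z kh[of z] kh[OF U(2)] by (simp add: b_def)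
  qed
  have b: "b \<in> ball b e" using e by simp
  have dk: "(\<lambda>z. k z - k b) holomorphic_on ball b e" using hol by (intro holomorphic_intros)
  obtain r1 where r1: "0 < r1" "\<And>z. z \<in> ball b r1 - {b} \<Longrightarrow> k z - k b \<noteq> 0"
  proof (rule isolated_zeros[OF dk open_ball connected_ball b _ w(1)])
    show "k b - k b = 0" "k w - k b \<noteq> 0" using w by auto
  qed blast
  have dhol: "deriv k holomorphic_on ball b e" using hol by (rule holomorphic_deriv) auto
  have "\<exists>w' \<in> ball b e. deriv k w' \<noteq> 0"
  proof (rule ccontr)
    assume "\<not> (\<exists>w' \<in> ball b e. deriv k w' \<noteq> 0)"
    then have zero: "deriv k z = 0" if "z \<in> ball b e" for z using that by simp
    have "(k has_field_derivative 0) (at z within ball b e)" if "z \<in> ball b e" for z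
      using holomorphic_derivI[OF hol open_ball that] zero[OF that]
      by (simp add: has_field_derivative_at_within)
    then have "\<exists>c. \<forall>z \<in> ball b e. k z = c"
      by (intro has_field_derivative_zero_constant) auto
    then show False using w b by auto
  qed
  then obtain w' where w': "w' \<in> ball b e" "deriv k w' \<noteq> 0" by auto
  obtain r2 where r2: "0 < r2" "\<And>z. z \<in> ball b r2 - {b} \<Longrightarrow> deriv k z \<noteq> 0"
  proof (cases "deriv k b = 0")
    case True
    show ?thesis
      by (rule isolated_zeros[OF dhol open_ball connected_ball b True w']) (rule that)
  next
    case False
    have "continuous_on (ball b e) (deriv k)" using dhol by (rule holomorphic_on_imp_continuous_on)
    then have "open (ball b e \<inter> deriv k -` (- {0}))" by (intro continuous_open_preimage) auto
    moreover have "b \<in> ball b e \<inter> deriv k -` (- {0})" using b False by simp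
    ultimately obtain r where "r > 0" "ball b r \<subseteq> ball b e \<inter> deriv k -` (- {0})"
      using open_contains_ball by metis
    then show ?thesis by (intro that[of r]) auto
  qed
  define r where "r = min e (min r1 r2)"
  have r: "0 < r" "r \<le> e" "r \<le> r1" "r \<le> r2" using e r1 r2 by (auto simp: r_def)
  let ?B = "{z \<in> U. \<phi> z \<in> ball b r}"
  have "h z \<noteq> h y \<and> injective_near h z" if z: "z \<in> ?B - {y}" for z
  proof
    have "\<phi> z \<noteq> b" using z chart_inj[OF U(1)] U by (auto simp: b_def dest: inj_onD)
    then have zb: "\<phi> z \<in> ball b r1 - {b}" "\<phi> z \<in> ball b r2 - {b}" "\<phi> z \<in> ball b e" using z r by auto
    then have "k (\<phi> z) \<noteq> k b" using r1(2) by fastforce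
    then show "h z \<noteq> h y" using kh[of z] kh[OF U(2)] z by (auto simp: b_def)
    obtain d where d: "d > 0" "ball (\<phi> z) d \<subseteq> ball b e" "inj_on k (ball (\<phi> z) d)"
      using has_complex_derivative_locally_injective[OF hol zb(3) open_ball r2(2)[OF zb(2)]] by metis
    let ?N = "{z' \<in> U. \<phi> z' \<in> ball (\<phi> z) d}"
    have "inj_on h ?N"
    proof (rule inj_onI)
      fix z1 z2 assume z12: "z1 \<in> ?N" "z2 \<in> ?N" "h z1 = h z2"
      then have "k (\<phi> z1) = k (\<phi> z2)" using kh by simp
      then have "\<phi> z1 = \<phi> z2" using d(3) z12 by (auto dest: inj_onD)
      then show "z1 = z2" using chart_inj[OF U(1)] z12 by (auto dest: inj_onD)
    qed
    moreover have "openin S ?N" by (intro chart_vimage_openin[OF U(1)] open_ball)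
    moreover have "z \<in> ?N" using z d by simp
    ultimately show "injective_near h z" unfolding injective_near_def by blast
  qed
  moreover have "openin S ?B" by (intro chart_vimage_openin[OF U(1)] open_ball)
  moreover have "y \<in> ?B" using U r by (simp add: b_def)
  ultimately show "\<exists>W. openin S W \<and> y \<in> W \<and> (\<forall>z\<in>W - {y}. h z \<noteq> h y \<and> injective_near h z)"
    by meson
qed

section \<open>Biholomorphic maps\<close>

lemma biholomorphicI:
  assumes f: "surface_holomorphic_on S \<A> U f" and g: "surface_holomorphic_on S \<A> V g"
    and fg: "\<And>x. x \<in> U \<Longrightarrow> f x \<in> V" "\<And>y. y \<in> V \<Longrightarrow> g y \<in> U"
      "\<And>x. x \<in> U \<Longrightarrow> g (f x) = x" "\<And>y. y \<in> V \<Longrightarrow> f (g y) = y"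
  shows "biholomorphic S \<A> U V f"
proof -
  have bij: "bij_betw f U V" using fg by (intro bij_betwI[where g = g]) auto
  moreover have "g y = inv_into U f y" if "y \<in> V" for y
    using fg that bij by (metis bij_betw_inv_into_left)
  ultimately show ?thesis
    using f surface_holomorphic_mono[OF g surface_holomorphicD(1)[OF g] subset_refl]
    unfolding biholomorphic_def by blast
qed

lemma biholomorphicD:
  assumes "biholomorphic S \<A> U V f"
  shows "surface_holomorphic_on S \<A> U f" "surface_holomorphic_on S \<A> V (inv_into U f)"
    "bij_betw f U V" "inj_on f U" "openin S U" "openin S V"
    "\<And>x. x \<in> U \<Longrightarrow> f x \<in> V" "\<And>y. y \<in> V \<Longrightarrow> inv_into U f y \<in> U"
    "\<And>x. x \<in> U \<Longrightarrow> inv_into U f (f x) = x" "\<And>y. y \<in> V \<Longrightarrow> f (inv_into U f y) = y"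
proof -
  show *: "surface_holomorphic_on S \<A> U f" "surface_holomorphic_on S \<A> V (inv_into U f)" "bij_betw f U V"
    using assms by (simp_all add: biholomorphic_def)
  then show "openin S U" "openin S V" "inj_on f U"
    using surface_holomorphicD(1) bij_betw_imp_inj_on by blast+
  show "\<And>x. x \<in> U \<Longrightarrow> f x \<in> V" "\<And>y. y \<in> V \<Longrightarrow> inv_into U f y \<in> U"
    "\<And>x. x \<in> U \<Longrightarrow> inv_into U f (f x) = x" "\<And>y. y \<in> V \<Longrightarrow> f (inv_into U f y) = y"
    using *(3) bij_betwE[OF *(3)] bij_betwE[OF bij_betw_inv_into[OF *(3)]]
      bij_betw_inv_into_left[OF *(3)] bij_betw_inv_into_right[OF *(3)] by simp_all
qed

lemma biholomorphic_inverse: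
  assumes "biholomorphic S \<A> U V f" shows "biholomorphic S \<A> V U (inv_into U f)"
  using biholomorphicD[OF assms] by (intro biholomorphicI[where g = f])

lemma biholomorphic_compose:
  assumes f: "biholomorphic S \<A> U V f" and g: "biholomorphic S \<A> U' V' g"
  shows "biholomorphic S \<A> {z \<in> U. f z \<in> U'} {w \<in> V'. inv_into U' g w \<in> V} (g \<circ> f)"
proof (rule biholomorphicI[where g = "inv_into U f \<circ> inv_into U' g"])
  note F = biholomorphicD[OF f] and G = biholomorphicD[OF g]
  show "surface_holomorphic_on S \<A> {z \<in> U. f z \<in> U'} (g \<circ> f)"
    by (rule surface_holomorphic_compose[OF F(1) G(1)])
  show "surface_holomorphic_on S \<A> {w \<in> V'. inv_into U' g w \<in> V} (inv_into U f \<circ> inv_into U' g)"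
    by (rule surface_holomorphic_compose[OF G(2) F(2)])
qed (use biholomorphicD[OF f] biholomorphicD[OF g] in auto)

end

section \<open>Local transfers\<close>

locale surface_subset = surface +
  fixes H :: "'a \<Rightarrow> 'a" and X :: "'a set"
  assumes X_subset: "X \<subseteq> topspace S"
begin

abbreviation "X_top \<equiv> subtopology S X"
abbreviation "maps \<equiv> local_maps S \<A> X"
abbreviation "transfers \<equiv> local_transfers S \<A> H X"

lemma topspace_X: "topspace X_top = X"
  using X_subset by auto

lemma openin_X: "openin S W \<Longrightarrow> openin X_top (W \<inter> X)"
  by (auto simp: openin_subtopology)

text \<open>
  A local map is the restriction to \<open>X\<close> of a biholomorphic map that preserves membership in \<open>X\<close> in
  both directions. Together with the converse \<open>local_mapI\<close> this reduces composition and inversion of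
  local maps to the same operations on their extensions.
\<close>

lemma local_mapE:
  assumes "\<eta> \<in> maps"
  obtains U V f where "biholomorphic S \<A> U V f" "\<forall>z \<in> U. f z \<in> X \<longleftrightarrow> z \<in> X"
    "\<eta> = (Some \<circ> f) |` (U \<inter> X)"
proof -
  obtain U V f where f: "biholomorphic S \<A> U V f" "U \<inter> X = dom \<eta>" "V \<inter> X = ran \<eta>"
    "\<forall>z \<in> dom \<eta>. \<eta> z = Some (f z)"
    using assms unfolding local_maps_def by blast
  have "f z \<in> X \<longleftrightarrow> z \<in> X" if z: "z \<in> U" for z
  proof
    assume "z \<in> X"
    then have "\<eta> z = Some (f z)" using f z by auto
    then show "f z \<in> X" using f(3) by (auto simp: ran_def)
  next
    assume "f z \<in> X"
    then have "f z \<in> ran \<eta>" using f(3) biholomorphicD(7)[OF f(1) z] by blast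
    then obtain z' where z': "\<eta> z' = Some (f z)" by (auto simp: ran_def)
    then have "z' \<in> dom \<eta>" by auto
    then have "z' \<in> U" "z' \<in> X" "f z' = f z" using f(2,4) z' by auto
    then show "z \<in> X" using biholomorphicD(4)[OF f(1)] z by (auto dest: inj_onD)
  qed
  moreover have "\<eta> z = ((Some \<circ> f) |` (U \<inter> X)) z" for z
    using f(2,4) by (cases "z \<in> dom \<eta>") (auto simp: restrict_map_def)
  ultimately show ?thesis using that f(1) by blast
qed

lemma local_map_dom_ran:
  assumes f: "biholomorphic S \<A> U V f" "\<forall>z \<in> U. f z \<in> X \<longleftrightarrow> z \<in> X"
  shows "dom ((Some \<circ> f) |` (U \<inter> X)) = U \<inter> X" "ran ((Some \<circ> f) |` (U \<inter> X)) = V \<inter> X"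
proof -
  show "dom ((Some \<circ> f) |` (U \<inter> X)) = U \<inter> X" by (auto simp: restrict_map_def split: if_splits)
  show "ran ((Some \<circ> f) |` (U \<inter> X)) = V \<inter> X"
  proof (intro subset_antisym subsetI)
    fix w assume "w \<in> ran ((Some \<circ> f) |` (U \<inter> X))"
    then obtain z where "z \<in> U" "z \<in> X" "w = f z"
      by (auto simp: ran_def restrict_map_def split: if_splits)
    then show "w \<in> V \<inter> X" using f biholomorphicD(7)[OF f(1)] by auto
  next
    fix w assume w: "w \<in> V \<inter> X"
    let ?z = "inv_into U f w"
    have "?z \<in> U" "f ?z = w" using biholomorphicD(8,10)[OF f(1)] w by auto
    moreover from this have "?z \<in> X" using f(2)[rule_format, of ?z] w by simp
    ultimately show "w \<in> ran ((Some \<circ> f) |` (U \<inter> X))"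
      by (auto simp: ran_def restrict_map_def intro!: exI[of _ ?z])
  qed
qed

lemma local_mapI:
  assumes f: "biholomorphic S \<A> U V f" "\<forall>z \<in> U. f z \<in> X \<longleftrightarrow> z \<in> X"
  shows "(Some \<circ> f) |` (U \<inter> X) \<in> maps"
proof -
  let ?\<eta> = "(Some \<circ> f) |` (U \<inter> X)" and ?g = "inv_into U f"
  note F = biholomorphicD[OF f(1)] and dr = local_map_dom_ran[OF f]
  have the_\<eta>: "the (?\<eta> z) = f z" if "z \<in> U \<inter> X" for z using that by (simp add: restrict_map_def)
  have top: "topspace (subtopology S (U \<inter> X)) = U \<inter> X" "topspace (subtopology S (V \<inter> X)) = V \<inter> X"
    using X_subset by auto
  have "homeomorphic_maps (subtopology S (U \<inter> X)) (subtopology S (V \<inter> X)) f ?g"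
    unfolding homeomorphic_maps_def top
  proof (intro conjI ballI)
    show "continuous_map (subtopology S (U \<inter> X)) (subtopology S (V \<inter> X)) f"
      using continuous_map_from_subtopology_mono[OF surface_holomorphicD(2)[OF F(1)], of "U \<inter> X"] F(7) f(2) top(1)
      by (auto simp: continuous_map_in_subtopology)
    have "?g w \<in> X" if "w \<in> V \<inter> X" for w using F(8,10)[of w] f(2)[rule_format, of "?g w"] that by simp
    then show "continuous_map (subtopology S (V \<inter> X)) (subtopology S (U \<inter> X)) ?g"
      using continuous_map_from_subtopology_mono[OF surface_holomorphicD(2)[OF F(2)], of "V \<inter> X"] F(8) top(2)
      by (auto simp: continuous_map_in_subtopology)
  qed (use F(9,10) in auto)
  then have "homeomorphic_map (subtopology S (U \<inter> X)) (subtopology S (V \<inter> X)) f"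
    using homeomorphic_map_maps by blast
  then have "homeomorphic_map (subtopology S (U \<inter> X)) (subtopology S (V \<inter> X)) (\<lambda>z. the (?\<eta> z))"
    by (rule homeomorphic_map_eq) (use the_\<eta> top in auto)
  moreover have "openin X_top (U \<inter> X)" "openin X_top (V \<inter> X)" using openin_X F by blast+
  moreover have "\<forall>z \<in> U \<inter> X. ?\<eta> z = Some (f z)" by (simp add: restrict_map_def)
  ultimately show ?thesis
    unfolding local_maps_def mem_Collect_eq dr using f(1) F(5,6) by blast
qed

lemma local_map_open:
  assumes "\<eta> \<in> maps" shows "openin X_top (dom \<eta>)" "openin X_top (ran \<eta>)" "dom \<eta> \<subseteq> X" "ran \<eta> \<subseteq> X"
proof -
  show "openin X_top (dom \<eta>)" "openin X_top (ran \<eta>)" using assms unfolding local_maps_def by blast+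
  then show "dom \<eta> \<subseteq> X" "ran \<eta> \<subseteq> X" using openin_subset topspace_X by blast+
qed

lemma local_map_homeomorphic:
  assumes "\<eta> \<in> maps"
  shows "homeomorphic_map (subtopology S (dom \<eta>)) (subtopology S (ran \<eta>)) (\<lambda>z. the (\<eta> z))"
  using assms unfolding local_maps_def by blast

lemma local_map_inj:
  assumes "\<eta> \<in> maps" "\<eta> z = Some w" "\<eta> z' = Some w" shows "z = z'"
proof -
  obtain U V f where f: "biholomorphic S \<A> U V f" "\<eta> = (Some \<circ> f) |` (U \<inter> X)"
    using assms(1) by (rule local_mapE)
  have "z \<in> U" "z' \<in> U" "f z = f z'"
    using assms(2,3) unfolding f(2) by (auto simp: restrict_map_def split: if_splits)
  then show ?thesis using biholomorphicD(4)[OF f(1)] by (auto dest: inj_onD)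
qed

lemma local_map_preimage:
  assumes "\<eta> \<in> maps" "openin X_top W" shows "openin X_top {z \<in> dom \<eta>. the (\<eta> z) \<in> W}"
proof -
  have "continuous_map (subtopology S (dom \<eta>)) (subtopology S (ran \<eta>)) (\<lambda>z. the (\<eta> z))"
    using local_map_homeomorphic[OF assms(1)] by (rule homeomorphic_imp_continuous_map)
  then have "continuous_map (subtopology S (dom \<eta>)) X_top (\<lambda>z. the (\<eta> z))"
    using local_map_open(4)[OF assms(1)] by (auto simp: continuous_map_in_subtopology)
  from openin_continuous_map_preimage[OF this assms(2)]
  have "openin (subtopology X_top (dom \<eta>)) {z \<in> topspace (subtopology S (dom \<eta>)). the (\<eta> z) \<in> W}"
    using local_map_open(3)[OF assms(1)] by (simp add: subtopology_subtopology Int_absorb1)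
  moreover have "topspace (subtopology S (dom \<eta>)) = dom \<eta>"
    using local_map_open(3)[OF assms(1)] X_subset by auto
  ultimately show ?thesis using local_map_open(1)[OF assms(1)] openin_trans_full by metis
qed

lemma map_inverse_eq_Some:
  assumes "\<eta> \<in> maps" shows "map_inverse \<eta> w = Some z \<longleftrightarrow> \<eta> z = Some w"
proof
  assume *: "\<eta> z = Some w"
  then have "(THE x. \<eta> x = Some w) = z" using local_map_inj[OF assms] by blast
  then show "map_inverse \<eta> w = Some z" using * by (auto simp: map_inverse_def ran_def)
next
  assume *: "map_inverse \<eta> w = Some z"
  then obtain z' where z': "\<eta> z' = Some w" by (auto simp: map_inverse_def ran_def split: if_splits)
  then have "(THE x. \<eta> x = Some w) = z'" using local_map_inj[OF assms] by blast
  then show "\<eta> z = Some w" using z' * by (auto simp: map_inverse_def split: if_splits)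
qed

lemma dom_map_inverse: "dom (map_inverse \<eta>) = ran \<eta>"
  by (auto simp: map_inverse_def dom_def)

lemma transfer_maps: "\<eta> \<in> transfers k \<Longrightarrow> \<eta> \<in> maps"
  by (simp add: local_transfers_def)

lemma transfer_identity: "Some |` X \<in> transfers 0"
proof -
  have "biholomorphic S \<A> (topspace S) (topspace S) (\<lambda>z. z)"
    by (rule biholomorphicI[where g = "\<lambda>z. z"]) (auto intro: surface_holomorphic_id)
  then have "(Some \<circ> (\<lambda>z. z)) |` (topspace S \<inter> X) \<in> maps" by (rule local_mapI) simp
  then have m: "Some |` X \<in> maps" using X_subset by (simp add: Int_absorb1 o_def)
  have "0 = int 0 - int 0 \<and> (\<forall>z \<in> dom (Some |` X). (H ^^ 0) z = (H ^^ 0) (the ((Some |` X) z)))"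
    by (auto simp: restrict_map_def)
  then show ?thesis unfolding local_transfers_def using m by blast
qed

text \<open>
  If \<open>y = \<eta> z\<close> and \<open>y' = \<eta>' y\<close>, then applying \<open>H ^^ n'\<close> to \<open>(H ^^ n) z = (H ^^ m) y\<close> and \<open>H ^^ m\<close> to
  \<open>(H ^^ n') y = (H ^^ m') y'\<close> gives an equation between \<open>z\<close> and \<open>y'\<close>, since iterates of \<open>H\<close> commute.
\<close>

lemma transfer_compose:
  assumes "\<eta> \<in> transfers k" "\<eta>' \<in> transfers k'"
  shows "\<eta>' \<circ>\<^sub>m \<eta> \<in> transfers (k + k')"
proof -
  obtain U V f where f: "biholomorphic S \<A> U V f" "\<forall>z \<in> U. f z \<in> X \<longleftrightarrow> z \<in> X" "\<eta> = (Some \<circ> f) |` (U \<inter> X)"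
    using transfer_maps[OF assms(1)] by (rule local_mapE)
  obtain U' V' f' where f': "biholomorphic S \<A> U' V' f'" "\<forall>z \<in> U'. f' z \<in> X \<longleftrightarrow> z \<in> X" "\<eta>' = (Some \<circ> f') |` (U' \<inter> X)"
    using transfer_maps[OF assms(2)] by (rule local_mapE)
  have "(Some \<circ> (f' \<circ> f)) |` ({z \<in> U. f z \<in> U'} \<inter> X) \<in> maps"
    by (rule local_mapI[OF biholomorphic_compose[OF f(1) f'(1)]]) (use f(2) f'(2) in auto)
  also have "(Some \<circ> (f' \<circ> f)) |` ({z \<in> U. f z \<in> U'} \<inter> X) = \<eta>' \<circ>\<^sub>m \<eta>"
    unfolding f(3) f'(3) using f(2) by (auto simp: map_comp_def restrict_map_def fun_eq_iff)
  finally have m: "\<eta>' \<circ>\<^sub>m \<eta> \<in> maps" .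
  obtain n m where nm: "k = int n - int m" "\<And>z. z \<in> dom \<eta> \<Longrightarrow> (H ^^ n) z = (H ^^ m) (the (\<eta> z))"
    using assms(1) unfolding local_transfers_def by blast
  obtain n' m' where nm': "k' = int n' - int m'" "\<And>z. z \<in> dom \<eta>' \<Longrightarrow> (H ^^ n') z = (H ^^ m') (the (\<eta>' z))"
    using assms(2) unfolding local_transfers_def by blast
  have "(H ^^ (n' + n)) z = (H ^^ (m + m')) (the ((\<eta>' \<circ>\<^sub>m \<eta>) z))" if z: "z \<in> dom (\<eta>' \<circ>\<^sub>m \<eta>)" for z
  proof -
    obtain y y' where y: "\<eta> z = Some y" "\<eta>' y = Some y'" "(\<eta>' \<circ>\<^sub>m \<eta>) z = Some y'"
      using z by (auto simp: map_comp_Some_iff)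
    have "(H ^^ (n' + n)) z = (H ^^ n') ((H ^^ m) y)" using nm(2)[of z] y by (simp add: domIff funpow_add)
    also have "\<dots> = (H ^^ m) ((H ^^ n') y)" by (metis add.commute comp_apply funpow_add)
    also have "\<dots> = (H ^^ m) ((H ^^ m') y')" using nm'(2)[of y] y by (simp add: domIff)
    finally show ?thesis using y by (simp add: funpow_add)
  qed
  moreover have "k + k' = int (n' + n) - int (m + m')" using nm nm' by simp
  ultimately show ?thesis unfolding local_transfers_def using m by blast
qed

lemma transfer_inverse:
  assumes "\<eta> \<in> transfers k" shows "map_inverse \<eta> \<in> transfers (- k)"
proof -
  obtain U V f where f: "biholomorphic S \<A> U V f" "\<forall>z \<in> U. f z \<in> X \<longleftrightarrow> z \<in> X" "\<eta> = (Some \<circ> f) |` (U \<inter> X)"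
    using transfer_maps[OF assms] by (rule local_mapE)
  note F = biholomorphicD[OF f(1)]
  have "(Some \<circ> inv_into U f) |` (V \<inter> X) \<in> maps"
  proof (rule local_mapI[OF biholomorphic_inverse[OF f(1)]])
    show "\<forall>w \<in> V. inv_into U f w \<in> X \<longleftrightarrow> w \<in> X"
    proof
      fix w assume "w \<in> V"
      then show "inv_into U f w \<in> X \<longleftrightarrow> w \<in> X"
        using F(8,10)[of w] f(2)[rule_format, of "inv_into U f w"] by simp
    qed
  qed
  also have "(Some \<circ> inv_into U f) |` (V \<inter> X) = map_inverse \<eta>"
  proof
    fix w
    show "((Some \<circ> inv_into U f) |` (V \<inter> X)) w = map_inverse \<eta> w"
    proof (cases "w \<in> V \<inter> X")
      case True
      then have "inv_into U f w \<in> U \<inter> X" "f (inv_into U f w) = w"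
        using F(8,10)[of w] f(2)[rule_format, of "inv_into U f w"] by auto
      then have "\<eta> (inv_into U f w) = Some w" unfolding f(3) by (simp add: restrict_map_def)
      then have "map_inverse \<eta> w = Some (inv_into U f w)"
        using map_inverse_eq_Some[OF transfer_maps[OF assms]] by blast
      then show ?thesis using True by (simp add: restrict_map_def)
    next
      case False
      then have "w \<notin> dom (map_inverse \<eta>)"
        unfolding dom_map_inverse f(3) local_map_dom_ran(2)[OF f(1,2)] .
      then show ?thesis using False by (auto simp: restrict_map_def)
    qed
  qed
  finally have m: "map_inverse \<eta> \<in> maps" .
  obtain n m where nm: "k = int n - int m" "\<And>z. z \<in> dom \<eta> \<Longrightarrow> (H ^^ n) z = (H ^^ m) (the (\<eta> z))"
    using assms unfolding local_transfers_def by blast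
  have "(H ^^ m) w = (H ^^ n) (the (map_inverse \<eta> w))" if w: "w \<in> dom (map_inverse \<eta>)" for w
  proof -
    obtain z where z: "map_inverse \<eta> w = Some z" using w by blast
    then have "\<eta> z = Some w" using map_inverse_eq_Some[OF transfer_maps[OF assms]] by blast
    then show ?thesis using nm(2)[of z] z by (simp add: domIff)
  qed
  moreover have "- k = int m - int n" using nm by simp
  ultimately show ?thesis unfolding local_transfers_def using m by blast
qed

section \<open>The groupoid of germs\<close>

definition agree :: "'a \<Rightarrow> ('a \<rightharpoonup> 'a) \<Rightarrow> ('a \<rightharpoonup> 'a) \<Rightarrow> bool" where
  "agree x \<eta> \<theta> \<longleftrightarrow> (\<exists>W. openin X_top W \<and> x \<in> W \<and> W \<subseteq> dom \<eta> \<inter> dom \<theta> \<and> (\<forall>z \<in> W. \<eta> z = \<theta> z))"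

lemma agree_at: "agree x \<eta> \<theta> \<Longrightarrow> \<eta> x = \<theta> x"
  unfolding agree_def by blast

lemma agree_refl: "\<eta> \<in> maps \<Longrightarrow> \<eta> x = Some y \<Longrightarrow> agree x \<eta> \<eta>"
  unfolding agree_def using local_map_open(1) by blast

lemma agree_compose:
  assumes \<eta>: "\<eta> \<in> maps" and \<eta>\<theta>: "agree x \<eta> \<theta>" "\<eta> x = Some y" "agree y \<eta>' \<theta>'"
  shows "agree x (\<eta>' \<circ>\<^sub>m \<eta>) (\<theta>' \<circ>\<^sub>m \<theta>)"
proof -
  obtain W where W: "openin X_top W" "x \<in> W" "W \<subseteq> dom \<eta> \<inter> dom \<theta>" "\<And>z. z \<in> W \<Longrightarrow> \<eta> z = \<theta> z"
    using \<eta>\<theta>(1) unfolding agree_def by auto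
  obtain W' where W': "openin X_top W'" "y \<in> W'" "W' \<subseteq> dom \<eta>' \<inter> dom \<theta>'" "\<And>z. z \<in> W' \<Longrightarrow> \<eta>' z = \<theta>' z"
    using \<eta>\<theta>(3) unfolding agree_def by auto
  let ?W = "W \<inter> {z \<in> dom \<eta>. the (\<eta> z) \<in> W'}"
  have "openin X_top ?W" using W(1) local_map_preimage[OF \<eta> W'(1)] by (rule openin_Int)
  moreover have "x \<in> ?W" using W W' \<eta>\<theta>(2) by auto
  moreover have eq: "z \<in> dom (\<eta>' \<circ>\<^sub>m \<eta>) \<and> (\<eta>' \<circ>\<^sub>m \<eta>) z = (\<theta>' \<circ>\<^sub>m \<theta>) z" if z: "z \<in> ?W" for z
  proof -
    obtain w where w: "\<eta> z = Some w" "w \<in> W'" using z by auto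
    then have "\<theta> z = Some w" "\<eta>' w = \<theta>' w" "w \<in> dom \<eta>'" using W(4)[of z] W'(3,4) z by auto
    moreover from this obtain v where "\<eta>' w = Some v" by blast
    ultimately show ?thesis using w by (simp add: map_comp_def dom_def)
  qed
  moreover have "?W \<subseteq> dom (\<eta>' \<circ>\<^sub>m \<eta>) \<inter> dom (\<theta>' \<circ>\<^sub>m \<theta>)"
  proof
    fix z assume "z \<in> ?W"
    from eq[OF this] show "z \<in> dom (\<eta>' \<circ>\<^sub>m \<eta>) \<inter> dom (\<theta>' \<circ>\<^sub>m \<theta>)" by (metis IntI domIff)
  qed
  ultimately show ?thesis unfolding agree_def by (intro exI[of _ ?W] conjI ballI) blast+
qed

lemma agree_inverse:
  assumes \<eta>: "\<eta> \<in> transfers k" "\<theta> \<in> transfers k" and \<eta>\<theta>: "agree x \<eta> \<theta>" "\<eta> x = Some y"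
  shows "agree y (map_inverse \<eta>) (map_inverse \<theta>)"
proof -
  obtain W where W: "openin X_top W" "x \<in> W" "W \<subseteq> dom \<eta> \<inter> dom \<theta>" "\<And>z. z \<in> W \<Longrightarrow> \<eta> z = \<theta> z"
    using \<eta>\<theta>(1) unfolding agree_def by auto
  note inv = map_inverse_eq_Some[OF transfer_maps[OF \<eta>(1)]] map_inverse_eq_Some[OF transfer_maps[OF \<eta>(2)]]
  let ?W = "{w \<in> dom (map_inverse \<eta>). the (map_inverse \<eta> w) \<in> W}"
  have "openin X_top ?W"
    by (rule local_map_preimage[OF transfer_maps[OF transfer_inverse[OF \<eta>(1)]] W(1)])
  moreover have "map_inverse \<eta> y = Some x" using inv \<eta>\<theta>(2) by simp
  then have "y \<in> ?W" using W(2) by auto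
  moreover have eq: "map_inverse \<eta> w = map_inverse \<theta> w" if w: "w \<in> ?W" for w
  proof -
    obtain z where z: "map_inverse \<eta> w = Some z" "z \<in> W" using w by auto
    then have "\<theta> z = Some w" using W(4)[of z] inv by simp
    then have "map_inverse \<theta> w = Some z" using inv(2) by blast
    then show ?thesis using z(1) by simp
  qed
  moreover have "?W \<subseteq> dom (map_inverse \<eta>) \<inter> dom (map_inverse \<theta>)"
  proof
    fix w assume w: "w \<in> ?W"
    from eq[OF this] show "w \<in> dom (map_inverse \<eta>) \<inter> dom (map_inverse \<theta>)" using w by (auto simp: dom_def)
  qed
  ultimately show ?thesis unfolding agree_def by (intro exI[of _ ?W] conjI ballI) blast+
qed

text \<open>
  The fourth component of a quadruple is determined by the others. Without it, \<open>germ_at k \<eta>\<close> is a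
  section over \<open>dom \<eta>\<close>, and the basic open sets are images of such sections.
\<close>

definition germ_at :: "int \<Rightarrow> ('a \<rightharpoonup> 'a) \<Rightarrow> 'a \<Rightarrow> 'a quadruple set" where
  "germ_at k \<eta> x = germ S \<A> H X x k \<eta> (the (\<eta> x))"

lemma germ_germ_at: "\<eta> x = Some y \<Longrightarrow> germ S \<A> H X x k \<eta> y = germ_at k \<eta> x"
  by (simp add: germ_at_def)

lemma germ_cases:
  assumes "g \<in> germs S \<A> H X"
  obtains k \<eta> x y where "\<eta> \<in> transfers k" "\<eta> x = Some y" "g = germ_at k \<eta> x"
proof -
  obtain q where q: "q \<in> quadruples S \<A> H X" "g = germ_rel S \<A> H X `` {q}"
    using assms unfolding germs_def by (rule quotientE)
  obtain x k \<eta> y where "q = (x, k, \<eta>, y)" by (cases q) auto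
  then show ?thesis
    using q that[of \<eta> k x y] by (auto simp: quadruples_def germ_def germ_at_def)
qed

lemma germ_at_in:
  assumes "\<eta> \<in> transfers k" "\<eta> x = Some y" shows "germ_at k \<eta> x \<in> germs S \<A> H X"
  using assms unfolding germs_def germ_at_def germ_def by (auto intro!: quotientI simp: quadruples_def)

lemma germ_at_eq_iff:
  assumes "\<eta> \<in> transfers k" "\<eta> x = Some y" "\<eta>' \<in> transfers k'" "\<eta>' x' = Some y'"
  shows "germ_at k \<eta> x = germ_at k' \<eta>' x' \<longleftrightarrow> k = k' \<and> x = x' \<and> agree x \<eta> \<eta>'"
proof -
  have q: "(x, k, \<eta>, y) \<in> quadruples S \<A> H X" "(x', k', \<eta>', y') \<in> quadruples S \<A> H X"
    using assms by (auto simp: quadruples_def)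
  have "germ_at k \<eta> x = germ_at k' \<eta>' x' \<longleftrightarrow> ((x, k, \<eta>, y), (x', k', \<eta>', y')) \<in> germ_rel S \<A> H X"
    using germ_eq_iff[OF q] assms by (simp add: germ_at_def)
  also have "\<dots> \<longleftrightarrow> k = k' \<and> x = x' \<and> y = y' \<and> agree x \<eta> \<eta>'"
    using q unfolding germ_rel_def agree_def by auto
  also have "\<dots> \<longleftrightarrow> k = k' \<and> x = x' \<and> agree x \<eta> \<eta>'"
    using agree_at[of x \<eta> \<eta>'] assms by auto
  finally show ?thesis .
qed

lemma mem_germ_at_iff:
  assumes "\<eta> \<in> transfers k" "\<eta> x = Some y"
  shows "(x', k', \<theta>, y') \<in> germ_at k \<eta> x \<longleftrightarrow>
    x' = x \<and> k' = k \<and> y' = y \<and> \<theta> \<in> transfers k \<and> \<theta> x = Some y \<and> agree x \<eta> \<theta>"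
proof -
  have "(x', k', \<theta>, y') \<in> germ_at k \<eta> x \<longleftrightarrow> ((x, k, \<eta>, y), (x', k', \<theta>, y')) \<in> germ_rel S \<A> H X"
    using assms by (simp add: germ_at_def germ_def)
  also have "\<dots> \<longleftrightarrow> x' = x \<and> k' = k \<and> y' = y \<and> \<theta> \<in> transfers k \<and> \<theta> x = Some y \<and> agree x \<eta> \<theta>"
    unfolding germ_rel_def agree_def quadruples_def using assms by auto
  finally show ?thesis .
qed

lemma self_mem_germ_at:
  assumes "\<eta> \<in> transfers k" "\<eta> x = Some y" shows "(x, k, \<eta>, y) \<in> germ_at k \<eta> x"
  using mem_germ_at_iff[OF assms] assms agree_refl[OF transfer_maps[OF assms(1)] assms(2)] by simp

lemma germ_range_at:
  assumes "\<eta> \<in> transfers k" "\<eta> x = Some y" shows "germ_range (germ_at k \<eta> x) = x"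
  unfolding germ_range_def mem_germ_at_iff[OF assms]
  using assms agree_refl[OF transfer_maps[OF assms(1)] assms(2)] by (intro the_equality) blast+

lemma germ_source_at:
  assumes "\<eta> \<in> transfers k" "\<eta> x = Some y" shows "germ_source (germ_at k \<eta> x) = y"
  unfolding germ_source_def mem_germ_at_iff[OF assms]
  using assms agree_refl[OF transfer_maps[OF assms(1)] assms(2)] by (intro the_equality) blast+

text \<open>
  The definite description in the definition of the product has a unique value, because
  representatives that agree near \<open>x\<close> and near \<open>y\<close> have compositions that agree near \<open>x\<close>.
\<close>

lemma germ_mult_at:
  assumes \<eta>: "\<eta> \<in> transfers k" "\<eta> x = Some y" and \<eta>': "\<eta>' \<in> transfers k'" "\<eta>' y = Some y'"
  shows "germ_mult S \<A> H X (germ_at k \<eta> x) (germ_at k' \<eta>' y) = germ_at (k + k') (\<eta>' \<circ>\<^sub>m \<eta>) x"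
  unfolding germ_mult_def
proof (rule the_equality)
  have c: "(\<eta>' \<circ>\<^sub>m \<eta>) x = Some y'" using \<eta>(2) \<eta>'(2) by simp
  show "\<exists>x' l \<theta> w l' \<theta>' y''. (x', l, \<theta>, w) \<in> germ_at k \<eta> x \<and> (w, l', \<theta>', y'') \<in> germ_at k' \<eta>' y \<and>
      germ_at (k + k') (\<eta>' \<circ>\<^sub>m \<eta>) x = germ S \<A> H X x' (l + l') (\<theta>' \<circ>\<^sub>m \<theta>) y''"
    using self_mem_germ_at[OF \<eta>] self_mem_germ_at[OF \<eta>'] germ_germ_at[where \<eta> = "\<eta>' \<circ>\<^sub>m \<eta>", OF c] by metis
  fix d assume "\<exists>x' l \<theta> w l' \<theta>' y''. (x', l, \<theta>, w) \<in> germ_at k \<eta> x \<and> (w, l', \<theta>', y'') \<in> germ_at k' \<eta>' y \<and>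
      d = germ S \<A> H X x' (l + l') (\<theta>' \<circ>\<^sub>m \<theta>) y''"
  then obtain \<theta> \<theta>' where \<theta>: "\<theta> \<in> transfers k" "\<theta> x = Some y" "agree x \<eta> \<theta>"
    and \<theta>': "\<theta>' \<in> transfers k'" "\<theta>' y = Some y'" "agree y \<eta>' \<theta>'"
    and d: "d = germ S \<A> H X x (k + k') (\<theta>' \<circ>\<^sub>m \<theta>) y'"
    unfolding mem_germ_at_iff[OF \<eta>] mem_germ_at_iff[OF \<eta>'] by blast
  have c': "(\<theta>' \<circ>\<^sub>m \<theta>) x = Some y'" using \<theta>(2) \<theta>'(2) by simp
  have "agree x (\<eta>' \<circ>\<^sub>m \<eta>) (\<theta>' \<circ>\<^sub>m \<theta>)"
    by (rule agree_compose[OF transfer_maps[OF \<eta>(1)] \<theta>(3) \<eta>(2) \<theta>'(3)])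
  then show "d = germ_at (k + k') (\<eta>' \<circ>\<^sub>m \<eta>) x"
    unfolding d germ_germ_at[where \<eta> = "\<theta>' \<circ>\<^sub>m \<theta>", OF c']
    using germ_at_eq_iff[OF transfer_compose[OF \<eta>(1) \<eta>'(1)] c transfer_compose[OF \<theta>(1) \<theta>'(1)] c'] by simp
qed

lemma germ_inverse_at:
  assumes \<eta>: "\<eta> \<in> transfers k" "\<eta> x = Some y"
  shows "germ_inverse S \<A> H X (germ_at k \<eta> x) = germ_at (- k) (map_inverse \<eta>) y"
  unfolding germ_inverse_def
proof (rule the_equality)
  have c: "map_inverse \<eta> y = Some x" using map_inverse_eq_Some[OF transfer_maps[OF \<eta>(1)]] \<eta>(2) by simp
  show "\<exists>x' l \<theta> w. (x', l, \<theta>, w) \<in> germ_at k \<eta> x \<and>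
      germ_at (- k) (map_inverse \<eta>) y = germ S \<A> H X w (- l) (map_inverse \<theta>) x'"
    using self_mem_germ_at[OF \<eta>] germ_germ_at[where \<eta> = "map_inverse \<eta>", OF c] by metis
  fix d assume "\<exists>x' l \<theta> w. (x', l, \<theta>, w) \<in> germ_at k \<eta> x \<and> d = germ S \<A> H X w (- l) (map_inverse \<theta>) x'"
  then obtain \<theta> where \<theta>: "\<theta> \<in> transfers k" "\<theta> x = Some y" "agree x \<eta> \<theta>"
    and d: "d = germ S \<A> H X y (- k) (map_inverse \<theta>) x"
    unfolding mem_germ_at_iff[OF \<eta>] by blast
  have c': "map_inverse \<theta> y = Some x" using map_inverse_eq_Some[OF transfer_maps[OF \<theta>(1)]] \<theta>(2) by simp
  show "d = germ_at (- k) (map_inverse \<eta>) y"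
    unfolding d germ_germ_at[where \<eta> = "map_inverse \<theta>", OF c']
    using germ_at_eq_iff[OF transfer_inverse[OF \<eta>(1)] c transfer_inverse[OF \<theta>(1)] c']
      agree_inverse[OF \<eta>(1) \<theta>(1,3) \<eta>(2)] by simp
qed

lemma germ_unit_at: "x \<in> X \<Longrightarrow> germ_unit S \<A> H X x = germ_at 0 (Some |` X) x"
  by (simp add: germ_unit_def germ_at_def)

lemma composable_germ_cases:
  assumes "h \<in> germs S \<A> H X" "germ_range h = y"
  obtains k \<eta> z where "\<eta> \<in> transfers k" "\<eta> y = Some z" "h = germ_at k \<eta> y"
proof -
  obtain k \<eta> x z where h: "\<eta> \<in> transfers k" "\<eta> x = Some z" "h = germ_at k \<eta> x"
    using assms(1) by (rule germ_cases)
  then have "x = y" using germ_range_at assms(2) by metis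
  then show ?thesis using that h by blast
qed

lemma groupoid_germs:
  "groupoid (germs S \<A> H X) X germ_range germ_source (germ_unit S \<A> H X) (germ_mult S \<A> H X) (germ_inverse S \<A> H X)"
proof
  let ?G = "germs S \<A> H X" and ?m = "germ_mult S \<A> H X" and ?i = "germ_inverse S \<A> H X" and ?e = "germ_unit S \<A> H X"
  have id: "(Some |` X) x = Some x" if "x \<in> X" for x using that by simp
  have in_X: "x \<in> X" "y \<in> X" if "\<eta> \<in> transfers k" "\<eta> x = Some y" for k \<eta> x y
    using local_map_open(3,4)[OF transfer_maps[OF that(1)]] that(2) by (auto simp: ran_def dom_def)
  fix g assume g: "g \<in> ?G"
  obtain k \<eta> x y where \<eta>: "\<eta> \<in> transfers k" "\<eta> x = Some y" and geq: "g = germ_at k \<eta> x"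
    using g by (rule germ_cases)
  note rg = germ_range_at[OF \<eta>, folded geq] and sg = germ_source_at[OF \<eta>, folded geq]
  show "germ_range g \<in> X" "germ_source g \<in> X" using rg sg in_X[OF \<eta>] by auto
  have inv: "map_inverse \<eta> \<in> transfers (- k)" "map_inverse \<eta> y = Some x"
    using transfer_inverse[OF \<eta>(1)] map_inverse_eq_Some[OF transfer_maps[OF \<eta>(1)]] \<eta>(2) by auto
  have ig: "?i g = germ_at (- k) (map_inverse \<eta>) y" unfolding geq by (rule germ_inverse_at[OF \<eta>])
  show "?i g \<in> ?G" unfolding ig by (rule germ_at_in[OF inv])
  show "germ_range (?i g) = germ_source g" unfolding ig sg by (rule germ_range_at[OF inv])
  show "germ_source (?i g) = germ_range g" unfolding ig rg by (rule germ_source_at[OF inv])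
  show "?m (?e (germ_range g)) g = g"
  proof -
    have "?m (?e x) g = germ_at (0 + k) (\<eta> \<circ>\<^sub>m (Some |` X)) x"
      unfolding germ_unit_at[OF in_X(1)[OF \<eta>]] geq
      by (rule germ_mult_at[OF transfer_identity id[OF in_X(1)[OF \<eta>]] \<eta>])
    also have "\<eta> \<circ>\<^sub>m (Some |` X) = \<eta>"
    proof
      fix z show "(\<eta> \<circ>\<^sub>m (Some |` X)) z = \<eta> z"
        using in_X(1)[OF \<eta>(1), of z] by (cases "\<eta> z") (auto simp: map_comp_def restrict_map_def)
    qed
    finally show ?thesis using rg geq by simp
  qed
  show "?m g (?e (germ_source g)) = g"
  proof -
    have "?m g (?e y) = germ_at (k + 0) ((Some |` X) \<circ>\<^sub>m \<eta>) x"
      unfolding germ_unit_at[OF in_X(2)[OF \<eta>]] geq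
      by (rule germ_mult_at[OF \<eta> transfer_identity id[OF in_X(2)[OF \<eta>]]])
    also have "(Some |` X) \<circ>\<^sub>m \<eta> = \<eta>"
      using local_map_open(4)[OF transfer_maps[OF \<eta>(1)]]
      by (auto simp: map_comp_def restrict_map_def fun_eq_iff ran_def split: option.splits)
    finally show ?thesis using sg geq by simp
  qed
  have agree_id: "agree z (map_inverse \<zeta> \<circ>\<^sub>m \<zeta>) (Some |` X)" if \<zeta>: "\<zeta> \<in> transfers l" "\<zeta> z = Some w" for l \<zeta> z w
  proof -
    have "(map_inverse \<zeta> \<circ>\<^sub>m \<zeta>) z' = Some z'" if "z' \<in> dom \<zeta>" for z'
      using that map_inverse_eq_Some[OF transfer_maps[OF \<zeta>(1)]] by (auto simp: map_comp_def)
    then show ?thesis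
      unfolding agree_def using local_map_open(1,3)[OF transfer_maps[OF \<zeta>(1)]] \<zeta>(2)
      by (intro exI[of _ "dom \<zeta>"]) auto
  qed
  show "?m g (?i g) = ?e (germ_range g)"
  proof -
    have "?m g (?i g) = germ_at (k + - k) (map_inverse \<eta> \<circ>\<^sub>m \<eta>) x"
      unfolding ig unfolding geq by (rule germ_mult_at[OF \<eta> inv])
    also have "\<dots> = germ_at 0 (Some |` X) x"
      using germ_at_eq_iff[OF transfer_compose[OF \<eta>(1) inv(1)] _ transfer_identity id[OF in_X(1)[OF \<eta>]], of x x]
        \<eta>(2) inv(2) agree_id[OF \<eta>] by simp
    finally show ?thesis unfolding rg germ_unit_at[OF in_X(1)[OF \<eta>]] .
  qed
  show "?m (?i g) g = ?e (germ_source g)"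
  proof -
    have mi: "map_inverse (map_inverse \<eta>) = \<eta>"
    proof
      fix z
      have "map_inverse (map_inverse \<eta>) z = Some w \<longleftrightarrow> \<eta> z = Some w" for w
        using map_inverse_eq_Some[OF transfer_maps[OF inv(1)]] map_inverse_eq_Some[OF transfer_maps[OF \<eta>(1)]] by simp
      then show "map_inverse (map_inverse \<eta>) z = \<eta> z" by (metis option.exhaust)
    qed
    have "?m (?i g) g = germ_at (- k + k) (\<eta> \<circ>\<^sub>m map_inverse \<eta>) y"
      unfolding ig unfolding geq by (rule germ_mult_at[OF inv \<eta>])
    also have "\<dots> = germ_at 0 (Some |` X) y"
      using germ_at_eq_iff[OF transfer_compose[OF inv(1) \<eta>(1)] _ transfer_identity id[OF in_X(2)[OF \<eta>]], of y y]
        \<eta>(2) inv(2) agree_id[OF inv] mi by simp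
    finally show ?thesis unfolding sg germ_unit_at[OF in_X(2)[OF \<eta>]] .
  qed
  fix h assume h: "h \<in> ?G" "germ_source g = germ_range h"
  obtain k' \<eta>' z where \<eta>': "\<eta>' \<in> transfers k'" "\<eta>' y = Some z" and heq: "h = germ_at k' \<eta>' y"
    using h(1) h(2)[symmetric, unfolded sg] by (rule composable_germ_cases)
  note gh = germ_mult_at[OF \<eta> \<eta>', folded geq heq]
  have c: "\<eta>' \<circ>\<^sub>m \<eta> \<in> transfers (k + k')" "(\<eta>' \<circ>\<^sub>m \<eta>) x = Some z"
    using transfer_compose[OF \<eta>(1) \<eta>'(1)] \<eta>(2) \<eta>'(2) by auto
  show "?m g h \<in> ?G" unfolding gh by (rule germ_at_in[OF c])
  show "germ_range (?m g h) = germ_range g" unfolding gh rg by (rule germ_range_at[OF c])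
  show "germ_source (?m g h) = germ_source h"
    unfolding gh unfolding heq germ_source_at[OF \<eta>'] by (rule germ_source_at[OF c])
  fix j assume j: "j \<in> ?G" "germ_source h = germ_range j"
  obtain k'' \<eta>'' w where \<eta>'': "\<eta>'' \<in> transfers k''" "\<eta>'' z = Some w" and jeq: "j = germ_at k'' \<eta>'' z"
    using j(1) j(2)[symmetric, unfolded heq germ_source_at[OF \<eta>']] by (rule composable_germ_cases)
  have c': "\<eta>'' \<circ>\<^sub>m \<eta>' \<in> transfers (k' + k'')" "(\<eta>'' \<circ>\<^sub>m \<eta>') y = Some w"
    using transfer_compose[OF \<eta>'(1) \<eta>''(1)] \<eta>'(2) \<eta>''(2) by auto
  have "?m (?m g h) j = germ_at (k + k' + k'') (\<eta>'' \<circ>\<^sub>m (\<eta>' \<circ>\<^sub>m \<eta>)) x"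
    unfolding gh unfolding jeq by (rule germ_mult_at[OF c \<eta>''])
  also have "\<eta>'' \<circ>\<^sub>m (\<eta>' \<circ>\<^sub>m \<eta>) = (\<eta>'' \<circ>\<^sub>m \<eta>') \<circ>\<^sub>m \<eta>"
    by (auto simp: map_comp_def fun_eq_iff split: option.splits)
  also have "germ_at (k + k' + k'') ((\<eta>'' \<circ>\<^sub>m \<eta>') \<circ>\<^sub>m \<eta>) x = ?m g (germ_at (k' + k'') (\<eta>'' \<circ>\<^sub>m \<eta>') y)"
    unfolding geq germ_mult_at[OF \<eta> c'] by (simp add: add.assoc)
  also have "germ_at (k' + k'') (\<eta>'' \<circ>\<^sub>m \<eta>') y = ?m h j"
    unfolding heq jeq by (rule germ_mult_at[OF \<eta>' \<eta>'', symmetric])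
  finally show "?m (?m g h) j = ?m g (?m h j)" .
next
  let ?G = "germs S \<A> H X"
  fix x assume x: "x \<in> X"
  have id: "(Some |` X) x = Some x" using x by simp
  show "germ_unit S \<A> H X x \<in> ?G" unfolding germ_unit_at[OF x] by (rule germ_at_in[OF transfer_identity id])
  show "germ_range (germ_unit S \<A> H X x) = x" unfolding germ_unit_at[OF x] by (rule germ_range_at[OF transfer_identity id])
  show "germ_source (germ_unit S \<A> H X x) = x" unfolding germ_unit_at[OF x] by (rule germ_source_at[OF transfer_identity id])
qed

section \<open>The topology of the groupoid of germs\<close>

abbreviation "germ_top \<equiv> germ_topology S \<A> H X"

lemma openin_germ_top_iff:
  "openin germ_top W \<longleftrightarrow> (\<forall>g \<in> W. \<exists>k \<eta> U. \<eta> \<in> transfers k \<and> openin X_top U \<and> U \<subseteq> dom \<eta> \<and>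
     g \<in> germ_at k \<eta> ` U \<and> germ_at k \<eta> ` U \<subseteq> W)"
proof -
  have base: "germ_base S \<A> H X = {germ_at k \<eta> ` U |k \<eta> U. \<eta> \<in> transfers k \<and> openin X_top U \<and> U \<subseteq> dom \<eta>}"
    unfolding germ_base_def germ_at_def by simp
  have "(\<exists>B. B \<in> germ_base S \<A> H X \<and> g \<in> B \<and> B \<subseteq> W) \<longleftrightarrow> (\<exists>k \<eta> U. \<eta> \<in> transfers k \<and> openin X_top U \<and>
      U \<subseteq> dom \<eta> \<and> g \<in> germ_at k \<eta> ` U \<and> germ_at k \<eta> ` U \<subseteq> W)" (is "?L \<longleftrightarrow> ?R") for g
  proof
    assume ?L
    then obtain B where "B \<in> germ_base S \<A> H X" "g \<in> B" "B \<subseteq> W" by auto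
    then show ?R unfolding base by auto
  next
    assume ?R
    then obtain k \<eta> U where *: "\<eta> \<in> transfers k" "openin X_top U" "U \<subseteq> dom \<eta>"
      "g \<in> germ_at k \<eta> ` U" "germ_at k \<eta> ` U \<subseteq> W" by (elim exE conjE)
    then have "germ_at k \<eta> ` U \<in> germ_base S \<A> H X" unfolding base by auto
    with * show ?L by (intro exI conjI)
  qed
  then show ?thesis unfolding openin_germ_topology arbitrary_union_of_alt by simp
qed

lemma openin_section:
  assumes "\<eta> \<in> transfers k" "openin X_top U" "U \<subseteq> dom \<eta>"
  shows "openin germ_top (germ_at k \<eta> ` U)"
  unfolding openin_germ_top_iff using assms by blast

text \<open>
  A basic set around the germ is the image of another section, which agrees with the given one near
  \<open>x\<close>. This is the only argument about the topology of germs; the continuity of all structure maps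
  follows from it.
\<close>

lemma section_neighbourhood:
  assumes \<eta>: "\<eta> \<in> transfers k" "x \<in> dom \<eta>" and W: "openin germ_top W" "germ_at k \<eta> x \<in> W"
  shows "\<exists>U. openin X_top U \<and> x \<in> U \<and> U \<subseteq> dom \<eta> \<and> germ_at k \<eta> ` U \<subseteq> W"
proof -
  obtain y where y: "\<eta> x = Some y" using \<eta>(2) by blast
  obtain l \<theta> U where \<theta>: "\<theta> \<in> transfers l" "openin X_top U" "U \<subseteq> dom \<theta>"
    "germ_at k \<eta> x \<in> germ_at l \<theta> ` U" "germ_at l \<theta> ` U \<subseteq> W"
    using W unfolding openin_germ_top_iff by meson
  then obtain z where z: "z \<in> U" "germ_at k \<eta> x = germ_at l \<theta> z" by blast
  then obtain w where w: "\<theta> z = Some w" using \<theta>(3) by blast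
  have eq: "k = l" "x = z" "agree x \<eta> \<theta>"
    using germ_at_eq_iff[OF \<eta>(1) y \<theta>(1) w] z(2) by auto
  obtain N where N: "openin X_top N" "x \<in> N" "N \<subseteq> dom \<eta> \<inter> dom \<theta>" "\<forall>z \<in> N. \<eta> z = \<theta> z"
    using eq(3) unfolding agree_def by blast
  have "germ_at k \<eta> z' \<in> W" if z': "z' \<in> N \<inter> U" for z'
  proof -
    obtain w' where w': "\<eta> z' = Some w'" using z' N(3) by blast
    then have "\<theta> z' = Some w'" using N(4) z' by simp
    moreover have "agree z' \<eta> \<theta>" using N z' unfolding agree_def by blast
    ultimately have "germ_at k \<eta> z' = germ_at l \<theta> z'"
      using germ_at_eq_iff[OF \<eta>(1) w' \<theta>(1), of z'] eq(1) by simp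
    then show ?thesis using \<theta>(5) z' by auto
  qed
  moreover have "openin X_top (N \<inter> U)" using N(1) \<theta>(2) by (rule openin_Int)
  moreover have "x \<in> N \<inter> U" "N \<inter> U \<subseteq> dom \<eta>" using N z eq by auto
  ultimately show ?thesis by (intro exI[of _ "N \<inter> U"]) blast
qed

lemma topspace_dom:
  assumes "\<eta> \<in> transfers k" shows "topspace (subtopology S (dom \<eta>)) = dom \<eta>"
  using local_map_open(3)[OF transfer_maps[OF assms]] X_subset by auto

lemma subtopology_dom:
  assumes "\<eta> \<in> transfers k"
  shows "subtopology X_top (dom \<eta>) = subtopology S (dom \<eta>)" "subtopology X_top (ran \<eta>) = subtopology S (ran \<eta>)"
  using local_map_open(3,4)[OF transfer_maps[OF assms]] by (simp_all add: subtopology_subtopology Int_absorb1)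

lemma section_in:
  assumes "\<eta> \<in> transfers k" "x \<in> dom \<eta>" shows "germ_at k \<eta> x \<in> topspace germ_top"
  using assms germ_at_in[OF assms(1)] by (auto simp: topspace_germ_topology)

lemma continuous_section:
  assumes \<eta>: "\<eta> \<in> transfers k"
  shows "continuous_map (subtopology S (dom \<eta>)) germ_top (germ_at k \<eta>)"
  unfolding continuous_map_def topspace_dom[OF \<eta>]
proof (intro conjI allI impI)
  show "germ_at k \<eta> \<in> dom \<eta> \<rightarrow> topspace germ_top" using section_in[OF \<eta>] by blast
  fix W assume W: "openin germ_top W"
  have "openin X_top {x \<in> dom \<eta>. germ_at k \<eta> x \<in> W}"
  proof (subst openin_subopen, intro ballI)
    fix x assume "x \<in> {x \<in> dom \<eta>. germ_at k \<eta> x \<in> W}"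
    then have "x \<in> dom \<eta>" "germ_at k \<eta> x \<in> W" by auto
    from section_neighbourhood[OF \<eta> this(1) W this(2)]
    show "\<exists>T. openin X_top T \<and> x \<in> T \<and> T \<subseteq> {x \<in> dom \<eta>. germ_at k \<eta> x \<in> W}" by blast
  qed
  then have "openin (subtopology X_top (dom \<eta>)) {x \<in> dom \<eta>. germ_at k \<eta> x \<in> W}"
    unfolding openin_subtopology[of X_top] by (intro exI conjI) auto
  then show "openin (subtopology S (dom \<eta>)) {x \<in> dom \<eta>. germ_at k \<eta> x \<in> W}"
    unfolding subtopology_dom[OF \<eta>] .
qed

lemma continuous_map_germI:
  assumes im: "\<And>g. g \<in> topspace germ_top \<Longrightarrow> f g \<in> topspace Y"
    and loc: "\<And>k \<eta> x y W. \<eta> \<in> transfers k \<Longrightarrow> \<eta> x = Some y \<Longrightarrow> openin Y W \<Longrightarrow> f (germ_at k \<eta> x) \<in> W \<Longrightarrow>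
      \<exists>U. openin X_top U \<and> x \<in> U \<and> U \<subseteq> dom \<eta> \<and> (\<forall>z \<in> U. f (germ_at k \<eta> z) \<in> W)"
  shows "continuous_map germ_top Y f"
  unfolding continuous_map_def
proof (intro conjI allI impI)
  show "f \<in> topspace germ_top \<rightarrow> topspace Y" using im by blast
  fix W assume W: "openin Y W"
  show "openin germ_top {g \<in> topspace germ_top. f g \<in> W}"
  proof (subst openin_subopen, intro ballI)
    fix g assume "g \<in> {g \<in> topspace germ_top. f g \<in> W}"
    then have g: "g \<in> germs S \<A> H X" "f g \<in> W" by (auto simp: topspace_germ_topology)
    obtain k \<eta> x y where \<eta>: "\<eta> \<in> transfers k" "\<eta> x = Some y" "g = germ_at k \<eta> x"
      using g(1) by (rule germ_cases)
    obtain U where U: "openin X_top U" "x \<in> U" "U \<subseteq> dom \<eta>" "\<forall>z \<in> U. f (germ_at k \<eta> z) \<in> W"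
      using loc[OF \<eta>(1,2) W] g(2) \<eta>(3) by blast
    have "germ_at k \<eta> ` U \<subseteq> {g \<in> topspace germ_top. f g \<in> W}"
      using U(3,4) section_in[OF \<eta>(1)] by blast
    moreover have "g \<in> germ_at k \<eta> ` U" using \<eta>(3) U(2) by blast
    ultimately show "\<exists>T. openin germ_top T \<and> g \<in> T \<and> T \<subseteq> {g \<in> topspace germ_top. f g \<in> W}"
      using openin_section[OF \<eta>(1) U(1,3)] by blast
  qed
qed

interpretation grpd: groupoid "germs S \<A> H X" X germ_range germ_source
    "germ_unit S \<A> H X" "germ_mult S \<A> H X" "germ_inverse S \<A> H X"
  by (rule groupoid_germs)

lemma continuous_germ_range: "continuous_map germ_top X_top germ_range"
proof (rule continuous_map_germI)
  show "germ_range g \<in> topspace X_top" if "g \<in> topspace germ_top" for g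
    using that grpd.range_in by (simp add: topspace_germ_topology topspace_X del: topspace_subtopology)
  fix k \<eta> x y W assume \<eta>: "\<eta> \<in> transfers k" "\<eta> x = Some y" and W: "openin X_top W" "germ_range (germ_at k \<eta> x) \<in> W"
  have "openin X_top (W \<inter> dom \<eta>)" using W(1) local_map_open(1)[OF transfer_maps[OF \<eta>(1)]] by (rule openin_Int)
  moreover have "\<forall>z \<in> W \<inter> dom \<eta>. germ_range (germ_at k \<eta> z) \<in> W"
    using germ_range_at[OF \<eta>(1)] by auto
  ultimately show "\<exists>U. openin X_top U \<and> x \<in> U \<and> U \<subseteq> dom \<eta> \<and> (\<forall>z \<in> U. germ_range (germ_at k \<eta> z) \<in> W)"
    using W(2) \<eta>(2) germ_range_at[OF \<eta>] by (intro exI[of _ "W \<inter> dom \<eta>"]) auto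
qed

lemma continuous_germ_source: "continuous_map germ_top X_top germ_source"
proof (rule continuous_map_germI)
  show "germ_source g \<in> topspace X_top" if "g \<in> topspace germ_top" for g
    using that grpd.source_in by (simp add: topspace_germ_topology topspace_X del: topspace_subtopology)
  fix k \<eta> x y W assume \<eta>: "\<eta> \<in> transfers k" "\<eta> x = Some y" and W: "openin X_top W" "germ_source (germ_at k \<eta> x) \<in> W"
  let ?U = "{z \<in> dom \<eta>. the (\<eta> z) \<in> W}"
  have "openin X_top ?U" by (rule local_map_preimage[OF transfer_maps[OF \<eta>(1)] W(1)])
  moreover have "\<forall>z \<in> ?U. germ_source (germ_at k \<eta> z) \<in> W"
    using germ_source_at[OF \<eta>(1)] by auto
  ultimately show "\<exists>U. openin X_top U \<and> x \<in> U \<and> U \<subseteq> dom \<eta> \<and> (\<forall>z \<in> U. germ_source (germ_at k \<eta> z) \<in> W)"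
    using W(2) \<eta>(2) germ_source_at[OF \<eta>] by (intro exI[of _ ?U]) auto
qed

lemma continuous_germ_unit: "continuous_map X_top germ_top (germ_unit S \<A> H X)"
proof -
  have "dom (Some |` X) = X" by (auto simp: restrict_map_def split: if_splits)
  then have "continuous_map X_top germ_top (germ_at 0 (Some |` X))"
    using continuous_section[OF transfer_identity] by simp
  then show ?thesis by (rule continuous_map_eq) (simp add: germ_unit_at)
qed

lemma continuous_germ_inverse: "continuous_map germ_top germ_top (germ_inverse S \<A> H X)"
proof (rule continuous_map_germI)
  show "germ_inverse S \<A> H X g \<in> topspace germ_top" if "g \<in> topspace germ_top" for g
    using that grpd.inv_in by (simp add: topspace_germ_topology)
  fix k \<eta> x y W assume \<eta>: "\<eta> \<in> transfers k" "\<eta> x = Some y"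
    and W: "openin germ_top W" "germ_inverse S \<A> H X (germ_at k \<eta> x) \<in> W"
  have inv: "map_inverse \<eta> \<in> transfers (- k)" "map_inverse \<eta> y = Some x"
    using transfer_inverse[OF \<eta>(1)] map_inverse_eq_Some[OF transfer_maps[OF \<eta>(1)]] \<eta>(2) by auto
  then have "y \<in> dom (map_inverse \<eta>)" by blast
  from section_neighbourhood[OF inv(1) this W(1) W(2)[unfolded germ_inverse_at[OF \<eta>]]]
  obtain V where V: "openin X_top V" "y \<in> V" "germ_at (- k) (map_inverse \<eta>) ` V \<subseteq> W" by blast
  let ?U = "{z \<in> dom \<eta>. the (\<eta> z) \<in> V}"
  have "openin X_top ?U" by (rule local_map_preimage[OF transfer_maps[OF \<eta>(1)] V(1)])
  moreover have "\<forall>z \<in> ?U. germ_inverse S \<A> H X (germ_at k \<eta> z) \<in> W"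
    using germ_inverse_at[OF \<eta>(1)] V(3) by auto
  ultimately show "\<exists>U. openin X_top U \<and> x \<in> U \<and> U \<subseteq> dom \<eta> \<and> (\<forall>z \<in> U. germ_inverse S \<A> H X (germ_at k \<eta> z) \<in> W)"
    using V(2) \<eta>(2) by (intro exI[of _ ?U]) auto
qed

text \<open>
  Near a pair of composable germs the product is the section of \<open>\<eta>' \<circ>\<^sub>m \<eta>\<close> at the range of the first
  factor.
\<close>

lemma continuous_germ_mult:
  defines "C \<equiv> {(g, h). g \<in> topspace germ_top \<and> h \<in> topspace germ_top \<and> germ_source g = germ_range h}"
  shows "continuous_map (subtopology (prod_topology germ_top germ_top) C) germ_top (\<lambda>(g, h). germ_mult S \<A> H X g h)"
proof -
  let ?P = "subtopology (prod_topology germ_top germ_top) C" and ?m = "\<lambda>(g, h). germ_mult S \<A> H X g h"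
  have top: "topspace ?P = C" by (auto simp: C_def)
  have "openin ?P {p \<in> C. ?m p \<in> W}" if W: "openin germ_top W" for W
  proof (subst openin_subopen, intro ballI)
    fix p assume p: "p \<in> {p \<in> C. ?m p \<in> W}"
    obtain g h where gh: "p = (g, h)" by (cases p)
    have g: "g \<in> germs S \<A> H X" "h \<in> germs S \<A> H X" "germ_source g = germ_range h" "germ_mult S \<A> H X g h \<in> W"
      using p gh by (auto simp: C_def topspace_germ_topology)
    obtain k \<eta> x y where \<eta>: "\<eta> \<in> transfers k" "\<eta> x = Some y" "g = germ_at k \<eta> x"
      using g(1) by (rule germ_cases)
    have "germ_range h = y" using g(3) germ_source_at[OF \<eta>(1,2)] \<eta>(3) by simp
    then obtain k' \<eta>' y' where \<eta>': "\<eta>' \<in> transfers k'" "\<eta>' y = Some y'" "h = germ_at k' \<eta>' y"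
      using composable_germ_cases[OF g(2)] by metis
    have c: "\<eta>' \<circ>\<^sub>m \<eta> \<in> transfers (k + k')" "(\<eta>' \<circ>\<^sub>m \<eta>) x = Some y'"
      using transfer_compose[OF \<eta>(1) \<eta>'(1)] \<eta>(2) \<eta>'(2) by auto
    then have "x \<in> dom (\<eta>' \<circ>\<^sub>m \<eta>)" by blast
    moreover have "germ_at (k + k') (\<eta>' \<circ>\<^sub>m \<eta>) x \<in> W"
      using g(4) germ_mult_at[OF \<eta>(1,2) \<eta>'(1,2)] \<eta>(3) \<eta>'(3) by simp
    ultimately obtain U where U: "openin X_top U" "x \<in> U" "U \<subseteq> dom (\<eta>' \<circ>\<^sub>m \<eta>)" "germ_at (k + k') (\<eta>' \<circ>\<^sub>m \<eta>) ` U \<subseteq> W"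
      using section_neighbourhood[OF c(1) _ W] by blast
    have Ud: "U \<subseteq> dom \<eta>" using U(3) by (auto simp: map_comp_def split: option.splits)
    let ?N = "germ_at k \<eta> ` U" and ?N' = "germ_at k' \<eta>' ` dom \<eta>'"
    let ?T = "(?N \<times> ?N') \<inter> C"
    have "openin germ_top ?N" by (rule openin_section[OF \<eta>(1) U(1) Ud])
    moreover have "openin germ_top ?N'"
      by (rule openin_section[OF \<eta>'(1) local_map_open(1)[OF transfer_maps[OF \<eta>'(1)]] subset_refl])
    ultimately have "openin (prod_topology germ_top germ_top) (?N \<times> ?N')"
      by (simp add: openin_prod_Times_iff)
    then have "openin ?P ?T" unfolding openin_subtopology by blast
    moreover have "y \<in> dom \<eta>'" using \<eta>'(2) by blast
    then have "p \<in> ?T" using p gh \<eta>(3) \<eta>'(3) U(2) by blast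
    moreover have "?T \<subseteq> {p \<in> C. ?m p \<in> W}"
    proof
      fix q assume q: "q \<in> ?T"
      then obtain z w where z: "z \<in> U" "w \<in> dom \<eta>'" "q = (germ_at k \<eta> z, germ_at k' \<eta>' w)" by blast
      obtain w' v where w': "\<eta> z = Some w'" and v: "\<eta>' w = Some v" using z Ud by blast
      have "germ_source (germ_at k \<eta> z) = germ_range (germ_at k' \<eta>' w)"
        using q z(3) by (auto simp: C_def)
      then have "w' = w" using germ_source_at[OF \<eta>(1) w'] germ_range_at[OF \<eta>'(1) v] by simp
      then have "?m q = germ_at (k + k') (\<eta>' \<circ>\<^sub>m \<eta>) z"
        using germ_mult_at[OF \<eta>(1) w' \<eta>'(1)] v z(3) by simp
      then show "q \<in> {p \<in> C. ?m p \<in> W}" using U(4) z(1) q by auto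
    qed
    ultimately show "\<exists>T. openin ?P T \<and> p \<in> T \<and> T \<subseteq> {p \<in> C. ?m p \<in> W}" by blast
  qed
  moreover have "?m \<in> C \<rightarrow> topspace germ_top"
    using grpd.mult_in by (auto simp: C_def topspace_germ_topology)
  ultimately show ?thesis unfolding continuous_map_def top by blast
qed

text \<open>
  The section is a continuous inverse.
\<close>

lemma homeomorphic_range_section:
  assumes \<eta>: "\<eta> \<in> transfers k"
  shows "homeomorphic_map (subtopology germ_top (germ_at k \<eta> ` dom \<eta>)) (subtopology S (dom \<eta>)) germ_range"
proof -
  let ?N = "germ_at k \<eta> ` dom \<eta>"
  have r: "germ_range (germ_at k \<eta> x) = x" if "x \<in> dom \<eta>" for x
    using germ_range_at[OF \<eta>] that by blast
  have N: "topspace (subtopology germ_top ?N) = ?N" using section_in[OF \<eta>] by auto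
  have "homeomorphic_maps (subtopology germ_top ?N) (subtopology S (dom \<eta>)) germ_range (germ_at k \<eta>)"
    unfolding homeomorphic_maps_def N topspace_dom[OF \<eta>]
  proof (intro conjI ballI)
    have "germ_range g \<in> dom \<eta>" if "g \<in> ?N" for g using that r by (elim imageE) simp
    then have "continuous_map (subtopology germ_top ?N) (subtopology X_top (dom \<eta>)) germ_range"
      using continuous_map_from_subtopology[OF continuous_germ_range, of ?N] N
      unfolding continuous_map_in_subtopology[of _ X_top] by auto
    then show "continuous_map (subtopology germ_top ?N) (subtopology S (dom \<eta>)) germ_range"
      by (simp only: subtopology_dom[OF \<eta>])
    show "continuous_map (subtopology S (dom \<eta>)) (subtopology germ_top ?N) (germ_at k \<eta>)"
      using continuous_section[OF \<eta>] by (auto simp: continuous_map_in_subtopology)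
    show "germ_at k \<eta> (germ_range g) = g" if "g \<in> ?N" for g using that by (elim imageE) (simp add: r)
    show "germ_range (germ_at k \<eta> x) = x" if "x \<in> dom \<eta>" for x using that by (rule r)
  qed
  then show ?thesis using homeomorphic_map_maps by blast
qed

lemma local_homeomorphism_range: "local_homeomorphism_map germ_top X_top germ_range"
  unfolding local_homeomorphism_map_def topspace_germ_topology
proof
  fix g assume "g \<in> germs S \<A> H X"
  then obtain k \<eta> x y where \<eta>: "\<eta> \<in> transfers k" "\<eta> x = Some y" "g = germ_at k \<eta> x"
    by (rule germ_cases)
  let ?N = "germ_at k \<eta> ` dom \<eta>"
  have dom: "openin X_top (dom \<eta>)" by (rule local_map_open(1)[OF transfer_maps[OF \<eta>(1)]])
  have im: "germ_range ` ?N = dom \<eta>"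
    using germ_range_at[OF \<eta>(1)] by (force simp: image_image)
  have "x \<in> dom \<eta>" using \<eta>(2) by blast
  then have "g \<in> ?N" using \<eta>(3) by blast
  then show "\<exists>U. openin germ_top U \<and> g \<in> U \<and> openin X_top (germ_range ` U) \<and>
      homeomorphic_map (subtopology germ_top U) (subtopology X_top (germ_range ` U)) germ_range"
    using openin_section[OF \<eta>(1) dom subset_refl] dom homeomorphic_range_section[OF \<eta>(1)]
    by (intro exI[of _ ?N]) (simp only: im subtopology_dom[OF \<eta>(1)] simp_thms)
qed

lemma local_homeomorphism_source: "local_homeomorphism_map germ_top X_top germ_source"
  unfolding local_homeomorphism_map_def topspace_germ_topology
proof
  fix g assume "g \<in> germs S \<A> H X"
  then obtain k \<eta> x y where \<eta>: "\<eta> \<in> transfers k" "\<eta> x = Some y" "g = germ_at k \<eta> x"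
    by (rule germ_cases)
  let ?N = "germ_at k \<eta> ` dom \<eta>"
  note m = transfer_maps[OF \<eta>(1)]
  have rs: "germ_range (germ_at k \<eta> z) = z" "germ_source (germ_at k \<eta> z) = the (\<eta> z)" if "z \<in> dom \<eta>" for z
    using germ_range_at[OF \<eta>(1)] germ_source_at[OF \<eta>(1)] that by auto
  have "homeomorphic_map (subtopology germ_top ?N) (subtopology S (ran \<eta>)) ((\<lambda>z. the (\<eta> z)) \<circ> germ_range)"
    using homeomorphic_range_section[OF \<eta>(1)] local_map_homeomorphic[OF m] by (rule homeomorphic_map_compose)
  then have hom: "homeomorphic_map (subtopology germ_top ?N) (subtopology S (ran \<eta>)) germ_source"
  proof (rule homeomorphic_map_eq)
    fix g assume "g \<in> topspace (subtopology germ_top ?N)"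
    then obtain z where "z \<in> dom \<eta>" "g = germ_at k \<eta> z" by auto
    then show "((\<lambda>z. the (\<eta> z)) \<circ> germ_range) g = germ_source g" using rs by simp
  qed
  have im: "germ_source ` ?N = ran \<eta>"
  proof -
    have "germ_source ` ?N = (\<lambda>z. the (\<eta> z)) ` dom \<eta>"
      unfolding image_image using rs by (intro image_cong) auto
    also have "\<dots> = ran \<eta>"
    proof (intro subset_antisym subsetI)
      fix w assume "w \<in> ran \<eta>"
      then obtain z where "\<eta> z = Some w" by (auto simp: ran_def)
      then show "w \<in> (\<lambda>z. the (\<eta> z)) ` dom \<eta>" by (intro image_eqI[of _ _ z]) auto
    qed (auto intro: ranI)
    finally show ?thesis .
  qed
  have "x \<in> dom \<eta>" using \<eta>(2) by blast
  then have "g \<in> ?N" using \<eta>(3) by blast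
  then show "\<exists>U. openin germ_top U \<and> g \<in> U \<and> openin X_top (germ_source ` U) \<and>
      homeomorphic_map (subtopology germ_top U) (subtopology X_top (germ_source ` U)) germ_source"
    using openin_section[OF \<eta>(1) local_map_open(1)[OF m] subset_refl] local_map_open(2)[OF m] hom
    by (intro exI[of _ ?N]) (simp only: im subtopology_dom[OF \<eta>(1)] simp_thms)
qed

lemma etale_groupoid_germs:
  "etale_groupoid germ_top X_top germ_range germ_source (germ_unit S \<A> H X) (germ_mult S \<A> H X) (germ_inverse S \<A> H X)"
proof -
  have g: "groupoid (topspace germ_top) (topspace X_top) germ_range germ_source
      (germ_unit S \<A> H X) (germ_mult S \<A> H X) (germ_inverse S \<A> H X)"
    unfolding topspace_germ_topology topspace_X by (rule groupoid_germs)
  show ?thesis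
    by (intro etale_groupoid.intro topological_groupoid.intro topological_groupoid_axioms.intro
        etale_groupoid_axioms.intro g continuous_germ_range continuous_germ_source continuous_germ_unit
        continuous_germ_mult continuous_germ_inverse local_homeomorphism_range local_homeomorphism_source)
qed

lemma locally_compact_germs:
  assumes "locally_compact_space X_top" shows "locally_compact_space germ_top"
  unfolding locally_compact_space_def topspace_germ_topology
proof
  fix g assume "g \<in> germs S \<A> H X"
  then obtain k \<eta> x y where \<eta>: "\<eta> \<in> transfers k" "\<eta> x = Some y" "g = germ_at k \<eta> x"
    by (rule germ_cases)
  have dom: "openin X_top (dom \<eta>)" by (rule local_map_open(1)[OF transfer_maps[OF \<eta>(1)]])
  have "Hausdorff_space X_top" using Hausdorff by (rule Hausdorff_space_subtopology)
  then have "locally_compact_space (subtopology X_top (dom \<eta>))"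
    using locally_compact_space_open_subset[OF disjI1] assms dom by blast
  then have "locally_compact_space (subtopology S (dom \<eta>))" unfolding subtopology_dom[OF \<eta>(1)] .
  moreover have xd: "x \<in> dom \<eta>" using \<eta>(2) by blast
  ultimately obtain U K where U: "openin (subtopology S (dom \<eta>)) U" "compactin (subtopology S (dom \<eta>)) K" "x \<in> U" "U \<subseteq> K"
    unfolding locally_compact_space_def topspace_dom[OF \<eta>(1)] by blast
  have "openin X_top U" "U \<subseteq> dom \<eta>"
    using openin_trans_full[OF _ dom, of U] U(1) openin_subset[OF U(1)]
    unfolding subtopology_dom[OF \<eta>(1)] topspace_dom[OF \<eta>(1)] by auto
  then have "openin germ_top (germ_at k \<eta> ` U)" by (rule openin_section[OF \<eta>(1)])
  moreover have "compactin germ_top (germ_at k \<eta> ` K)"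
    using U(2) continuous_section[OF \<eta>(1)] by (rule image_compactin)
  ultimately show "\<exists>U K. openin germ_top U \<and> compactin germ_top K \<and> g \<in> U \<and> U \<subseteq> K"
    using U(3,4) \<eta>(3) by blast
qed

end

section \<open>Separation and countability\<close>

locale perfect_surface_subset = surface_subset +
  assumes perfect: "x \<in> X \<Longrightarrow> \<not> openin X_top {x}"
begin

lemma accumulation:
  assumes "openin X_top W" "x \<in> W" "W \<subseteq> A" shows "x \<in> S derived_set_of A"
  unfolding in_derived_set_of
proof (intro conjI allI impI)
  have xX: "x \<in> X" using openin_subset[OF assms(1)] assms(2) topspace_X by blast
  then show "x \<in> topspace S" using X_subset by blast
  fix T assume T: "x \<in> T \<and> openin S T"
  have "openin X_top (W \<inter> (T \<inter> X))" using assms(1) T openin_X by blast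
  then have "W \<inter> (T \<inter> X) \<noteq> {x}" using perfect[OF xX] by auto
  moreover have "x \<in> W \<inter> (T \<inter> X)" using assms(2) T xX by blast
  ultimately show "\<exists>y. y \<noteq> x \<and> y \<in> A \<and> y \<in> T" using assms(3) by blast
qed

lemma equal_on_connected:
  assumes f: "biholomorphic S \<A> U V f" "biholomorphic S \<A> U' V' f'"
    and D: "openin S D" "connectedin S D" "D \<subseteq> U \<inter> U'"
    and W: "openin X_top W" "x \<in> W" "x \<in> D" "\<And>z. z \<in> W \<Longrightarrow> f z = f' z" and "z \<in> D"
  shows "f z = f' z"
proof (rule identity_theorem[OF biholomorphicD(1)[OF f(1)] biholomorphicD(1)[OF f(2)] D W(3) _ \<open>z \<in> D\<close>])
  show "x \<in> S derived_set_of {z. f z = f' z}" by (rule accumulation[OF W(1,2)]) (use W(4) in auto)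
qed

text \<open>
  The only case in which the base points and the degrees do not separate the germs is that of two
  transfers of the same degree at the same point. If their sections met over every neighbourhood, the
  extensions would agree near a point of a connected neighbourhood \<open>D\<close> of \<open>x\<close>, hence on \<open>D\<close>, and
  the two germs would be equal.
\<close>

lemma Hausdorff_germs: "Hausdorff_space germ_top"
  unfolding Hausdorff_space_def topspace_germ_topology
proof (intro allI impI, elim conjE)
  fix g h assume g: "g \<in> germs S \<A> H X" and h: "h \<in> germs S \<A> H X" and gh: "g \<noteq> h"
  obtain k \<eta> x y where \<eta>: "\<eta> \<in> transfers k" "\<eta> x = Some y" and geq: "g = germ_at k \<eta> x"
    using g by (rule germ_cases)
  obtain l \<theta> x' y' where \<theta>: "\<theta> \<in> transfers l" "\<theta> x' = Some y'" and heq: "h = germ_at l \<theta> x'"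
    using h by (rule germ_cases)
  note m\<eta> = transfer_maps[OF \<eta>(1)] and m\<theta> = transfer_maps[OF \<theta>(1)]
  have in_dom: "x \<in> dom \<eta>" "x' \<in> dom \<theta>" using \<eta>(2) \<theta>(2) by blast+
  \<comment> \<open>It suffices to find neighbourhoods of the base points over which the two sections do not meet.\<close>
  have reduce: "\<exists>P Q. openin germ_top P \<and> openin germ_top Q \<and> g \<in> P \<and> h \<in> Q \<and> disjnt P Q"
    if N: "openin X_top N" "x \<in> N" "N \<subseteq> dom \<eta>" and N': "openin X_top N'" "x' \<in> N'" "N' \<subseteq> dom \<theta>"
      and dj: "\<And>z. z \<in> N \<Longrightarrow> z \<in> N' \<Longrightarrow> k = l \<Longrightarrow> agree z \<eta> \<theta> \<Longrightarrow> False" for N N'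
  proof -
    have "germ_at k \<eta> z \<noteq> germ_at l \<theta> z'" if z: "z \<in> N" "z' \<in> N'" for z z'
    proof
      assume eq: "germ_at k \<eta> z = germ_at l \<theta> z'"
      obtain w w' where "\<eta> z = Some w" "\<theta> z' = Some w'" using z N(3) N'(3) by blast
      from germ_at_eq_iff[OF \<eta>(1) this(1) \<theta>(1) this(2)] eq have "k = l" "z = z'" "agree z \<eta> \<theta>" by auto
      then show False using dj z by blast
    qed
    then have "disjnt (germ_at k \<eta> ` N) (germ_at l \<theta> ` N')" unfolding disjnt_def by blast
    then show ?thesis
      using openin_section[OF \<eta>(1) N(1,3)] openin_section[OF \<theta>(1) N'(1,3)] N(2) N'(2) geq heq
      by (intro exI[of _ "germ_at k \<eta> ` N"] exI[of _ "germ_at l \<theta> ` N'"]) simp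
  qed
  show "\<exists>P Q. openin germ_top P \<and> openin germ_top Q \<and> g \<in> P \<and> h \<in> Q \<and> disjnt P Q"
  proof (cases "x = x' \<and> k = l")
    case False
    show ?thesis
    proof (cases "k = l")
      case True
      then have "x \<noteq> x'" using False by blast
      moreover have "Hausdorff_space X_top" using Hausdorff by (rule Hausdorff_space_subtopology)
      moreover have "x \<in> topspace X_top" "x' \<in> topspace X_top"
        using in_dom local_map_open(3)[OF m\<eta>] local_map_open(3)[OF m\<theta>] topspace_X by blast+
      ultimately obtain P Q where PQ: "openin X_top P" "openin X_top Q" "x \<in> P" "x' \<in> Q" "disjnt P Q"
        unfolding Hausdorff_space_def by meson
      show ?thesis
      proof (rule reduce)
        show "openin X_top (P \<inter> dom \<eta>)" "openin X_top (Q \<inter> dom \<theta>)"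
          using PQ local_map_open(1)[OF m\<eta>] local_map_open(1)[OF m\<theta>] by blast+
        show "False" if "z \<in> P \<inter> dom \<eta>" "z \<in> Q \<inter> dom \<theta>" for z
          using that PQ(5) unfolding disjnt_def by blast
      qed (use PQ in_dom in auto)
    next
      case False
      show ?thesis
        by (rule reduce[OF local_map_open(1)[OF m\<eta>] in_dom(1) subset_refl local_map_open(1)[OF m\<theta>] in_dom(2) subset_refl])
          (use False in blast)
    qed
  next
    case True
    then have nag: "\<not> agree x \<eta> \<theta>" using gh germ_at_eq_iff[OF \<eta> \<theta>] geq heq by blast
    obtain U V f where f: "biholomorphic S \<A> U V f" "\<forall>z \<in> U. f z \<in> X \<longleftrightarrow> z \<in> X" "\<eta> = (Some \<circ> f) |` (U \<inter> X)"
      using m\<eta> by (rule local_mapE)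
    obtain U' V' f' where f': "biholomorphic S \<A> U' V' f'" "\<forall>z \<in> U'. f' z \<in> X \<longleftrightarrow> z \<in> X" "\<theta> = (Some \<circ> f') |` (U' \<inter> X)"
      using m\<theta> by (rule local_mapE)
    have doms: "dom \<eta> = U \<inter> X" "dom \<theta> = U' \<inter> X"
      unfolding f(3) f'(3) using local_map_dom_ran(1)[OF f(1,2)] local_map_dom_ran(1)[OF f'(1,2)] by simp_all
    have "openin S (U \<inter> U')" using biholomorphicD(5)[OF f(1)] biholomorphicD(5)[OF f'(1)] by (rule openin_Int)
    moreover have xU: "x \<in> U \<inter> U'" "x \<in> X" using in_dom doms True by auto
    ultimately obtain D where D: "openin S D" "connectedin S D" "x \<in> D" "D \<subseteq> U \<inter> U'"
      using connected_chart_neighbourhood by metis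
    have DX: "openin X_top (D \<inter> X)" by (rule openin_X[OF D(1)])
    show ?thesis
    proof (rule reduce[OF DX _ _ DX])
      fix z assume z: "z \<in> D \<inter> X" "agree z \<eta> \<theta>"
      then obtain W where W: "openin X_top W" "z \<in> W" "W \<subseteq> dom \<eta> \<inter> dom \<theta>" "\<forall>w \<in> W. \<eta> w = \<theta> w"
        unfolding agree_def by blast
      have "f w = f' w" if "w \<in> W" for w
      proof -
        have "w \<in> U \<inter> X" "w \<in> U' \<inter> X" "\<eta> w = \<theta> w" using W(3,4) that doms by auto
        then show ?thesis unfolding f(3) f'(3) by (simp add: restrict_map_def)
      qed
      from equal_on_connected[OF f(1) f'(1) D(1,2,4) W(1,2) _ this]
      have eq: "f w = f' w" if "w \<in> D" for w using that z(1) by simp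
      have "\<eta> w = \<theta> w" if "w \<in> D \<inter> X" for w
        using eq[of w] that D(4) unfolding f(3) f'(3) by (auto simp: restrict_map_def)
      moreover have "D \<inter> X \<subseteq> dom \<eta> \<inter> dom \<theta>" using D(4) doms by auto
      moreover have "x \<in> D \<inter> X" using D(3) xU by blast
      ultimately have "agree x \<eta> \<theta>" unfolding agree_def using DX by blast
      then show False using nag by blast
    qed (use D xU doms True in auto)
  qed
qed

text \<open>
  A germ is described by the exponents \<open>n\<close> and \<open>m\<close>, a connected set \<open>D\<close> from a countable base, a point
  \<open>q\<close> from a countable dense subset of \<open>X\<close>, and a basic set \<open>B\<close> around \<open>\<eta> q\<close> on which \<open>H\<^sup>m\<close> is
  injective. One transfer is chosen for each tuple that occurs, and its section is cut down by the
  members of a countable base of the surface.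
\<close>

lemma second_countable_germs:
  assumes conn: "connected_space S" and H: "surface_holomorphic_on S \<A> (topspace S) H"
    and nc: "\<not> (\<exists>c. \<forall>z \<in> topspace S. H z = c)"
  shows "second_countable germ_top"
proof -
  have sc: "second_countable S" using conn by (rule Rado)
  obtain \<B> where \<B>: "countable \<B>" "\<And>V. V \<in> \<B> \<Longrightarrow> openin S V"
    "\<And>U x. openin S U \<Longrightarrow> x \<in> U \<Longrightarrow> \<exists>V \<in> \<B>. x \<in> V \<and> V \<subseteq> U"
    using sc unfolding second_countable_def by metis
  have "\<exists>D. openin S D \<and> connectedin S D \<and> x \<in> D \<and> D \<subseteq> W" if "openin S W" "x \<in> W" for W x
    using connected_chart_neighbourhood[OF that] by metis
  from second_countable_refinement[OF sc, of "connectedin S", OF this]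
  obtain \<D> where \<D>: "countable \<D>" "\<And>D. D \<in> \<D> \<Longrightarrow> openin S D" "\<And>D. D \<in> \<D> \<Longrightarrow> connectedin S D"
    "\<And>W x. openin S W \<Longrightarrow> x \<in> W \<Longrightarrow> \<exists>D \<in> \<D>. x \<in> D \<and> D \<subseteq> W"
    by metis
  have "separable_space X_top"
    using second_countable_subtopology[OF sc] by (rule second_countable_imp_separable_space)
  then obtain Q where Q: "countable Q" "Q \<subseteq> X" "X_top closure_of Q = X"
    unfolding separable_space_def topspace_X by blast
  have dense: "\<exists>q \<in> Q. q \<in> W" if "openin X_top W" "x \<in> W" for W x
  proof -
    have "x \<in> X_top closure_of Q" using openin_subset[OF that(1)] that(2) Q(3) topspace_X by blast
    then show ?thesis using that unfolding in_closure_of by blast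
  qed
  define R where "R d k \<eta> \<longleftrightarrow> (case d of (n, m, D, q, B) \<Rightarrow> \<eta> \<in> transfers k \<and> k = int n - int m \<and>
      (\<forall>z \<in> dom \<eta>. (H ^^ n) z = (H ^^ m) (the (\<eta> z))) \<and>
      (\<exists>U V f. biholomorphic S \<A> U V f \<and> (\<forall>z \<in> U. f z \<in> X \<longleftrightarrow> z \<in> X) \<and> \<eta> = (Some \<circ> f) |` (U \<inter> X) \<and>
         D \<subseteq> U \<and> q \<in> D \<and> f q \<in> B \<and> inj_on (H ^^ m) B))" for d k \<eta>
  define data where "data = (UNIV :: nat set) \<times> (UNIV :: nat set) \<times> \<D> \<times> Q \<times> \<B>"
  have data_count: "countable data" unfolding data_def using \<D>(1) Q(1) \<B>(1) by auto
  \<comment> \<open>Near \<open>q\<close> both extensions map into \<open>B\<close>, and there \<open>H\<^sup>m\<close> can be cancelled from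
    \<open>H\<^sup>m (f z) = H\<^sup>n z = H\<^sup>m (f' z)\<close>. The identity theorem spreads the equality over \<open>D\<close>.\<close>
  have unique: "k = k' \<and> D \<inter> X \<subseteq> dom \<eta> \<inter> dom \<eta>' \<and> (\<forall>z \<in> D \<inter> X. \<eta> z = \<eta>' z)"
    if d: "(n, m, D, q, B) \<in> data" and R1: "R (n, m, D, q, B) k \<eta>" and R2: "R (n, m, D, q, B) k' \<eta>'"
    for n m D q B k \<eta> k' \<eta>'
  proof -
    have D: "D \<in> \<D>" "q \<in> X" "B \<in> \<B>" using d Q(2) unfolding data_def by auto
    obtain U V f where f: "biholomorphic S \<A> U V f" "\<forall>z \<in> U. f z \<in> X \<longleftrightarrow> z \<in> X" "\<eta> = (Some \<circ> f) |` (U \<inter> X)"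
      "D \<subseteq> U" "q \<in> D" "f q \<in> B" "inj_on (H ^^ m) B" and e: "k = int n - int m"
      "\<forall>z \<in> dom \<eta>. (H ^^ n) z = (H ^^ m) (the (\<eta> z))"
      using R1 unfolding R_def by auto
    obtain U' V' f' where f': "biholomorphic S \<A> U' V' f'" "\<forall>z \<in> U'. f' z \<in> X \<longleftrightarrow> z \<in> X" "\<eta>' = (Some \<circ> f') |` (U' \<inter> X)"
      "D \<subseteq> U'" "f' q \<in> B" and e': "k' = int n - int m"
      "\<forall>z \<in> dom \<eta>'. (H ^^ n) z = (H ^^ m) (the (\<eta>' z))"
      using R2 unfolding R_def by auto
    have doms: "dom \<eta> = U \<inter> X" "dom \<eta>' = U' \<inter> X"
      unfolding f(3) f'(3) using local_map_dom_ran(1)[OF f(1,2)] local_map_dom_ran(1)[OF f'(1,2)] by simp_all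
    let ?N = "D \<inter> ({z \<in> U. f z \<in> B} \<inter> {z \<in> U'. f' z \<in> B})"
    have "openin S ?N"
      using \<D>(2)[OF D(1)] surface_holomorphic_preimage[OF biholomorphicD(1)[OF f(1)] \<B>(2)[OF D(3)]]
        surface_holomorphic_preimage[OF biholomorphicD(1)[OF f'(1)] \<B>(2)[OF D(3)]]
      by (intro openin_Int)
    then have NX: "openin X_top (?N \<inter> X)" by (rule openin_X)
    have qN: "q \<in> ?N \<inter> X" using f f' D(2) by auto
    have feq: "f z = f' z" if z: "z \<in> ?N \<inter> X" for z
    proof -
      have "z \<in> U" "z \<in> U'" "z \<in> X" "f z \<in> B" "f' z \<in> B" using z by auto
      moreover from this have "\<eta> z = Some (f z)" "\<eta>' z = Some (f' z)"
        unfolding f(3) f'(3) by (simp_all add: restrict_map_def)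
      ultimately have "(H ^^ m) (f z) = (H ^^ n) z" "(H ^^ m) (f' z) = (H ^^ n) z"
        using e(2)[rule_format, of z] e'(2)[rule_format, of z] doms by simp_all
      then show ?thesis using inj_onD[OF f(7), of "f z" "f' z"] \<open>f z \<in> B\<close> \<open>f' z \<in> B\<close> by simp
    qed
    have "D \<subseteq> U \<inter> U'" using f(4) f'(4) by blast
    from equal_on_connected[OF f(1) f'(1) \<D>(2)[OF D(1)] \<D>(3)[OF D(1)] this NX qN f(5) feq]
    have "f z = f' z" if "z \<in> D" for z using that by simp
    then have "\<forall>z \<in> D \<inter> X. \<eta> z = \<eta>' z"
      using f(4) f'(4) unfolding f(3) f'(3) by (auto simp: restrict_map_def)
    then show ?thesis using doms f(4) f'(4) e(1) e'(1) by auto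
  qed
  \<comment> \<open>\<open>H\<^sup>m\<close> may fail to be injective near \<open>f x\<close>, but it is injective near \<open>f x'\<close> for some point \<open>x'\<close> of
    \<open>X\<close> close to \<open>x\<close>; the point \<open>q\<close> is taken near \<open>x'\<close>.\<close>
  have exists: "\<exists>n m D q B. (n, m, D, q, B) \<in> data \<and> R (n, m, D, q, B) k \<eta> \<and> x \<in> D"
    if \<eta>: "\<eta> \<in> transfers k" "\<eta> x = Some y" for k \<eta> x y
  proof -
    obtain n m where nm: "k = int n - int m" "\<forall>z \<in> dom \<eta>. (H ^^ n) z = (H ^^ m) (the (\<eta> z))"
      using \<eta>(1) unfolding local_transfers_def by blast
    obtain U V f where f: "biholomorphic S \<A> U V f" "\<forall>z \<in> U. f z \<in> X \<longleftrightarrow> z \<in> X" "\<eta> = (Some \<circ> f) |` (U \<inter> X)"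
      using transfer_maps[OF \<eta>(1)] by (rule local_mapE)
    note F = biholomorphicD[OF f(1)]
    have x: "x \<in> U" "x \<in> X" "y = f x"
      using \<eta>(2) unfolding f(3) by (auto simp: restrict_map_def split: if_splits)
    obtain D where D: "D \<in> \<D>" "x \<in> D" "D \<subseteq> U" using \<D>(4)[OF F(5) x(1)] by blast
    have "f x \<in> topspace S" by (rule surface_holomorphic_image[OF F(1) x(1)])
    moreover have "locally_injective_off_isolated (H ^^ m)"
      by (rule locally_injective_funpow[OF holomorphic_locally_injective[OF conn H nc]])
    ultimately obtain W where W: "openin S W" "f x \<in> W" "\<And>w. w \<in> W - {f x} \<Longrightarrow> injective_near (H ^^ m) w"
      unfolding locally_injective_off_isolated_def by meson
    have "openin S (D \<inter> {z \<in> U. f z \<in> W})"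
      using \<D>(2)[OF D(1)] surface_holomorphic_preimage[OF F(1) W(1)] by (rule openin_Int)
    from accumulation[OF openin_X[OF this], of x] D x W(2)
    have "x \<in> S derived_set_of (D \<inter> {z \<in> U. f z \<in> W} \<inter> X)" by auto
    moreover have "openin S (topspace S)" "x \<in> topspace S" using x X_subset by auto
    ultimately obtain x' where x': "x' \<noteq> x" "x' \<in> D" "x' \<in> U" "f x' \<in> W" "x' \<in> X"
      unfolding in_derived_set_of by blast
    have "f x' \<noteq> f x" using F(4) x' x(1) by (auto dest: inj_onD)
    then obtain N where N: "openin S N" "f x' \<in> N" "inj_on (H ^^ m) N"
      using W(3)[of "f x'"] x'(4) unfolding injective_near_def by blast
    have "openin S (D \<inter> {z \<in> U. f z \<in> N})"
      using \<D>(2)[OF D(1)] surface_holomorphic_preimage[OF F(1) N(1)] by (rule openin_Int)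
    from dense[OF openin_X[OF this], of x'] x' N(2)
    obtain q where q: "q \<in> Q" "q \<in> D" "f q \<in> N" by auto
    obtain B where B: "B \<in> \<B>" "f q \<in> B" "B \<subseteq> N" using \<B>(3)[OF N(1) q(3)] by blast
    have "inj_on (H ^^ m) B" using N(3) B(3) by (rule inj_on_subset)
    then have "R (n, m, D, q, B) k \<eta>"
      unfolding R_def prod.case using \<eta>(1) nm f D(3) q(2) B(2) by blast
    moreover have "(n, m, D, q, B) \<in> data" unfolding data_def using D(1) q(1) B(1) by simp
    ultimately show ?thesis using D(2) by blast
  qed
  define c where "c d = (SOME p. R d (fst p) (snd p))" for d
  have Rc: "R d (fst (c d)) (snd (c d))" if "R d k \<eta>" for d k \<eta>
    unfolding c_def by (rule someI[of "\<lambda>p. R d (fst p) (snd p)" "(k, \<eta>)"]) (simp add: that)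
  define b where "b d V = germ_at (fst (c d)) (snd (c d)) ` (fst (snd (snd d)) \<inter> X \<inter> V)" for d V
  define base where "base = (\<lambda>(d, V). b d V) ` ({d \<in> data. \<exists>k \<eta>. R d k \<eta>} \<times> \<B>)"
  have "countable base" unfolding base_def
    using data_count \<B>(1) by (intro countable_image countable_SIGMA) (auto intro: countable_subset)
  moreover have "openin germ_top A" if A: "A \<in> base" for A
  proof -
    obtain d V k \<eta> where d: "d \<in> data" "R d k \<eta>" "V \<in> \<B>" "A = b d V"
      using A unfolding base_def by auto
    obtain n m D q B where deq: "d = (n, m, D, q, B)" by (cases d)
    obtain k' \<eta>' where c: "c d = (k', \<eta>')" by (cases "c d")
    have R': "R (n, m, D, q, B) k' \<eta>'" using Rc[OF d(2)] c deq by simp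
    then have "\<eta>' \<in> transfers k'" unfolding R_def prod.case by (rule conjunct1)
    moreover have "D \<inter> X \<subseteq> dom \<eta>'" using unique[OF d(1)[unfolded deq] R' R'] by simp
    moreover have "openin X_top (D \<inter> X \<inter> V)"
    proof -
      have "D \<in> \<D>" using d(1) unfolding deq data_def by simp
      then have "openin S (D \<inter> V)" using \<D>(2) \<B>(2)[OF d(3)] by blast
      then show ?thesis using openin_X[of "D \<inter> V"] by (simp add: Int_ac)
    qed
    ultimately have "openin germ_top (germ_at k' \<eta>' ` (D \<inter> X \<inter> V))" by (intro openin_section) auto
    then show ?thesis using c unfolding d(4) b_def deq by simp
  qed
  moreover have "\<exists>A \<in> base. g \<in> A \<and> A \<subseteq> W" if W: "openin germ_top W" "g \<in> W" for W g
  proof -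
    have "g \<in> germs S \<A> H X" using openin_subset[OF W(1)] W(2) topspace_germ_topology by blast
    then obtain k \<eta> x y where \<eta>: "\<eta> \<in> transfers k" "\<eta> x = Some y" "g = germ_at k \<eta> x"
      by (rule germ_cases)
    obtain n m D q B where d: "(n, m, D, q, B) \<in> data" "R (n, m, D, q, B) k \<eta>" "x \<in> D"
      using exists[OF \<eta>(1,2)] by blast
    let ?d = "(n, m, D, q, B)"
    obtain k' \<eta>' where c: "c ?d = (k', \<eta>')" by (cases "c ?d")
    have R': "R ?d k' \<eta>'" using Rc[OF d(2)] c by simp
    then have \<eta>': "\<eta>' \<in> transfers k'" unfolding R_def prod.case by (rule conjunct1)
    have eq: "k = k'" "D \<inter> X \<subseteq> dom \<eta> \<inter> dom \<eta>'" "\<forall>z \<in> D \<inter> X. \<eta> z = \<eta>' z"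
      using unique[OF d(1,2) R'] by simp_all
    have "D \<in> \<D>" using d(1) unfolding data_def by simp
    then have DX: "openin X_top (D \<inter> X)" using openin_X \<D>(2) by blast
    have xX: "x \<in> X" using \<eta>(2) local_map_open(3)[OF transfer_maps[OF \<eta>(1)]] by blast
    then have xDX: "x \<in> D \<inter> X" using d(3) by blast
    then have "agree x \<eta> \<eta>'" unfolding agree_def using DX eq(2,3) by blast
    moreover have "\<eta>' x = Some y" using eq(3) xDX \<eta>(2) by simp
    ultimately have g: "g = germ_at k' \<eta>' x" using germ_at_eq_iff[OF \<eta>(1,2) \<eta>'] \<eta>(3) eq(1) by simp
    have xd: "x \<in> dom \<eta>'" using eq(2) xDX by blast
    from section_neighbourhood[OF \<eta>' xd W(1)] W(2) g
    obtain N where N: "openin X_top N" "x \<in> N" "germ_at k' \<eta>' ` N \<subseteq> W" by blast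
    obtain N' where N': "openin S N'" "N = N' \<inter> X" using N(1) unfolding openin_subtopology by blast
    obtain V where V: "V \<in> \<B>" "x \<in> V" "V \<subseteq> N'" using \<B>(3)[OF N'(1)] N(2) N'(2) by blast
    have "b ?d V = germ_at k' \<eta>' ` (D \<inter> X \<inter> V)" unfolding b_def c by simp
    moreover have "germ_at k' \<eta>' ` (D \<inter> X \<inter> V) \<subseteq> W" using N(3) N'(2) V(3) by blast
    moreover have "g \<in> germ_at k' \<eta>' ` (D \<inter> X \<inter> V)" using g xDX V(2) by blast
    moreover have "b ?d V \<in> base" unfolding base_def using d(1,2) V(1) by (intro image_eqI[of _ _ "(?d, V)"]) auto
    ultimately show ?thesis by (intro bexI[of _ "b ?d V"]) simp_all
  qed
  ultimately show ?thesis unfolding second_countable_def by (intro exI[of _ base]) blast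
qed

end

theorem proposition4p3:
  fixes S :: "'a topology" and \<A> :: "('a set \<times> ('a \<Rightarrow> complex)) set"
    and H :: "'a \<Rightarrow> 'a" and X :: "'a set"
  assumes "riemann_surface S \<A>" and "connected_space S"
    and "surface_holomorphic_on S \<A> (topspace S) H"
    and "\<not> (\<exists>c. \<forall>z \<in> topspace S. H z = c)"
    and "X \<subseteq> topspace S"
    and "locally_compact_space (subtopology S X)"
    and "\<forall>x \<in> X. \<not> openin (subtopology S X) {x}"
    and "{z \<in> topspace S. H z \<in> X} = X"
  shows "second_countable (germ_topology S \<A> H X) \<and>
    etale_groupoid (germ_topology S \<A> H X) (subtopology S X)
      germ_range germ_source (germ_unit S \<A> H X)
      (germ_mult S \<A> H X) (germ_inverse S \<A> H X) \<and>
    locally_compact_space (germ_topology S \<A> H X) \<and>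
    Hausdorff_space (germ_topology S \<A> H X)"
proof -
  interpret perfect_surface_subset S \<A> H X
    using assms(1,5,7) by unfold_locales auto
  show ?thesis
    using second_countable_germs[OF assms(2-4)] etale_groupoid_germs
      locally_compact_germs[OF assms(6)] Hausdorff_germs by blast
qed

end
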